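(* Let $f$ be a Bernstein function satisfying the standing assumptions of the context, and let $S^c=(S^c_t)_{t\ge0}$ be the censored decreasing subordinator constructed in the context, with arbitrary starting point $S^c_0=x>0$ and cemetery $\partial$. Then $S^c$ is a strong Markov process.
   Context: Standing assumptions. $f$ is a complete Bernstein function with characteristics $(0,\mu)$: $f(\lambda)=\int_0^\infty(1-e^{-\lambda x})\,\mu(dx)$ for $\lambda>0$, where $\mu$ is a measure on $(0,\infty)$ with $\int_0^\infty\min\{1,x\}\,\mu(dx)<\infty$ which has a completely monotone density with respect to Lebesgue measure. Moreover $\lim_{\lambda\to0}\frac1{f(\lambda)}=\infty$, $\lim_{\lambda\to\infty}\frac1{f(\lambda)}=0$, $\lim_{\lambda\to0}\frac{\lambda}{f(\lambda)}=0$, $\lim_{\lambda\to\infty}\frac{\lambda}{f(\lambda)}=\infty$. Construction of $S^c$ (piecing together). Let $S^1,S^2,\dots$ be i.i.d. subordinators (Lévy processes with increasing càdlàg paths started at $0$) with $\mathbb E[e^{-\lambda S^j_t}]=e^{-tf(\lambda)}$. Fix $x>0$. Put $\tau_0=0$, $Y_0=x$ and recursively for $j\ge1$ $$\sigma_j=\inf\{s>0:\ S^j_s>Y_{j-1}\},\qquad \tau_j=\sum_{i=1}^j\sigma_i,\qquad Y_j=Y_{j-1}-S^j_{\sigma_j-}.$$ Let $\tau_\infty=\lim_{j\to\infty}\tau_j$ and set $$S^c_t=Y_{j-1}-S^j_{t-\tau_{j-1}}\ \text{ for }\tau_{j-1}\le t<\tau_j,\ j\ge1,\qquad S^c_t=\partial\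 \text{ for }t\ge\tau_\infty .$$ Thus $S^c_{\tau_j}=S^c_{\tau_j-}=Y_j$: jumps which would take the process out of $(0,\infty)$ are suppressed and the process is restarted from the position just before such a jump. (Null sets on which some $Y_j=0$ are ignored.) $\mathbb P^x,\mathbb E^x$ denote probability and expectation for the process started at $x$; the state space is $(0,\infty)\cup\{\partial\}$; the strong Markov property is understood with respect to the natural filtration of the process. *)

theory Defs
  imports "HOL-Probability.Probability"
begin

section \<open>Bernstein functions\<close>

definition completely_monotone :: "(real \<Rightarrow> real) \<Rightarrow> bool" where
  "completely_monotone m \<longleftrightarrow>
     (\<forall>n. \<forall>x>0. (deriv ^^ n) m field_differentiable at x \<and> 0 \<le> (- 1) ^ n * (deriv ^^ n) m x)"

text \<open>
  A Bernstein function with characteristics \<open>(b, \<mu>)\<close> is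
  \<open>b * l + (\<integral>x. 1 - exp (- l * x) \<partial>\<mu>)\<close>; here \<open>b = 0\<close>. It is complete if \<open>\<mu>\<close> has a
  completely monotone density. The measure lives on the space \<open>{0<..}\<close>, and only the values
  of \<open>f\<close> on \<open>{0<..}\<close> matter.
\<close>

definition complete_bernstein :: "(real \<Rightarrow> real) \<Rightarrow> real measure \<Rightarrow> bool" where
  "complete_bernstein f \<mu> \<longleftrightarrow>
     (\<exists>m. completely_monotone m \<and>
          \<mu> = density (restrict_space lborel {0<..}) (\<lambda>x. ennreal (m x))) \<and>
     (\<integral>\<^sup>+ x. ennreal (min 1 x) \<partial>\<mu>) < \<infinity> \<and>
     (\<forall>l>0. f l = (\<integral>x. (1 - exp (- l * x)) \<partial>\<mu>))"

section \<open>Processes and subordinators\<close>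

text \<open>
  Processes are indexed by \<open>real\<close>, but only times in \<open>{0..}\<close> are meaningful.
\<close>

abbreviation path_space :: "'e measure \<Rightarrow> (real \<Rightarrow> 'e) measure" where
  "path_space E \<equiv> Pi\<^sub>M {0..} (\<lambda>_. E)"

definition path :: "(real \<Rightarrow> 'a \<Rightarrow> 'e) \<Rightarrow> 'a \<Rightarrow> real \<Rightarrow> 'e" where
  "path X \<omega> = (\<lambda>t\<in>{0..}. X t \<omega>)"

locale subordinator = prob_space M for M :: "'a measure" +
  fixes S :: "real \<Rightarrow> 'a \<Rightarrow> real"
  assumes measurable_S: "\<And>t. 0 \<le> t \<Longrightarrow> S t \<in> borel_measurable M"
    and start_zero: "\<And>\<omega>. \<omega> \<in> space M \<Longrightarrow> S 0 \<omega> = 0"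
    and increasing: "\<And>\<omega>. \<omega> \<in> space M \<Longrightarrow> mono_on {0..} (\<lambda>t. S t \<omega>)"
    and right_continuous:
      "\<And>\<omega> t. \<omega> \<in> space M \<Longrightarrow> 0 \<le> t \<Longrightarrow> continuous (at_right t) (\<lambda>u. S u \<omega>)"
    and left_limits:
      "\<And>\<omega> t. \<omega> \<in> space M \<Longrightarrow> 0 < t \<Longrightarrow> \<exists>l. ((\<lambda>u. S u \<omega>) \<longlongrightarrow> l) (at_left t)"
    and stationary_increments:
      "\<And>s h. 0 \<le> s \<Longrightarrow> 0 \<le> h \<Longrightarrow>
         distr M borel (\<lambda>\<omega>. S (s + h) \<omega> - S s \<omega>) = distr M borel (S h)"
    and independent_increments:
      "\<And>(t :: nat \<Rightarrow> real) n. 0 \<le> t 0 \<Longrightarrow> (\<And>i. i < n \<Longrightarrow> t i < t (Suc i)) \<Longrightarrow>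
         indep_vars (\<lambda>_. borel) (\<lambda>i \<omega>. S (t (Suc i)) \<omega> - S (t i) \<omega>) {..<n}"

definition iid_processes :: "'a measure \<Rightarrow> (nat \<Rightarrow> real \<Rightarrow> 'a \<Rightarrow> real) \<Rightarrow> bool" where
  "iid_processes M S \<longleftrightarrow>
     prob_space.indep_vars M (\<lambda>_. path_space borel) (\<lambda>j. path (S j)) UNIV \<and>
     (\<forall>i j. distr M (path_space borel) (path (S i)) = distr M (path_space borel) (path (S j)))"

section \<open>The censored decreasing subordinator\<close>

text \<open>
  The construction is done path by path: \<open>s j\<close> is a path of the \<open>(j + 1)\<close>-st subordinator, so
  that \<open>censored_sigma s x j\<close> is $\sigma_{j+1}$, while \<open>censored_pos s x j\<close> and
  \<open>censored_tau s x j\<close> are $Y_j$ and $\tau_j$. Passage times are infinite if the level is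
  never passed (the infimum of the empty set in \<open>ennreal\<close>); in that case the next position is
  a dummy value which is never used.
\<close>

definition first_passage :: "(real \<Rightarrow> real) \<Rightarrow> real \<Rightarrow> ennreal" where
  "first_passage g y = (INF u\<in>{u. 0 < u \<and> y < g u}. ennreal u)"

text \<open>The convention for the left limit at \<open>0\<close> is \<open>g (0-) = g 0\<close>.\<close>

definition left_limit :: "(real \<Rightarrow> real) \<Rightarrow> real \<Rightarrow> real" where
  "left_limit g r = (if 0 < r then Lim (at_left r) g else g 0)"

primrec censored_pos :: "(nat \<Rightarrow> real \<Rightarrow> real) \<Rightarrow> real \<Rightarrow> nat \<Rightarrow> real" where
  "censored_pos s x 0 = x"
| "censored_pos s x (Suc j) =
     censored_pos s x j - left_limit (s j) (enn2real (first_passage (s j) (censored_pos s x j)))"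

definition censored_sigma :: "(nat \<Rightarrow> real \<Rightarrow> real) \<Rightarrow> real \<Rightarrow> nat \<Rightarrow> ennreal" where
  "censored_sigma s x j = first_passage (s j) (censored_pos s x j)"

definition censored_tau :: "(nat \<Rightarrow> real \<Rightarrow> real) \<Rightarrow> real \<Rightarrow> nat \<Rightarrow> ennreal" where
  "censored_tau s x j = (\<Sum>i<j. censored_sigma s x i)"

definition censored_lifetime :: "(nat \<Rightarrow> real \<Rightarrow> real) \<Rightarrow> real \<Rightarrow> ennreal" where
  "censored_lifetime s x = lim (\<lambda>j. censored_tau s x j)"

text \<open>
  The cemetery is \<open>None\<close>. The value \<open>0\<close>, which is not in the state space, can be attained only
  on the null set where the path is to be ignored; there we use the cemetery instead, so that
  every path stays in the state space.
\<close>

definition censored_path :: "(nat \<Rightarrow> real \<Rightarrow> real) \<Rightarrow> real \<Rightarrow> real \<Rightarrow> real option" where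
  "censored_path s x t =
     (if ennreal t < censored_lifetime s x then
        let j = (THE j. censored_tau s x j \<le> ennreal t \<and> ennreal t < censored_tau s x (Suc j));
            v = censored_pos s x j - s j (t - enn2real (censored_tau s x j))
        in if 0 < v then Some v else None
      else None)"

fun censored_subordinator ::
  "(nat \<Rightarrow> real \<Rightarrow> 'a \<Rightarrow> real) \<Rightarrow> real option \<Rightarrow> real \<Rightarrow> 'a \<Rightarrow> real option" where
  "censored_subordinator S (Some x) t \<omega> = censored_path (\<lambda>j u. S j u \<omega>) x t"
| "censored_subordinator S None t \<omega> = None"

definition censored_state :: "real option measure" where
  "censored_state =
     sigma (insert None (Some ` {0<..}))
       (insert {None} ((`) Some ` sets (restrict_space borel {0<..})))"

section \<open>Strong Markov processes\<close>

text \<open>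
  Stopping times may be infinite, hence filtrations are indexed by \<open>ennreal\<close>; at \<open>\<infinity>\<close> the
  natural filtration is generated by the whole process.
\<close>

definition natural_filtration ::
  "'a measure \<Rightarrow> 'e measure \<Rightarrow> (real \<Rightarrow> 'a \<Rightarrow> 'e) \<Rightarrow> ennreal \<Rightarrow> 'a measure" where
  "natural_filtration M E X t =
     sigma (space M) {X u -` A \<inter> space M |u A. 0 \<le> u \<and> ennreal u \<le> t \<and> A \<in> sets E}"

abbreviation stopped_sigma ::
  "'a measure \<Rightarrow> 'e measure \<Rightarrow> (real \<Rightarrow> 'a \<Rightarrow> 'e) \<Rightarrow> ('a \<Rightarrow> ennreal) \<Rightarrow> 'a measure" where
  "stopped_sigma M E X T \<equiv> filtration.pre_sigma (space M) (natural_filtration M E X) T"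

text \<open>
  \<open>P x\<close> is the probability measure and \<open>X x\<close> the process for the starting point \<open>x\<close>.
  The strong Markov property says that, on \<open>{T < \<infinity>}\<close>,
  \<open>P x (X (T + _) \<in> \<Gamma> | F T) = P (X T) (X \<in> \<Gamma>)\<close> almost surely, for all measurable sets
  \<open>\<Gamma>\<close> of paths.
\<close>

definition strong_markov_process ::
  "'e measure \<Rightarrow> ('e \<Rightarrow> 'a measure) \<Rightarrow> ('e \<Rightarrow> real \<Rightarrow> 'a \<Rightarrow> 'e) \<Rightarrow> bool" where
  "strong_markov_process E P X \<longleftrightarrow>
     (\<forall>x\<in>space E. prob_space (P x) \<and> (\<forall>t\<ge>0. X x t \<in> P x \<rightarrow>\<^sub>M E) \<and> (AE \<omega> in P x. X x 0 \<omega> = x)) \<and>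
     (\<lambda>x. distr (P x) (path_space E) (path (X x))) \<in> E \<rightarrow>\<^sub>M prob_algebra (path_space E) \<and>
     (\<forall>x\<in>space E. \<forall>T. stopping_time (natural_filtration (P x) E (X x)) T \<longrightarrow>
        (\<forall>A\<in>sets E. {\<omega>\<in>space (P x). T \<omega> < \<infinity> \<and> X x (enn2real (T \<omega>)) \<omega> \<in> A}
            \<in> sets (stopped_sigma (P x) E (X x) T)) \<and>
        (\<forall>\<Gamma>\<in>sets (path_space E).
           AE \<omega> in P x. T \<omega> < \<infinity> \<longrightarrow>
             real_cond_exp (P x) (stopped_sigma (P x) E (X x) T)
               (indicator {\<omega>\<in>space (P x). T \<omega> < \<infinity> \<and> path (\<lambda>t. X x (enn2real (T \<omega>) + t)) \<omega> \<in> \<Gamma>}) \<omega>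
             = measure (distr (P (X x (enn2real (T \<omega>)) \<omega>)) (path_space E)
                          (path (X (X x (enn2real (T \<omega>)) \<omega>)))) \<Gamma>))"

end

theory Submission
  imports Defs
begin

text \<open>
  The idea is that a stopping time \<open>T\<close> of the natural filtration, seen on the event
  \<open>\<tau>\<^sub>j \<le> T < \<tau>\<^sub>j\<^sub>+\<^sub>1\<close>, acts like a stopping time \<open>R = T - \<tau>\<^sub>j\<close> of the piece \<open>S\<^sup>j\<close>, given the
  earlier pieces. Approximating \<open>R\<close> from above by dyadic times and using right continuity, the
  restarted piece \<open>S\<^sup>j\<^sub>R\<^sub>+\<^sub>u - S\<^sup>j\<^sub>R\<close> together with the later pieces is seen to be independent of the
  past, with the law of the original sequence of pieces. Path by path, the process after \<open>T\<close> is
  the censored path built from these pieces with starting point \<open>X\<^sub>T\<close>, so the claim follows from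
  Fubini's theorem.
\<close>

section \<open>Paths\<close>

text \<open>Two kinds of information have to be matched. \<open>T\<close> is a stopping time of the
  filtration of the censored process, while independence is known for the pieces; since
  \<open>tau\<close> is random, \<open>T - tau\<close> acts as a stopping time only conditionally on
  earlier pieces and only inside a phase. The bridge is a statement about events: where the phase
  lasts at least \<open>q\<close> and \<open>T < tau + q\<close>, every event of \<open>FT\<close>
  is determined by the pieces before \<open>j\<close> and by piece \<open>j\<close> up to local time
  \<open>q\<close> (\<open>past_FT\<close>). The bound \<open>q <= sig\<close> makes this work.
  Rounding \<open>R\<close> up may overshoot the end of the phase, so the dyadic argument runs on
  events that merely exhaust the phase in the limit (\<open>grid_event\<close>). As the rounded
  times decrease, restarted paths converge coordinatewise only, so indicators of events are first
  replaced by continuous functions (\<open>soft_box\<close>). Encoding the cemetery by 0 makes the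
  whole process nonincreasing and right continuous, so that its state at \<open>T\<close> is
  described by countably many times.\<close>

definition increasing_path :: "(real \<Rightarrow> real) \<Rightarrow> bool" where
  "increasing_path g \<longleftrightarrow> g 0 = 0 \<and> mono_on {0..} g \<and> (\<forall>t\<ge>0. continuous (at_right t) g)"

lemma increasing_path_zero: "increasing_path g \<Longrightarrow> g 0 = 0"
  by (simp add: increasing_path_def)

lemma increasing_path_mono: "increasing_path g \<Longrightarrow> 0 \<le> u \<Longrightarrow> u \<le> v \<Longrightarrow> g u \<le> g v"
  by (auto simp: increasing_path_def mono_on_def)

lemma increasing_path_nonneg: "increasing_path g \<Longrightarrow> 0 \<le> u \<Longrightarrow> 0 \<le> g u"
  using increasing_path_mono[of g 0 u] by (simp add: increasing_path_zero)

lemma increasing_path_right: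
  assumes "increasing_path g" "0 \<le> t"
  shows "(g \<longlongrightarrow> g t) (at_right t)"
  using assms by (auto simp: increasing_path_def continuous_within)

lemma increasing_path_less:
  assumes g: "increasing_path g" and t: "0 \<le> t" and c: "g t < c"
  shows "\<exists>b>t. \<forall>u. t \<le> u \<longrightarrow> u < b \<longrightarrow> g u < c"
proof -
  have "\<forall>\<^sub>F u in at_right t. g u < c"
    using increasing_path_right[OF g t] c by (rule order_tendstoD)
  then obtain b where "b > t" "\<And>u. t < u \<Longrightarrow> u < b \<Longrightarrow> g u < c"
    by (auto simp: eventually_at_right_field)
  then show ?thesis
    using c by (metis order_le_less)
qed

text \<open>Right continuity and monotonicity let a later rational time witness the strict
  inequality. This yields measurability of evaluation at random times, and it shows that
  \<open>regularize\<close> fixes increasing paths.\<close>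

lemma increasing_path_less_iff:
  assumes g: "increasing_path g" and t: "0 \<le> t"
  shows "g t < c \<longleftrightarrow> (\<exists>q\<in>\<rat>. t < q \<and> g q < c)"
proof
  assume "g t < c"
  then obtain b where b: "b > t" "\<And>u. t \<le> u \<Longrightarrow> u < b \<Longrightarrow> g u < c"
    using increasing_path_less[OF g t] by blast
  obtain q where "q \<in> \<rat>" "t < q" "q < b"
    using Rats_dense_in_real[OF b(1)] by blast
  then show "\<exists>q\<in>\<rat>. t < q \<and> g q < c" using b by force
next
  assume "\<exists>q\<in>\<rat>. t < q \<and> g q < c"
  then show "g t < c" using increasing_path_mono[OF g t] by (meson le_less_trans less_imp_le)
qed

lemma increasing_path_cmp:
  assumes "increasing_path g" "0 \<le> r"
  shows "increasing_path (\<lambda>u. g (r + u) - g r)"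
  unfolding increasing_path_def
proof (intro conjI allI impI)
  show "mono_on {0..} (\<lambda>u. g (r + u) - g r)"
    using increasing_path_mono[OF assms(1)] assms(2) by (auto simp: mono_on_def)
  fix t :: real assume t: "0 \<le> t"
  have "(g \<longlongrightarrow> g (r + t)) (at_right (r + t))"
    using increasing_path_right[OF assms(1), of "r + t"] assms t by simp
  moreover have "filterlim (\<lambda>u. r + u) (at_right (r + t)) (at_right t)"
    by (simp add: filterlim_at_right_to_0[of _ _ t] filterlim_at_right_to_0[of _ _ "r + t"] filterlim_at)
       (auto intro!: tendsto_eq_intros simp: filterlim_at eventually_at_filter)
  ultimately have "((\<lambda>u. g (r + u)) \<longlongrightarrow> g (r + t)) (at_right t)"
    by (rule filterlim_compose)
  then show "continuous (at_right t) (\<lambda>u. g (r + u) - g r)"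
    unfolding continuous_within by (intro tendsto_intros)
qed simp

lemma increasing_path_const_zero: "increasing_path (\<lambda>_. 0)"
  by (simp add: increasing_path_def mono_on_def)

text \<open>Freezing a piece at q keeps it an admissible piece while it depends only on times up to
  q; \<open>stopped_pieces\<close> rests on this.\<close>

lemma increasing_path_stop:
  assumes "increasing_path g" "0 \<le> q"
  shows "increasing_path (\<lambda>u. g (min q u))"
  unfolding increasing_path_def
proof (intro conjI allI impI)
  show "g (min q 0) = 0" using assms by (simp add: increasing_path_zero)
  show "mono_on {0..} (\<lambda>u. g (min q u))"
    using increasing_path_mono[OF assms(1)] assms(2) by (auto simp: mono_on_def min_def)
  fix t :: real assume t: "0 \<le> t"
  show "continuous (at_right t) (\<lambda>u. g (min q u))"
  proof (cases "t < q")
    case True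
    have "\<forall>\<^sub>F u in at_right t. g u = g (min q u)"
      using True by (auto simp: eventually_at_right_field min_def intro!: exI[of _ q])
    moreover have "(g \<longlongrightarrow> g (min q t)) (at_right t)"
      using increasing_path_right[OF assms(1) t] True by simp
    ultimately show ?thesis
      unfolding continuous_within by (rule Lim_transform_eventually[rotated])
  next
    case False
    have "\<forall>\<^sub>F u in at_right t. g q = g (min q u)"
      using False by (auto simp: eventually_at_right_field min_def intro!: exI[of _ "t + 1"])
    moreover have "((\<lambda>_. g q) \<longlongrightarrow> g (min q t)) (at_right t)"
      using False by simp
    ultimately show ?thesis
      unfolding continuous_within by (rule Lim_transform_eventually[rotated])
  qed
qed

subsection \<open>First passage and left limits\<close>

lemma first_passage_less_iff: "first_passage g y < r \<longleftrightarrow> (\<exists>u>0. y < g u \<and> ennreal u < r)"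
  by (auto simp: first_passage_def INF_less_iff)

lemma first_passage_geI: "(\<And>u. 0 < u \<Longrightarrow> y < g u \<Longrightarrow> r \<le> ennreal u) \<Longrightarrow> r \<le> first_passage g y"
  by (auto simp: first_passage_def intro!: INF_greatest)

text \<open>The infimum runs over positive times, so it says nothing about u = 0; there the bound
  comes from \<open>g 0 = 0\<close> and the hypothesis that y is nonnegative.\<close>

lemma le_of_less_first_passage:
  assumes "increasing_path g" "0 \<le> y" "0 \<le> u" "ennreal u < first_passage g y"
  shows "g u \<le> y"
proof (rule ccontr)
  assume "\<not> g u \<le> y"
  then have "y < g u" "0 < u" using assms by (auto simp: increasing_path_zero order_le_less)
  then have "first_passage g y \<le> ennreal u"
    by (auto simp: first_passage_def intro!: INF_lower)
  then show False using assms(4) by simp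
qed

lemma first_passage_pos:
  assumes "increasing_path g" "0 < y"
  shows "0 < first_passage g y"
proof -
  obtain b where b: "b > 0" "\<And>u. 0 \<le> u \<Longrightarrow> u < b \<Longrightarrow> g u < y"
    using increasing_path_less[OF assms(1), of 0 y] assms by (auto simp: increasing_path_zero)
  have "ennreal b \<le> first_passage g y"
    using b(2) by (intro first_passage_geI) (meson ennreal_leI less_asym less_imp_le not_le)
  then show ?thesis using b(1) by (metis ennreal_eq_0_iff less_le_trans linorder_not_less not_gr_zero)
qed

text \<open>A monotone path has left limits, and writing them as suprema lets them be bounded and
  measured through values at earlier times.\<close>

lemma left_limit_tendsto:
  assumes g: "increasing_path g" and r: "0 < r"
  shows "(g \<longlongrightarrow> Sup (g ` {0..<r})) (at_left r)"
proof (rule order_tendstoI)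
  have bdd: "bdd_above (g ` {0..<r})"
    using increasing_path_mono[OF g] by (intro bdd_aboveI[of _ "g r"]) auto
  { fix a assume "a < Sup (g ` {0..<r})"
    then obtain u where u: "0 \<le> u" "u < r" "a < g u"
      using less_cSUP_iff[OF _ bdd, of a] r by auto
    then show "\<forall>\<^sub>F x in at_left r. a < g x"
      using increasing_path_mono[OF g, of u] by (auto simp: eventually_at_left_field intro!: exI[of _ u] intro: less_le_trans) }
  { fix a assume a: "Sup (g ` {0..<r}) < a"
    show "\<forall>\<^sub>F x in at_left r. g x < a"
      using r a by (auto simp: eventually_at_left_field intro!: exI[of _ 0] intro: le_less_trans[OF cSUP_upper[OF _ bdd]]) }
qed

lemma left_limit_eq_Sup:
  assumes "increasing_path g" "0 < r"
  shows "left_limit g r = Sup (g ` {0..<r})"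
  using tendsto_Lim[OF _ left_limit_tendsto[OF assms]] assms(2) by (simp add: left_limit_def)

lemma left_limit_nonpos: "increasing_path g \<Longrightarrow> r \<le> 0 \<Longrightarrow> left_limit g r = 0"
  by (simp add: left_limit_def increasing_path_zero)

lemma le_left_limit:
  assumes "increasing_path g" "0 \<le> u" "u < r"
  shows "g u \<le> left_limit g r"
proof -
  have "bdd_above (g ` {0..<r})"
    using increasing_path_mono[OF assms(1)] by (intro bdd_aboveI[of _ "g r"]) auto
  then show ?thesis using assms by (auto simp: left_limit_eq_Sup intro!: cSUP_upper)
qed

lemma left_limit_le:
  assumes "increasing_path g" "0 \<le> c" "\<And>u. 0 \<le> u \<Longrightarrow> u < r \<Longrightarrow> g u \<le> c"
  shows "left_limit g r \<le> c"
  using assms by (cases "0 < r") (auto simp: left_limit_nonpos left_limit_eq_Sup intro!: cSUP_least)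

lemma left_limit_nonneg:
  assumes "increasing_path g"
  shows "0 \<le> left_limit g r"
  using le_left_limit[OF assms, of 0 r] increasing_path_zero[OF assms] left_limit_nonpos[OF assms, of r]
  by (cases "0 < r") auto

lemma left_limit_greater_iff:
  assumes g: "increasing_path g" and r: "0 < r"
  shows "c < left_limit g r \<longleftrightarrow> (\<exists>q\<in>\<rat>. 0 \<le> q \<and> q < r \<and> c < g q)"
proof
  have bdd: "bdd_above (g ` {0..<r})"
    using increasing_path_mono[OF g] by (intro bdd_aboveI[of _ "g r"]) auto
  assume "c < left_limit g r"
  then obtain u where u: "0 \<le> u" "u < r" "c < g u"
    using less_cSUP_iff[OF _ bdd, of c] r by (auto simp: left_limit_eq_Sup[OF g r])
  obtain q where "q \<in> \<rat>" "u < q" "q < r"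
    using Rats_dense_in_real[OF u(2)] by blast
  then show "\<exists>q\<in>\<rat>. 0 \<le> q \<and> q < r \<and> c < g q"
    using u increasing_path_mono[OF g u(1), of q] by force
next
  assume "\<exists>q\<in>\<rat>. 0 \<le> q \<and> q < r \<and> c < g q"
  then show "c < left_limit g r" using le_left_limit[OF g] by (meson less_le_trans)
qed

lemma first_passage_cong: "(\<And>u. 0 \<le> u \<Longrightarrow> g u = h u) \<Longrightarrow> first_passage g y = first_passage h y"
  unfolding first_passage_def by (intro INF_cong) auto

lemma left_limit_cong:
  assumes "increasing_path g" "increasing_path h" "\<And>u. 0 \<le> u \<Longrightarrow> g u = h u"
  shows "left_limit g r = left_limit h r"
proof (cases "0 < r")
  case True
  then show ?thesis using assms by (simp add: left_limit_eq_Sup)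
qed (simp add: assms left_limit_nonpos)

text \<open>Up to r the level y has not been exceeded, so every time at which g exceeds y lies
  beyond r and is seen by the restarted path as exceeding the remaining level.\<close>

lemma first_passage_shift:
  assumes g: "increasing_path g" and r: "0 \<le> r" "ennreal r < first_passage g y" and y: "0 \<le> y"
  shows "ennreal r + first_passage (\<lambda>u. g (r + u) - g r) (y - g r) = first_passage g y"
proof (rule antisym)
  show "ennreal r + first_passage (\<lambda>u. g (r + u) - g r) (y - g r) \<le> first_passage g y"
  proof (rule first_passage_geI)
    fix u :: real assume u: "0 < u" "y < g u"
    have "\<not> u \<le> r"
      using increasing_path_mono[OF g, of u r] u le_of_less_first_passage[OF g y r] by auto
    then have "first_passage (\<lambda>u. g (r + u) - g r) (y - g r) \<le> ennreal (u - r)"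
      using u by (auto simp: first_passage_def intro!: INF_lower)
    then have "ennreal r + first_passage (\<lambda>u. g (r + u) - g r) (y - g r) \<le> ennreal r + ennreal (u - r)"
      by (rule add_left_mono)
    also have "\<dots> = ennreal u" using \<open>\<not> u \<le> r\<close> r by (simp flip: ennreal_plus)
    finally show "ennreal r + first_passage (\<lambda>u. g (r + u) - g r) (y - g r) \<le> ennreal u" .
  qed
  have "first_passage g y - ennreal r \<le> first_passage (\<lambda>u. g (r + u) - g r) (y - g r)"
  proof (rule first_passage_geI)
    fix u :: real assume u: "0 < u" "y - g r < g (r + u) - g r"
    then have "first_passage g y \<le> ennreal (r + u)"
      using r unfolding first_passage_def by (intro INF_lower) auto
    then show "first_passage g y - ennreal r \<le> ennreal u"
      using u r by (simp add: ennreal_minus_le_iff add.commute)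
  qed
  then show "first_passage g y \<le> ennreal r + first_passage (\<lambda>u. g (r + u) - g r) (y - g r)"
    by (simp add: ennreal_minus_le_iff)
qed

text \<open>Values before r are dominated by \<open>g r\<close>, so only the restarted part counts.
  The case b = 0 is genuinely different: there the convention for the left limit at 0 gives 0, while
  the left limit of g at r may lie below \<open>g r\<close>.\<close>

lemma left_limit_shift:
  assumes g: "increasing_path g" and r: "0 \<le> r" "0 < b"
  shows "left_limit (\<lambda>u. g (r + u) - g r) b = left_limit g (r + b) - g r"
proof (rule antisym)
  have g': "increasing_path (\<lambda>u. g (r + u) - g r)" by (rule increasing_path_cmp[OF g r(1)])
  show "left_limit (\<lambda>u. g (r + u) - g r) b \<le> left_limit g (r + b) - g r"
    using le_left_limit[OF g, of r "r + b"] le_left_limit[OF g, of "r + _" "r + b"] r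
    by (intro left_limit_le[OF g']) auto
  have "left_limit g (r + b) \<le> left_limit (\<lambda>u. g (r + u) - g r) b + g r"
  proof (rule left_limit_le[OF g])
    show "0 \<le> left_limit (\<lambda>u. g (r + u) - g r) b + g r"
      using left_limit_nonneg[OF g'] increasing_path_nonneg[OF g r(1)] by simp
    fix u assume u: "0 \<le> u" "u < r + b"
    show "g u \<le> left_limit (\<lambda>u. g (r + u) - g r) b + g r"
    proof (cases "r \<le> u")
      case True
      then show ?thesis using le_left_limit[OF g', of "u - r" b] u by simp
    next
      case False
      then show ?thesis
        using increasing_path_mono[OF g u(1), of r] left_limit_nonneg[OF g', of b] by simp
    qed
  qed
  then show "left_limit g (r + b) - g r \<le> left_limit (\<lambda>u. g (r + u) - g r) b" by simp
qed

subsection \<open>The censored path\<close>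

locale censored =
  fixes s :: "nat \<Rightarrow> real \<Rightarrow> real" and x :: real
  assumes path: "increasing_path (s i)" and start: "0 \<le> x"
begin

lemma pos_bounds: "0 \<le> censored_pos s x j \<and> censored_pos s x (Suc j) \<le> censored_pos s x j"
proof (induction j)
  have *: "left_limit (s j) (enn2real (first_passage (s j) y)) \<le> y" if "0 \<le> y" for j y
  proof (cases "first_passage (s j) y")
    case (real r)
    show ?thesis
    proof (intro left_limit_le path that)
      fix u assume "0 \<le> u" "u < enn2real (first_passage (s j) y)"
      then show "s j u \<le> y"
        using that real by (intro le_of_less_first_passage[OF path]) (auto simp: ennreal_less_iff)
    qed
  next
    \<comment> \<open>\<open>enn2real\<close> sends an infinite passage time to 0, where the left
      limit is 0; the dummy next position is therefore y again, and the bounds persist.\<close>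
    case top
    then show ?thesis using that by (simp add: left_limit_nonpos[OF path])
  qed
  { case 0 show ?case using start left_limit_nonneg[OF path] by simp }
  { case (Suc j)
    then show ?case using *[of "censored_pos s x j"] left_limit_nonneg[OF path] by simp }
qed

lemma pos_nonneg: "0 \<le> censored_pos s x j" and pos_Suc_le: "censored_pos s x (Suc j) \<le> censored_pos s x j"
  using pos_bounds by auto

lemma pos_antimono: "i \<le> j \<Longrightarrow> censored_pos s x j \<le> censored_pos s x i"
  by (rule lift_Suc_antimono_le[of "censored_pos s x"]) (rule pos_Suc_le)

end

lemma tau_Suc: "censored_tau s x (Suc j) = censored_tau s x j + censored_sigma s x j"
  by (simp add: censored_tau_def)

lemma tau_0: "censored_tau s x 0 = 0"
  by (simp add: censored_tau_def)

lemma tau_mono: "i \<le> j \<Longrightarrow> censored_tau s x i \<le> censored_tau s x j"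
  by (rule lift_Suc_mono_le[of "censored_tau s x"]) (simp add: tau_Suc)

lemma lifetime_eq_SUP: "censored_lifetime s x = (SUP j. censored_tau s x j)"
  unfolding censored_lifetime_def
  by (rule limI[OF LIMSEQ_SUP]) (simp add: incseq_def tau_mono)

definition in_phase :: "(nat \<Rightarrow> real \<Rightarrow> real) \<Rightarrow> real \<Rightarrow> real \<Rightarrow> nat \<Rightarrow> bool" where
  "in_phase s x t j \<longleftrightarrow> censored_tau s x j \<le> ennreal t \<and> ennreal t < censored_tau s x (Suc j)"

text \<open>Phases are half-open intervals between successive nondecreasing times, hence disjoint.
  This makes the definite description in \<open>censored_path\<close> meaningful.\<close>

lemma in_phase_unique: "in_phase s x t i \<Longrightarrow> in_phase s x t j \<Longrightarrow> i = j"
proof (induction i j rule: linorder_wlog)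
  case (le i j)
  show ?case
  proof (rule ccontr)
    assume "i \<noteq> j"
    then have "censored_tau s x (Suc i) \<le> censored_tau s x j"
      using le by (intro tau_mono) auto
    then show False using le by (auto simp: in_phase_def)
  qed
qed simp

lemma less_lifetime_iff: "ennreal t < censored_lifetime s x \<longleftrightarrow> (\<exists>j. in_phase s x t j)"
proof
  assume "ennreal t < censored_lifetime s x"
  then obtain k where k: "ennreal t < censored_tau s x k"
    by (auto simp: lifetime_eq_SUP less_SUP_iff)
  \<comment> \<open>The least index with t below \<open>censored_tau\<close> is positive because
    that time is 0 at index 0; its predecessor is the current phase.\<close>
  define m where "m = (LEAST k. ennreal t < censored_tau s x k)"
  have m: "ennreal t < censored_tau s x m"
    unfolding m_def by (rule LeastI[of _ k]) fact
  then obtain j where j: "m = Suc j" by (cases m) (auto simp: tau_0)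
  have "\<not> ennreal t < censored_tau s x j"
    using not_less_Least[of j "\<lambda>k. ennreal t < censored_tau s x k"] j by (simp add: m_def)
  then show "\<exists>j. in_phase s x t j" using m j by (auto simp: in_phase_def not_less)
qed (auto simp: lifetime_eq_SUP less_SUP_iff in_phase_def)

text \<open>The cemetery is encoded by the value \<open>0\<close>, which makes the whole path nonincreasing.\<close>

definition of_value :: "real \<Rightarrow> real option" where
  "of_value v = (if 0 < v then Some v else None)"

definition censored_value :: "(nat \<Rightarrow> real \<Rightarrow> real) \<Rightarrow> real \<Rightarrow> real \<Rightarrow> real" where
  "censored_value s x t = (case censored_path s x t of None \<Rightarrow> 0 | Some v \<Rightarrow> v)"

lemma censored_path_in_phase:
  assumes "in_phase s x t j"
  shows "censored_path s x t = of_value (censored_pos s x j - s j (t - enn2real (censored_tau s x j)))"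
proof -
  have "(THE j. censored_tau s x j \<le> ennreal t \<and> ennreal t < censored_tau s x (Suc j)) = j"
    using assms in_phase_unique unfolding in_phase_def[symmetric] by blast
  then show ?thesis
    using assms by (auto simp: censored_path_def less_lifetime_iff of_value_def Let_def)
qed

lemma censored_path_no_phase: "\<not> (\<exists>j. in_phase s x t j) \<Longrightarrow> censored_path s x t = None"
  by (simp add: censored_path_def less_lifetime_iff)

lemma censored_path_eq_value: "censored_path s x t = of_value (censored_value s x t)"
proof (cases "\<exists>j. in_phase s x t j")
  case True
  then obtain j where "in_phase s x t j" by blast
  then show ?thesis by (simp add: censored_value_def censored_path_in_phase of_value_def)
qed (simp add: censored_path_no_phase censored_value_def of_value_def)

lemma censored_value_no_phase: "\<not> (\<exists>j. in_phase s x t j) \<Longrightarrow> censored_value s x t = 0"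
  by (simp add: censored_value_def censored_path_no_phase)

lemma censored_value_in_phase:
  "in_phase s x t j \<Longrightarrow>
    censored_value s x t = max 0 (censored_pos s x j - s j (t - enn2real (censored_tau s x j)))"
  by (simp add: censored_value_def censored_path_in_phase of_value_def)

lemma in_phaseE:
  assumes "in_phase s x t j" "0 \<le> t"
  obtains a r where "0 \<le> a" "0 \<le> r" "censored_tau s x j = ennreal a" "t = a + r"
    "enn2real (censored_tau s x j) = a" "ennreal r < censored_sigma s x j"
proof -
  obtain a where a: "0 \<le> a" "censored_tau s x j = ennreal a"
    using assms by (cases "censored_tau s x j") (auto simp: in_phase_def top_unique)
  moreover have "a \<le> t" using assms a by (auto simp: in_phase_def)
  moreover have "ennreal (t - a) < censored_sigma s x j"
  proof (cases "censored_sigma s x j")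
    case (real b)
    then show ?thesis using assms a by (auto simp: in_phase_def tau_Suc ennreal_less_iff simp flip: ennreal_plus)
  qed simp
  ultimately show ?thesis by (intro that[of a "t - a"]) auto
qed

lemma value_nonneg: "0 \<le> censored_value s x t"
  by (cases "\<exists>j. in_phase s x t j") (auto simp: censored_value_in_phase censored_value_no_phase)

context censored
begin

lemma value_in_phase:
  assumes "in_phase s x t j" "0 \<le> t"
  shows "censored_value s x t = censored_pos s x j - s j (t - enn2real (censored_tau s x j))"
proof -
  obtain a r where *: "0 \<le> a" "0 \<le> r" "censored_tau s x j = ennreal a" "t = a + r"
    "enn2real (censored_tau s x j) = a" "ennreal r < censored_sigma s x j"
    using in_phaseE[OF assms] .
  then have "s j r \<le> censored_pos s x j"
    by (intro le_of_less_first_passage[OF path pos_nonneg]) (simp_all add: censored_sigma_def)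
  then show ?thesis unfolding censored_value_in_phase[OF assms(1)] using * by simp
qed

lemma value_start:
  assumes "0 < x"
  shows "censored_value s x 0 = x"
proof -
  have "in_phase s x 0 0"
    using first_passage_pos[OF path assms]
    by (simp add: in_phase_def tau_Suc tau_0 censored_sigma_def)
  then show ?thesis
    using value_in_phase[of 0 0] by (simp add: tau_0 increasing_path_zero[OF path])
qed

lemma in_phase_later:
  assumes "in_phase s x t j" "in_phase s x t' k" "t \<le> t'"
  shows "j \<le> k"
proof (rule ccontr)
  assume "\<not> j \<le> k"
  then have "censored_tau s x (Suc k) \<le> censored_tau s x j" by (intro tau_mono) auto
  then have "ennreal t' < ennreal t" using assms by (auto simp: in_phase_def)
  then show False using ennreal_leI[OF assms(3)] by simp
qed

text \<open>Inside a phase the piece increases. Across phases, every value in phase j is at least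
  the position from which the next phase starts, since that position subtracts the left limit at the
  end of phase j; positions decrease afterwards. After the lifetime the value is 0, below
  everything.\<close>

lemma value_antimono:
  assumes t: "0 \<le> t" "t \<le> t'"
  shows "censored_value s x t' \<le> censored_value s x t"
proof (cases "\<exists>k. in_phase s x t' k")
  case True
  then obtain k where k: "in_phase s x t' k" by blast
  have "ennreal t < censored_lifetime s x"
    using less_lifetime_iff[of t' s x] True ennreal_leI[OF t(2)] by (metis le_less_trans)
  then obtain j where j: "in_phase s x t j" by (auto simp: less_lifetime_iff)
  have jk: "j \<le> k" by (rule in_phase_later[OF j k t(2)])
  obtain a r where r: "0 \<le> a" "0 \<le> r" "censored_tau s x j = ennreal a" "t = a + r"
      "enn2real (censored_tau s x j) = a" "ennreal r < censored_sigma s x j"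
    using in_phaseE[OF j t(1)] .
  obtain a' r' where r': "0 \<le> a'" "0 \<le> r'" "censored_tau s x k = ennreal a'" "t' = a' + r'"
      "enn2real (censored_tau s x k) = a'" "ennreal r' < censored_sigma s x k"
    using in_phaseE[OF k] t by auto
  have v: "censored_value s x t = censored_pos s x j - s j r"
    using value_in_phase[OF j t(1)] r by simp
  have v': "censored_value s x t' = censored_pos s x k - s k r'"
    using value_in_phase[OF k] t r' by simp
  show ?thesis
  proof (cases "j = k")
    case True
    then show ?thesis using v v' r r' t increasing_path_mono[OF path r(2), of r'] by simp
  next
    case False
    then have "censored_tau s x (Suc j) \<le> censored_tau s x k" using jk by (intro tau_mono) auto
    \<comment> \<open>A later phase exists, so phase j has finite length, and
      \<open>enn2real\<close> of that length is its true value.\<close>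
    then have "censored_sigma s x j \<noteq> \<top>" using r' by (auto simp: tau_Suc top_unique)
    then have "r < enn2real (censored_sigma s x j)"
      using r(6) r(2) by (cases "censored_sigma s x j") (auto simp: ennreal_less_iff)
    then have "s j r \<le> left_limit (s j) (enn2real (censored_sigma s x j))"
      by (rule le_left_limit[OF path r(2)])
    moreover have "censored_pos s x k \<le> censored_pos s x (Suc j)"
      using False jk by (intro pos_antimono) auto
    moreover have "0 \<le> s k r'" using increasing_path_nonneg[OF path r'(2)] .
    ultimately show ?thesis using v v' by (simp add: censored_sigma_def)
  qed
next
  case False
  then show ?thesis using value_nonneg by (simp add: censored_value_no_phase)
qed

text \<open>Together with \<open>value_antimono\<close> this is right continuity: only the bound
  from below needs an argument. A nonnegative level can be exceeded only inside a phase, and phases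
  are open on the right, so right continuity of the piece applies; a negative level is always
  exceeded.\<close>

lemma value_right_continuous:
  assumes t: "0 \<le> t" and c: "c < censored_value s x t"
  shows "\<exists>b>t. \<forall>u. t \<le> u \<longrightarrow> u < b \<longrightarrow> c < censored_value s x u"
proof (cases "c < 0")
  case True
  then show ?thesis using value_nonneg by (auto intro!: exI[of _ "t + 1"] intro: less_le_trans)
next
  case False
  then obtain j where j: "in_phase s x t j"
    using c by (metis censored_value_no_phase)
  obtain a r where r: "0 \<le> a" "0 \<le> r" "censored_tau s x j = ennreal a" "t = a + r"
      "enn2real (censored_tau s x j) = a" "ennreal r < censored_sigma s x j"
    using in_phaseE[OF j t] .
  have "s j r < censored_pos s x j - c"
    using c value_in_phase[OF j t] r by simp
  then obtain b where b: "b > r" "\<And>u. r \<le> u \<Longrightarrow> u < b \<Longrightarrow> s j u < censored_pos s x j - c"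
    using increasing_path_less[OF path r(2)] by blast
  obtain b' where b': "b' > r" "ennreal b' < censored_sigma s x j"
  proof (cases "censored_sigma s x j")
    case (real q)
    then show ?thesis using r dense[of r q] by (metis that ennreal_less_iff order_less_imp_le order_le_less_trans)
  next
    case top
    then show ?thesis using that[of "r + 1"] by (simp add: ennreal_less_top)
  qed
  have "c < censored_value s x u" if u: "t \<le> u" "u < a + min b b'" for u
  proof -
    have "ennreal (u - a) < censored_sigma s x j"
      using u by (intro le_less_trans[OF ennreal_leI b'(2)]) auto
    then have "ennreal u < ennreal a + censored_sigma s x j"
      using u r by (cases "censored_sigma s x j") (auto simp: ennreal_less_iff simp flip: ennreal_plus)
    then have p: "in_phase s x u j"
      using r u by (auto simp: in_phase_def tau_Suc intro!: ennreal_leI)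
    have "u - a < b" using u by simp
    then show ?thesis
      using value_in_phase[OF p] b(2)[of "u - a"] u r t by simp
  qed
  then show ?thesis using r b b' by (intro exI[of _ "a + min b b'"]) auto
qed

text \<open>Pathwise core of the Markov property. Passage times and left limits are compatible with
  restarting the current piece, so the restarted construction has the same positions from the next
  phase on and all its phase boundaries are moved by t; the lifetimes agree as well.\<close>

lemma value_shift:
  assumes t: "0 \<le> t" and j: "in_phase s x t j" and pos: "0 < censored_value s x t" and u: "0 \<le> u"
  defines "r \<equiv> t - enn2real (censored_tau s x j)"
  defines "s' \<equiv> case_nat (\<lambda>v. s j (r + v) - s j r) (\<lambda>k. s (Suc j + k))"
  shows "censored_value s x (t + u) = censored_value s' (censored_value s x t) u"
proof -
  obtain a r' where r': "0 \<le> a" "0 \<le> r'" "censored_tau s x j = ennreal a" "t = a + r'"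
      "enn2real (censored_tau s x j) = a" "ennreal r' < censored_sigma s x j"
    using in_phaseE[OF j t] .
  have r: "0 \<le> r" "censored_tau s x j = ennreal a" "t = a + r" "ennreal r < censored_sigma s x j"
    using r' by (auto simp: r_def)
  let ?v = "censored_value s x t"
  have v: "?v = censored_pos s x j - s j r"
    using value_in_phase[OF j t] by (simp add: r_def)
  interpret s': censored s' ?v
    using increasing_path_cmp[OF path r(1)] path value_nonneg
    by unfold_locales (auto simp: s'_def split: nat.split)
  have sig0: "ennreal r + censored_sigma s' ?v 0 = censored_sigma s x j"
    using first_passage_shift[OF path r(1) _ pos_nonneg, of j j] r v
    by (simp add: censored_sigma_def s'_def)
  \<comment> \<open>Agreement begins with the next position; at index 0 the new construction starts
    from the current value instead of the start of phase j. If the current phase never ends, the two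
    dummy successors may differ, but then no later phase occurs.\<close>
  have pos': "censored_pos s' ?v (Suc k) = censored_pos s x (Suc j + k)"
    if fin: "censored_sigma s x j \<noteq> \<top>" for k
  proof (induction k)
    case 0
    obtain b where b: "0 \<le> b" "censored_sigma s x j = ennreal b"
      using fin by (cases "censored_sigma s x j") auto
    then obtain b' where b': "0 \<le> b'" "censored_sigma s' ?v 0 = ennreal b'"
      using sig0 by (cases "censored_sigma s' ?v 0") auto
    have eq: "r + b' = b" using sig0 b b' r by (simp flip: ennreal_plus)
    \<comment> \<open>The time t lies strictly before the end of phase j, which supplies the
      positivity required by \<open>left_limit_shift\<close>.\<close>
    have "0 < b'" using eq r b by (auto simp: ennreal_less_iff)
    then show ?case
      using left_limit_shift[OF path r(1), of b' j] b b' eq v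
      by (simp add: censored_sigma_def s'_def)
  next
    case (Suc k)
    have "s' (Suc k) = s (Suc (j + k))" by (simp add: s'_def)
    with Suc show ?case by simp
  qed
  have tau': "ennreal t + censored_tau s' ?v (Suc k) = censored_tau s x (Suc j + k)" for k
  proof (cases "censored_sigma s x j = \<top>")
    case True
    then have "censored_sigma s' ?v 0 = \<top>" using sig0 by (cases "censored_sigma s' ?v 0") auto
    then have "censored_tau s' ?v (Suc 0) = \<top>" "censored_tau s x (Suc j) = \<top>"
      using True by (simp_all add: tau_Suc tau_0)
    then have "censored_tau s' ?v (Suc k) = \<top>" "censored_tau s x (Suc j + k) = \<top>"
      using tau_mono[of "Suc 0" "Suc k" s' ?v] tau_mono[of "Suc j" "Suc j + k" s x]
      by (simp_all add: top_unique)
    then show ?thesis by simp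
  next
    case False
    show ?thesis
    proof (induction k)
      case 0
      have "ennreal t + censored_tau s' ?v (Suc 0) = ennreal a + (ennreal r + censored_sigma s' ?v 0)"
        using r r' by (simp add: tau_Suc tau_0 ennreal_plus add.assoc)
      also have "\<dots> = censored_tau s x (Suc j + 0)"
        using sig0 r(2) by (simp add: tau_Suc[of s x j])
      finally show ?case .
    next
      case (Suc k)
      have "s' (Suc k) = s (Suc (j + k))" by (simp add: s'_def)
      then have "censored_sigma s' ?v (Suc k) = censored_sigma s x (Suc j + k)"
        using pos'[OF False, of k] by (simp add: censored_sigma_def)
      then show ?case using Suc by (simp add: tau_Suc[of _ _ "Suc k"] tau_Suc[of s x "Suc (j + k)"] add.assoc[symmetric])
    qed
  qed
  have phase0: "in_phase s' ?v u 0 \<longleftrightarrow> in_phase s x (t + u) j"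
    using tau'[of 0, symmetric] r r' u t
    by (auto simp: in_phase_def tau_0 ennreal_plus intro!: ennreal_leI)
  have phaseS: "in_phase s' ?v u (Suc k) \<longleftrightarrow> in_phase s x (t + u) (Suc j + k)" for k
    using tau'[of k, symmetric] tau'[of "Suc k", symmetric] t u
    by (simp add: in_phase_def ennreal_plus)
  have phase_ge: "j \<le> k" if "in_phase s x (t + u) k" for k
    using in_phase_later[OF j that] u by simp
  show ?thesis
  proof (cases "\<exists>k. in_phase s x (t + u) k")
    case True
    then obtain k where k: "in_phase s x (t + u) k" by blast
    then consider "k = j" | m where "k = Suc j + m"
      using phase_ge[OF k] by (metis le_neq_implies_less less_iff_Suc_add add_Suc)
    then show ?thesis
    proof cases
      case 1
      then have "in_phase s' ?v u 0" using k phase0 by simp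
      then have "censored_value s' ?v u = ?v - (s j (r + u) - s j r)"
        using s'.value_in_phase[of u 0] u by (simp add: tau_0 s'_def)
      moreover have "censored_value s x (t + u) = censored_pos s x j - s j (r + u)"
        using value_in_phase[of "t + u" j] k 1 t u by (simp add: r_def algebra_simps)
      ultimately show ?thesis using v by simp
    next
      case (2 m)
      then have p: "in_phase s' ?v u (Suc m)" using k phaseS by simp
      have fin: "censored_sigma s x j \<noteq> \<top>"
      proof
        assume "censored_sigma s x j = \<top>"
        then have "censored_tau s x (Suc j) = \<top>" by (simp add: tau_Suc)
        then have "censored_tau s x k = \<top>" using tau_mono[of "Suc j" k s x] 2 by (simp add: top_unique)
        then show False using k by (simp add: in_phase_def top_unique)
      qed
      obtain b where b: "0 \<le> b" "censored_tau s' ?v (Suc m) = ennreal b"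
        using in_phaseE[OF p u] by metis
      have "censored_tau s x k = ennreal (t + b)" using tau'[of m] b t 2 by (simp add: ennreal_plus)
      then have "enn2real (censored_tau s x k) = t + b" using t b by (simp del: ennreal_plus)
      then have "censored_value s x (t + u) = censored_pos s x k - s k (t + u - (t + b))"
        using value_in_phase[OF k] t u b by simp
      moreover have "censored_value s' ?v u = censored_pos s x k - s k (u - b)"
        using s'.value_in_phase[OF p u] pos'[OF fin, of m] b 2 by (simp add: s'_def)
      ultimately show ?thesis by simp
    qed
  next
    case False
    have "\<not> (\<exists>k. in_phase s' ?v u k)"
    proof
      assume "\<exists>k. in_phase s' ?v u k"
      then obtain k where "in_phase s' ?v u k" by blast
      then show False using False phase0 phaseS by (cases k) auto
    qed
    then show ?thesis using False by (simp add: censored_value_no_phase)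
  qed
qed

end

subsection \<open>Dependence on the pieces\<close>

lemma censored_pos_cong:
  assumes "\<And>i. increasing_path (s i)" "\<And>i. increasing_path (s' i)"
    and "\<And>i u. i < j \<Longrightarrow> 0 \<le> u \<Longrightarrow> s i u = s' i u" and "i \<le> j"
  shows "censored_pos s x i = censored_pos s' x i"
  using \<open>i \<le> j\<close>
proof (induction i)
  case (Suc i)
  have "first_passage (s i) = first_passage (s' i)"
    using Suc assms(3)[of i] by (intro ext first_passage_cong) auto
  moreover have "left_limit (s i) = left_limit (s' i)"
    using Suc assms(3)[of i] by (intro ext left_limit_cong assms) auto
  ultimately show ?case using Suc by simp
qed simp

lemma censored_sigma_cong:
  assumes "\<And>i. increasing_path (s i)" "\<And>i. increasing_path (s' i)"
    and "\<And>i u. i < j \<Longrightarrow> 0 \<le> u \<Longrightarrow> s i u = s' i u" and "i < j"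
  shows "censored_sigma s x i = censored_sigma s' x i"
  unfolding censored_sigma_def
  using censored_pos_cong[of s s' j i x] assms first_passage_cong[of "s i" "s' i"] by auto

lemma censored_tau_cong:
  assumes "\<And>i. increasing_path (s i)" "\<And>i. increasing_path (s' i)"
    and "\<And>i u. i < j \<Longrightarrow> 0 \<le> u \<Longrightarrow> s i u = s' i u" and "i \<le> j"
  shows "censored_tau s x i = censored_tau s' x i"
  unfolding censored_tau_def
  using censored_sigma_cong[of s s' j _ x] assms by (intro sum.cong) auto

lemma censored_value_cong:
  assumes "\<And>i. increasing_path (s i)" "\<And>i. increasing_path (s' i)"
    and eq: "\<And>i u. 0 \<le> u \<Longrightarrow> s i u = s' i u" and t: "0 \<le> t"
  shows "censored_value s x t = censored_value s' x t"
proof -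
  have tau: "censored_tau s x i = censored_tau s' x i" for i
    by (rule censored_tau_cong[where j = i]) (use assms in auto)
  have p: "censored_pos s x i = censored_pos s' x i" for i
    by (rule censored_pos_cong[where j = i]) (use assms in auto)
  have ph: "in_phase s x t i \<longleftrightarrow> in_phase s' x t i" for i
    by (simp add: in_phase_def tau)
  show ?thesis
  proof (cases "\<exists>j. in_phase s x t j")
    case True
    then obtain j where j: "in_phase s x t j" by blast
    obtain a r where "0 \<le> r" "t = a + r" "enn2real (censored_tau s x j) = a"
      using in_phaseE[OF j t] by metis
    then show ?thesis
      using j ph censored_value_in_phase[of s x t j] censored_value_in_phase[of s' x t j] eq[of r j]
      by (simp add: tau p)
  next
    case False
    then show ?thesis using ph by (simp add: censored_value_no_phase)
  qed
qed

text \<open>That a phase lasts at least q means that the piece does not exceed its level before q,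
  so earlier values decide it. The strict inequality would not do: a path may sit at the level at q
  and exceed it immediately afterwards.\<close>

lemma le_censored_sigma_cong:
  assumes "\<And>i. increasing_path (s i)" "\<And>i. increasing_path (s' i)"
    and "\<And>i u. i < j \<Longrightarrow> 0 \<le> u \<Longrightarrow> s i u = s' i u"
    and eq: "\<And>u. 0 \<le> u \<Longrightarrow> u \<le> q \<Longrightarrow> s j u = s' j u"
    and x: "0 \<le> x" and le: "ennreal q \<le> censored_sigma s x j"
  shows "ennreal q \<le> censored_sigma s' x j"
  unfolding censored_sigma_def
proof (rule first_passage_geI, rule ccontr)
  interpret censored s x using assms by unfold_locales
  fix u assume u: "0 < u" "censored_pos s' x j < s' j u" "\<not> ennreal q \<le> ennreal u"
  have less: "u < q"
    using u by (metis ennreal_leI not_le)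
  have "ennreal u < censored_sigma s x j"
    using u less by (intro less_le_trans[OF ennreal_lessI le]) auto
  then have "s j u \<le> censored_pos s x j"
    using u by (intro le_of_less_first_passage[OF path pos_nonneg]) (simp_all add: censored_sigma_def)
  moreover have "censored_pos s x j = censored_pos s' x j"
    by (rule censored_pos_cong[where j = j]) (use assms in auto)
  ultimately show False using eq[of u] u(1,2) less by linarith
qed

text \<open>If phase j lasts at least q, then before \<open>tau + q\<close> the process reads piece
  j only at local times below q. The bound on t is strict because the phase may end exactly at that
  moment, and then the next piece takes over.\<close>

lemma censored_value_cong_before:
  assumes good: "\<And>i. increasing_path (s i)" "\<And>i. increasing_path (s' i)"
    and eq: "\<And>i u. i < j \<Longrightarrow> 0 \<le> u \<Longrightarrow> s i u = s' i u"
      "\<And>u. 0 \<le> u \<Longrightarrow> u \<le> q \<Longrightarrow> s j u = s' j u"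
    and x: "0 \<le> x" and le: "ennreal q \<le> censored_sigma s x j"
    and t: "0 \<le> t" "ennreal t < censored_tau s x j + ennreal q"
  shows "censored_value s x t = censored_value s' x t"
proof -
  interpret censored s x using assms by unfold_locales
  interpret s': censored s' x using assms by unfold_locales
  have tau: "censored_tau s x i = censored_tau s' x i" if "i \<le> j" for i
    by (rule censored_tau_cong[where j = j]) (use assms that in auto)
  have p: "censored_pos s x i = censored_pos s' x i" if "i \<le> j" for i
    by (rule censored_pos_cong[where j = j]) (use assms that in auto)
  have le': "ennreal q \<le> censored_sigma s' x j"
    using le_censored_sigma_cong[of s s' j q x] assms by blast
  have "ennreal t < censored_tau s x (Suc j)"
    using less_le_trans[OF t(2) add_left_mono[OF le]] by (simp add: tau_Suc)
  then have "ennreal t < censored_lifetime s x"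
    by (auto simp: lifetime_eq_SUP less_SUP_iff)
  then obtain i where i: "in_phase s x t i" by (auto simp: less_lifetime_iff)
  have "i \<le> j"
  proof (rule ccontr)
    assume "\<not> i \<le> j"
    then have "censored_tau s x (Suc j) \<le> censored_tau s x i" by (intro tau_mono) auto
    then show False using i \<open>ennreal t < censored_tau s x (Suc j)\<close> by (auto simp: in_phase_def)
  qed
  obtain a r where r: "0 \<le> a" "0 \<le> r" "censored_tau s x i = ennreal a" "t = a + r"
      "enn2real (censored_tau s x i) = a" "ennreal r < censored_sigma s x i"
    using in_phaseE[OF i t(1)] .
  have "in_phase s' x t i \<and> s i r = s' i r"
  proof (cases "i = j")
    case True
    have "ennreal t < censored_tau s' x (Suc j)"
      using less_le_trans[OF t(2) add_left_mono[OF le']] tau[of j] by (simp add: tau_Suc)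
    moreover have "r < q"
    proof (rule ccontr)
      assume "\<not> r < q"
      then have "ennreal a + ennreal q \<le> ennreal a + ennreal r" by (intro add_left_mono ennreal_leI) simp
      then show False using t(2) r True by (simp add: ennreal_plus ennreal_less_iff)
    qed
    ultimately show ?thesis using i True tau[of i] eq(2)[of r] r by (simp add: in_phase_def)
  next
    case False
    then show ?thesis using i tau[of i] tau[of "Suc i"] \<open>i \<le> j\<close> eq(1)[of i r] r by (simp add: in_phase_def)
  qed
  then show ?thesis
    using value_in_phase[OF i t(1)] s'.value_in_phase[of t i] t p[OF \<open>i \<le> j\<close>] tau[OF \<open>i \<le> j\<close>] r by simp
qed

section \<open>Measurability\<close>

lemma countable_rats_on: "countable {q\<in>\<rat>. P q}"
  using countable_rat by (rule countable_subset[rotated]) auto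

section \<open>The state space and its numerical encoding\<close>

lemma measurable_of_value:
  assumes [measurable]: "f \<in> borel_measurable N"
  shows "(\<lambda>\<omega>. of_value (f \<omega>)) \<in> N \<rightarrow>\<^sub>M censored_state"
  unfolding censored_state_def
proof (rule measurable_measure_of)
  show "insert {None} ((`) Some ` sets (restrict_space borel {0<..})) \<subseteq> Pow (insert None (Some ` {0<..}))"
    by (auto simp: sets_restrict_space)
  show "(\<lambda>\<omega>. of_value (f \<omega>)) \<in> space N \<rightarrow> insert None (Some ` {0<..})"
    by (auto simp: of_value_def)
  fix y :: "real option set" assume "y \<in> insert {None} ((`) Some ` sets (restrict_space borel {0<..}))"
  then consider "y = {None}" | B where "B \<in> sets borel" "y = Some ` ({0<..} \<inter> B)"
    by (auto simp: sets_restrict_space)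
  then show "(\<lambda>\<omega>. of_value (f \<omega>)) -` y \<inter> space N \<in> sets N"
  proof cases
    case 1
    then have "(\<lambda>\<omega>. of_value (f \<omega>)) -` y \<inter> space N = {\<omega>\<in>space N. \<not> 0 < f \<omega>}"
      by (auto simp: of_value_def split: if_splits)
    then show ?thesis by simp
  next
    case [measurable]: (2 B)
    have "(\<lambda>\<omega>. of_value (f \<omega>)) -` y \<inter> space N = {\<omega>\<in>space N. 0 < f \<omega> \<and> f \<omega> \<in> B}"
      by (auto simp: of_value_def 2 split: if_splits)
    then show ?thesis by simp
  qed
qed

definition value_of :: "real option \<Rightarrow> real" where
  "value_of z = (case z of None \<Rightarrow> 0 | Some v \<Rightarrow> v)"

lemma space_censored_state: "space censored_state = insert None (Some ` {0<..})"
  unfolding censored_state_def by (rule space_measure_of) (auto simp: sets_restrict_space)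

lemma Some_image_in_censored_state:
  assumes "B \<in> sets borel"
  shows "Some ` ({0<..} \<inter> B) \<in> sets censored_state"
proof -
  have "{0<..} \<inter> B \<in> sets (restrict_space borel {0<..})"
    using assms by (auto simp: sets_restrict_space)
  then show ?thesis
    unfolding censored_state_def by (subst sets_measure_of) (auto simp: sets_restrict_space)
qed

lemma None_in_censored_state: "{None} \<in> sets censored_state"
  unfolding censored_state_def by (subst sets_measure_of) (auto simp: sets_restrict_space)

lemma measurable_value_of [measurable]: "value_of \<in> borel_measurable censored_state"
proof (rule measurableI)
  fix B :: "real set" assume B: "B \<in> sets borel"
  have "value_of -` B \<inter> space censored_state = Some ` ({0<..} \<inter> B) \<union> (if 0 \<in> B then {None} else {})"
    by (auto simp: value_of_def space_censored_state)
  then show "value_of -` B \<inter> space censored_state \<in> sets censored_state"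
    using Some_image_in_censored_state[OF B] None_in_censored_state by (auto intro!: sets.insert_in_sets)
qed simp

lemma of_value_in_space: "of_value v \<in> space censored_state"
  by (simp add: of_value_def space_censored_state)

section \<open>Measurability of the construction\<close>

lemma measurable_eval_increasing_path:
  fixes g :: "'n \<Rightarrow> real \<Rightarrow> real"
  assumes g: "\<And>u. 0 \<le> u \<Longrightarrow> (\<lambda>\<omega>. g \<omega> u) \<in> borel_measurable N"
      "\<And>\<omega>. \<omega> \<in> space N \<Longrightarrow> increasing_path (g \<omega>)"
    and r [measurable]: "r \<in> borel_measurable N" and r0: "\<And>\<omega>. \<omega> \<in> space N \<Longrightarrow> 0 \<le> r \<omega>"
  shows "(\<lambda>\<omega>. g \<omega> (r \<omega>)) \<in> borel_measurable N"
  unfolding borel_measurable_iff_less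
proof
  fix c
  have "{\<omega>\<in>space N. g \<omega> (r \<omega>) < c} = (\<Union>q\<in>{q\<in>\<rat>. 0 \<le> q}. {\<omega>\<in>space N. r \<omega> < q \<and> g \<omega> q < c})"
  proof (intro set_eqI)
    fix \<omega>
    show "\<omega> \<in> {\<omega>\<in>space N. g \<omega> (r \<omega>) < c} \<longleftrightarrow> \<omega> \<in> (\<Union>q\<in>{q\<in>\<rat>. 0 \<le> q}. {\<omega>\<in>space N. r \<omega> < q \<and> g \<omega> q < c})"
      using increasing_path_less_iff[OF g(2) r0, of \<omega> \<omega> c] r0[of \<omega>] by fastforce
  qed
  also have "\<dots> \<in> sets N"
  proof (rule sets.countable_UN''[OF countable_rats_on])
    fix q :: real assume "q \<in> {q\<in>\<rat>. 0 \<le> q}"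
    then have [measurable]: "(\<lambda>\<omega>. g \<omega> q) \<in> borel_measurable N" using g(1) by simp
    show "{\<omega>\<in>space N. r \<omega> < q \<and> g \<omega> q < c} \<in> sets N" by measurable
  qed
  finally show "{\<omega>\<in>space N. g \<omega> (r \<omega>) < c} \<in> sets N" .
qed

text \<open>A time above the level can be replaced by a slightly later rational one, since the path
  does not come down again; this reduces the event to countably many times.\<close>

lemma measurable_first_passage:
  fixes g :: "'n \<Rightarrow> real \<Rightarrow> real"
  assumes g: "\<And>u. 0 \<le> u \<Longrightarrow> (\<lambda>\<omega>. g \<omega> u) \<in> borel_measurable N"
      "\<And>\<omega>. \<omega> \<in> space N \<Longrightarrow> increasing_path (g \<omega>)"
    and y [measurable]: "y \<in> borel_measurable N"
  shows "(\<lambda>\<omega>. first_passage (g \<omega>) (y \<omega>)) \<in> borel_measurable N"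
proof (rule borel_measurableI_less)
  fix r :: ennreal
  have "{\<omega>\<in>space N. first_passage (g \<omega>) (y \<omega>) < r} =
    (\<Union>q\<in>{q\<in>\<rat>. 0 < q \<and> ennreal q < r}. {\<omega>\<in>space N. y \<omega> < g \<omega> q})"
  proof (intro set_eqI iffI)
    fix \<omega> assume "\<omega> \<in> {\<omega>\<in>space N. first_passage (g \<omega>) (y \<omega>) < r}"
    then obtain u where \<omega>: "\<omega> \<in> space N" and u: "0 < u" "y \<omega> < g \<omega> u" "ennreal u < r"
      by (auto simp: first_passage_less_iff)
    obtain b where b: "u < b" "ennreal b \<le> r"
    proof (cases r)
      case (real c)
      then show ?thesis using u that[of c] by (auto simp: ennreal_less_iff)
    qed (use that[of "u + 1"] in auto)
    obtain q where q: "q \<in> \<rat>" "u < q" "q < b" using Rats_dense_in_real[OF b(1)] by blast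
    have "ennreal q < r" using q u by (intro less_le_trans[OF ennreal_lessI b(2)]) auto
    moreover have "y \<omega> < g \<omega> q"
      using increasing_path_mono[OF g(2)[OF \<omega>], of u q] u q by simp
    ultimately show "\<omega> \<in> (\<Union>q\<in>{q\<in>\<rat>. 0 < q \<and> ennreal q < r}. {\<omega>\<in>space N. y \<omega> < g \<omega> q})"
      using q u \<omega> by auto
  qed (auto simp: first_passage_less_iff)
  also have "\<dots> \<in> sets N"
  proof (rule sets.countable_UN''[OF countable_rats_on])
    fix q :: real assume "q \<in> {q\<in>\<rat>. 0 < q \<and> ennreal q < r}"
    then have [measurable]: "(\<lambda>\<omega>. g \<omega> q) \<in> borel_measurable N" using g(1) by simp
    show "{\<omega>\<in>space N. y \<omega> < g \<omega> q} \<in> sets N" by measurable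
  qed
  finally show "{\<omega>\<in>space N. first_passage (g \<omega>) (y \<omega>) < r} \<in> sets N" .
qed

lemma measurable_left_limit:
  fixes g :: "'n \<Rightarrow> real \<Rightarrow> real"
  assumes g: "\<And>u. 0 \<le> u \<Longrightarrow> (\<lambda>\<omega>. g \<omega> u) \<in> borel_measurable N"
      "\<And>\<omega>. \<omega> \<in> space N \<Longrightarrow> increasing_path (g \<omega>)"
    and r [measurable]: "r \<in> borel_measurable N"
  shows "(\<lambda>\<omega>. left_limit (g \<omega>) (r \<omega>)) \<in> borel_measurable N"
  unfolding borel_measurable_iff_greater
proof
  fix c
  have "{\<omega>\<in>space N. c < left_limit (g \<omega>) (r \<omega>)} =
    (\<Union>q\<in>{q\<in>\<rat>. 0 \<le> q}. {\<omega>\<in>space N. q < r \<omega> \<and> c < g \<omega> q}) \<union> {\<omega>\<in>space N. r \<omega> \<le> 0 \<and> c < 0}"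
  proof (intro set_eqI)
    fix \<omega>
    show "\<omega> \<in> {\<omega>\<in>space N. c < left_limit (g \<omega>) (r \<omega>)} \<longleftrightarrow> \<omega> \<in>
      (\<Union>q\<in>{q\<in>\<rat>. 0 \<le> q}. {\<omega>\<in>space N. q < r \<omega> \<and> c < g \<omega> q}) \<union> {\<omega>\<in>space N. r \<omega> \<le> 0 \<and> c < 0}"
      using left_limit_greater_iff[OF g(2), of \<omega> "r \<omega>" c] left_limit_nonpos[OF g(2), of \<omega> "r \<omega>"]
      by (cases "0 < r \<omega>") auto
  qed
  also have "\<dots> \<in> sets N"
  proof (intro sets.Un sets.countable_UN''[OF countable_rats_on])
    fix q :: real assume "q \<in> {q\<in>\<rat>. 0 \<le> q}"
    then have [measurable]: "(\<lambda>\<omega>. g \<omega> q) \<in> borel_measurable N" using g(1) by simp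
    show "{\<omega>\<in>space N. q < r \<omega> \<and> c < g \<omega> q} \<in> sets N" by measurable
  qed measurable
  finally show "{\<omega>\<in>space N. c < left_limit (g \<omega>) (r \<omega>)} \<in> sets N" .
qed

text \<open>The measurable space is a parameter because three instances occur: the given pieces on
  \<open>M\<close>, stopped pieces on \<open>past j q\<close>, and regularized paths on the product
  of path spaces.\<close>

locale measurable_paths =
  fixes N :: "'n measure" and s :: "'n \<Rightarrow> nat \<Rightarrow> real \<Rightarrow> real" and x :: "'n \<Rightarrow> real"
  assumes measurable_path: "0 \<le> u \<Longrightarrow> (\<lambda>\<omega>. s \<omega> i u) \<in> borel_measurable N"
    and path: "\<omega> \<in> space N \<Longrightarrow> increasing_path (s \<omega> i)"
    and measurable_start [measurable]: "x \<in> borel_measurable N"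
begin

lemma measurable_pos [measurable]: "(\<lambda>\<omega>. censored_pos (s \<omega>) (x \<omega>) j) \<in> borel_measurable N"
proof (induction j)
  case (Suc j)
  note this [measurable]
  have [measurable]: "(\<lambda>\<omega>. first_passage (s \<omega> j) (censored_pos (s \<omega>) (x \<omega>) j)) \<in> borel_measurable N"
    by (rule measurable_first_passage[where g = "\<lambda>\<omega>. s \<omega> j", OF measurable_path path]) auto
  have [measurable]: "(\<lambda>\<omega>. left_limit (s \<omega> j) (enn2real (first_passage (s \<omega> j) (censored_pos (s \<omega>) (x \<omega>) j))))
      \<in> borel_measurable N"
    by (rule measurable_left_limit[where g = "\<lambda>\<omega>. s \<omega> j", OF measurable_path path]) auto
  show ?case by simp
qed simp

lemma measurable_sigma [measurable]: "(\<lambda>\<omega>. censored_sigma (s \<omega>) (x \<omega>) j) \<in> borel_measurable N"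
  unfolding censored_sigma_def by (rule measurable_first_passage[where g = "\<lambda>\<omega>. s \<omega> j", OF measurable_path path]) auto

lemma measurable_tau [measurable]: "(\<lambda>\<omega>. censored_tau (s \<omega>) (x \<omega>) j) \<in> borel_measurable N"
  unfolding censored_tau_def by measurable

lemma measurable_in_phase [measurable]: "Measurable.pred N (\<lambda>\<omega>. in_phase (s \<omega>) (x \<omega>) t j)"
  unfolding in_phase_def by measurable

lemma measurable_value:
  assumes "0 \<le> t"
  shows "(\<lambda>\<omega>. censored_value (s \<omega>) (x \<omega>) t) \<in> borel_measurable N"
proof -
  \<comment> \<open>The \<open>max 0\<close> keeps the evaluation time nonnegative also off phase j,
    as evaluation of an increasing path at a random time demands; in phase j it changes
    nothing.\<close>
  define v where "v j \<omega> = censored_pos (s \<omega>) (x \<omega>) j -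
      s \<omega> j (max 0 (t - enn2real (censored_tau (s \<omega>) (x \<omega>) j)))" for j \<omega>
  have [measurable]: "v j \<in> borel_measurable N" for j
    unfolding v_def
    by (intro borel_measurable_diff measurable_pos
        measurable_eval_increasing_path[where g = "\<lambda>\<omega>. s \<omega> j", OF measurable_path path]) auto
  define V where "V \<omega> = (if \<exists>j. in_phase (s \<omega>) (x \<omega>) t j then max 0 (v (LEAST j. in_phase (s \<omega>) (x \<omega>) t j) \<omega>) else 0)" for \<omega>
  have [measurable]: "(\<lambda>\<omega>. v (LEAST j. in_phase (s \<omega>) (x \<omega>) t j) \<omega>) \<in> borel_measurable N"
    by (rule measurable_compose_countable[where f = v]) measurable
  have "V \<in> borel_measurable N"
    unfolding V_def by measurable
  moreover have "V \<omega> = censored_value (s \<omega>) (x \<omega>) t" if "\<omega> \<in> space N" for \<omega>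
  proof (cases "\<exists>j. in_phase (s \<omega>) (x \<omega>) t j")
    case True
    then have j: "in_phase (s \<omega>) (x \<omega>) t (LEAST j. in_phase (s \<omega>) (x \<omega>) t j)" by (metis LeastI)
    obtain a r where "0 \<le> r" "t = a + r" "enn2real (censored_tau (s \<omega>) (x \<omega>) (LEAST j. in_phase (s \<omega>) (x \<omega>) t j)) = a"
      using in_phaseE[OF j assms] by metis
    then show ?thesis
      unfolding censored_value_in_phase[OF j] V_def v_def using True by simp
  qed (simp add: V_def censored_value_no_phase)
  ultimately show ?thesis by (simp cong: measurable_cong)
qed

lemma measurable_censored_path:
  "0 \<le> t \<Longrightarrow> (\<lambda>\<omega>. censored_path (s \<omega>) (x \<omega>) t) \<in> N \<rightarrow>\<^sub>M censored_state"
  unfolding censored_path_eq_value by (intro measurable_of_value measurable_value)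

end

text \<open>
  The increasing paths do not form a measurable subset of the path space. Therefore functionals
  of paths are extended to all of it by composing them with a measurable retraction onto the
  increasing paths.
\<close>

definition regularize :: "(real \<Rightarrow> real) \<Rightarrow> real \<Rightarrow> real" where
  "regularize g t = (INF q\<in>{q\<in>\<rat>. t < q}. max 0 (g q)) - (INF q\<in>{q\<in>\<rat>. 0 < q}. max 0 (g q))"

lemma rats_above_nonempty: "{q\<in>\<rat>. (t::real) < q} \<noteq> {}"
  using Rats_dense_in_real[of t "t + 1"] by auto

lemma bdd_below_max: "bdd_below ((\<lambda>q. max 0 (g q :: real)) ` A)"
  by (intro bdd_belowI[of _ 0]) auto

lemma increasing_path_regularize: "increasing_path (regularize g)"
proof -
  \<comment> \<open>For an arbitrary function, an infimum over the rationals beyond t is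
    nondecreasing and right continuous in t. The \<open>max 0\<close> keeps these infima bounded
    below, and subtracting the value at 0 makes the path start at 0.\<close>
  define h where "h t = (INF q\<in>{q\<in>\<rat>. t < q}. max 0 (g q))" for t :: real
  have mono: "h t \<le> h u" if "t \<le> u" for t u
    unfolding h_def using that
    by (intro cINF_superset_mono rats_above_nonempty bdd_below_max) auto
  have right: "(h \<longlongrightarrow> h t) (at_right t)" for t
  proof (rule order_tendstoI)
    fix a assume "a < h t"
    then show "\<forall>\<^sub>F u in at_right t. a < h u"
      using mono by (auto simp: eventually_at_right_field intro!: exI[of _ "t + 1"] intro: less_le_trans)
  next
    fix a assume "h t < a"
    then obtain q where q: "q \<in> \<rat>" "t < q" "max 0 (g q) < a"
      unfolding h_def using cINF_less_iff[OF rats_above_nonempty bdd_below_max] by fastforce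
    have "h u < a" if "u < q" for u
      unfolding h_def using q that cINF_less_iff[OF rats_above_nonempty bdd_below_max] by fastforce
    then show "\<forall>\<^sub>F u in at_right t. h u < a"
      using q by (auto simp: eventually_at_right_field)
  qed
  have eq: "regularize g = (\<lambda>t. h t - h 0)" by (simp add: fun_eq_iff regularize_def h_def)
  show ?thesis
    unfolding increasing_path_def eq
    using mono right by (auto simp: mono_on_def continuous_within intro!: tendsto_intros)
qed

lemma regularize_eq:
  assumes g: "increasing_path g" and eq: "\<And>t. 0 \<le> t \<Longrightarrow> g' t = g t" and t: "0 \<le> t"
  shows "regularize g' t = g t"
proof -
  have *: "(INF q\<in>{q\<in>\<rat>. t < q}. max 0 (g' q)) = g t" if t: "0 \<le> t" for t
  proof (rule antisym)
    show "g t \<le> (INF q\<in>{q\<in>\<rat>. t < q}. max 0 (g' q))"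
      using t eq increasing_path_mono[OF g t]
      by (intro cINF_greatest rats_above_nonempty) (auto intro: max.coboundedI2)
    show "(INF q\<in>{q\<in>\<rat>. t < q}. max 0 (g' q)) \<le> g t"
    proof (rule dense_ge)
      fix c assume c: "g t < c"
      then obtain q where q: "q \<in> \<rat>" "t < q" "g q < c"
        using increasing_path_less_iff[OF g t] by blast
      then have "(INF q\<in>{q\<in>\<rat>. t < q}. max 0 (g' q)) \<le> max 0 (g' q)"
        by (intro cINF_lower bdd_below_max) auto
      also have "\<dots> \<le> c"
        using q t eq[of q] c increasing_path_nonneg[OF g t] by auto
      finally show "(INF q\<in>{q\<in>\<rat>. t < q}. max 0 (g' q)) \<le> c" .
    qed
  qed
  show ?thesis
    using *[OF t] *[of 0] increasing_path_zero[OF g] by (simp add: regularize_def)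
qed

lemma measurable_regularize:
  assumes t: "0 \<le> t"
  shows "(\<lambda>g. regularize g t) \<in> borel_measurable (path_space borel)"
proof -
  have "(\<lambda>g. INF q\<in>{q\<in>\<rat>. u < q}. max 0 (g q :: real)) \<in> borel_measurable (path_space borel)"
    if u: "0 \<le> u" for u
  proof (rule borel_measurable_cINF[OF countable_rats_on])
    fix q assume "q \<in> {q\<in>\<rat>. u < q}"
    then have [measurable]: "(\<lambda>g. g q :: real) \<in> borel_measurable (path_space borel)"
      using u by (intro measurable_component_singleton) auto
    show "(\<lambda>g. max 0 (g q :: real)) \<in> borel_measurable (path_space borel)" by simp
  qed (rule bdd_below_max)
  from this[OF t] this[of 0] show ?thesis
    unfolding regularize_def by (intro borel_measurable_diff) auto
qed

text \<open>The censored path as a function of its start and its pieces, defined on the entire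
  product space so that it can be evaluated under product laws.\<close>

definition path_functional :: "real \<times> (nat \<Rightarrow> real \<Rightarrow> real) \<Rightarrow> real \<Rightarrow> real option" where
  "path_functional = (\<lambda>(v, s). \<lambda>t\<in>{0..}. censored_path (\<lambda>j. regularize (s j)) v t)"

lemma measurable_path_functional [measurable]:
  "path_functional \<in> borel \<Otimes>\<^sub>M (\<Pi>\<^sub>M i\<in>UNIV. path_space borel) \<rightarrow>\<^sub>M path_space censored_state"
proof -
  interpret measurable_paths "borel \<Otimes>\<^sub>M (\<Pi>\<^sub>M i\<in>UNIV. path_space borel)" "\<lambda>(v, s) j. regularize (s j)" fst
  proof
    fix u :: real and i :: nat assume "0 \<le> u"
    then show "(\<lambda>\<omega>. (case \<omega> of (v, s) \<Rightarrow> \<lambda>j. regularize (s j)) i u)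
        \<in> borel_measurable (borel \<Otimes>\<^sub>M (\<Pi>\<^sub>M i\<in>UNIV. path_space borel))"
      unfolding split_beta by (intro measurable_compose[OF _ measurable_regularize]) auto
  qed (auto simp: increasing_path_regularize)
  have "(\<lambda>p. \<lambda>t\<in>{0..}. censored_path ((\<lambda>(v, s) j. regularize (s j)) p) (fst p) t)
      \<in> borel \<Otimes>\<^sub>M (\<Pi>\<^sub>M i\<in>UNIV. path_space borel) \<rightarrow>\<^sub>M path_space censored_state"
    by (intro measurable_restrict measurable_censored_path) auto
  then show ?thesis by (simp add: path_functional_def split_beta')
qed

lemma path_functional_eq:
  assumes "\<And>j. increasing_path (s j)"
    and "\<And>j t. 0 \<le> t \<Longrightarrow> s' j t = s j t"
  shows "path_functional (v, s') = (\<lambda>t\<in>{0..}. censored_path s v t)"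
  unfolding path_functional_def prod.case
proof (rule restrict_ext)
  fix t :: real assume "t \<in> {0..}"
  then show "censored_path (\<lambda>j. regularize (s' j)) v t = censored_path s v t"
    unfolding censored_path_eq_value
    by (intro arg_cong[where f = of_value] censored_value_cong increasing_path_regularize assms regularize_eq) auto
qed

section \<open>Independence of past and future\<close>

definition boxes :: "'i set \<Rightarrow> ('i \<Rightarrow> real) set set" where
  "boxes I = {{w\<in>space (\<Pi>\<^sub>M i\<in>I. borel). \<forall>u\<in>J. w u \<le> a u} |J a. finite J \<and> J \<subseteq> I}"

lemma boxes_sets: "boxes I \<subseteq> sets (\<Pi>\<^sub>M i\<in>I. borel)"
proof
  fix B assume "B \<in> boxes I"
  then obtain J a where J: "finite J" "J \<subseteq> I" and B: "B = {w\<in>space (\<Pi>\<^sub>M i\<in>I. borel). \<forall>u\<in>J. w u \<le> a u}"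
    by (auto simp: boxes_def)
  have "{w\<in>space (\<Pi>\<^sub>M i\<in>I. borel). w u \<le> a u} \<in> sets (\<Pi>\<^sub>M i\<in>I. borel)" if "u \<in> J" for u
  proof -
    have [measurable]: "(\<lambda>w. w u) \<in> (\<Pi>\<^sub>M i\<in>I. borel) \<rightarrow>\<^sub>M borel"
      using that J by (intro measurable_component_singleton) auto
    show ?thesis by measurable
  qed
  then show "B \<in> sets (\<Pi>\<^sub>M i\<in>I. borel)"
    unfolding B using J(1) by (rule sets.sets_Collect_finite_All)
qed

lemma Int_stable_boxes: "Int_stable (boxes I)"
proof (rule Int_stableI)
  fix A B assume "A \<in> boxes I" "B \<in> boxes I"
  then obtain J a K b where J: "finite J" "J \<subseteq> I" and A: "A = {w\<in>space (\<Pi>\<^sub>M i\<in>I. borel). \<forall>u\<in>J. w u \<le> a u}"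
    and K: "finite K" "K \<subseteq> I" and B: "B = {w\<in>space (\<Pi>\<^sub>M i\<in>I. borel). \<forall>u\<in>K. w u \<le> b u}"
    by (auto simp: boxes_def)
  define c where "c u = (if u \<in> J then if u \<in> K then min (a u) (b u) else a u else b u)" for u
  have "A \<inter> B = {w\<in>space (\<Pi>\<^sub>M i\<in>I. borel). \<forall>u\<in>J \<union> K. w u \<le> c u}"
    unfolding A B by (auto simp: c_def)
  then show "A \<inter> B \<in> boxes I"
    unfolding boxes_def using J K by (auto intro!: exI[of _ "J \<union> K"] exI[of _ c])
qed

lemma sets_PiM_boxes: "sets (\<Pi>\<^sub>M i\<in>I. borel) = sigma_sets (space (\<Pi>\<^sub>M i\<in>I. borel)) (boxes I)"
proof (rule antisym)
  let ?P = "\<Pi>\<^sub>M i\<in>I. (borel :: real measure)"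
  let ?G = "sigma (space ?P) (boxes I)"
  have G: "boxes I \<subseteq> Pow (space ?P)"
    using boxes_sets sets.sets_into_space by blast
  have sets_G: "sets ?G = sigma_sets (space ?P) (boxes I)" and space_G: "space ?G = space ?P"
    using G by simp_all
  have "(\<lambda>w. \<lambda>i\<in>I. w i) \<in> ?G \<rightarrow>\<^sub>M ?P"
  proof (rule measurable_restrict)
    fix i assume i: "i \<in> I"
    show "(\<lambda>w. w i) \<in> ?G \<rightarrow>\<^sub>M borel"
      unfolding borel_measurable_iff_le
    proof
      fix c
      have "{w \<in> space ?P. w i \<le> c} \<in> boxes I"
        unfolding boxes_def using i by (auto intro!: exI[of _ "{i}"] exI[of _ "\<lambda>_. c"])
      then show "{w \<in> space ?G. w i \<le> c} \<in> sets ?G"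
        unfolding space_G sets_G by (rule sigma_sets.Basic)
    qed
  qed
  moreover have "(\<lambda>i\<in>I. w i) = w" if "w \<in> space ?G" for w
    using that unfolding space_G by (auto simp: space_PiM)
  ultimately have "(\<lambda>w. w) \<in> ?G \<rightarrow>\<^sub>M ?P" by (simp cong: measurable_cong)
  then have "A \<in> sets ?G" if "A \<in> sets ?P" for A
    using measurable_sets[of "\<lambda>w. w" ?G ?P A] that sets.sets_into_space[OF that]
    by (simp add: space_G Int_absorb2 vimage_def)
  then show "sets ?P \<subseteq> sigma_sets (space ?P) (boxes I)" unfolding sets_G by blast
  show "sigma_sets (space ?P) (boxes I) \<subseteq> sets ?P"
    by (rule sets.sigma_sets_subset[OF boxes_sets])
qed

text \<open>Joint distribution functions at finitely many indices determine the measure, by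
  stability of boxes under intersection. The box with empty J is the whole space, whose finite mass
  the uniqueness argument requires.\<close>

lemma measure_eqI_boxes:
  assumes "finite_measure M1" "sets M1 = sets (\<Pi>\<^sub>M i\<in>I. borel)" "sets M2 = sets (\<Pi>\<^sub>M i\<in>I. borel)"
    and "\<And>J a. finite J \<Longrightarrow> J \<subseteq> I \<Longrightarrow>
      emeasure M1 {w\<in>space (\<Pi>\<^sub>M i\<in>I. borel). \<forall>u\<in>J. w u \<le> a u} =
      emeasure M2 {w\<in>space (\<Pi>\<^sub>M i\<in>I. borel). \<forall>u\<in>J. w u \<le> (a u :: real)}"
  shows "M1 = M2"
proof (rule measure_eqI_generator_eq[OF Int_stable_boxes[of I]])
  let ?P = "\<Pi>\<^sub>M i\<in>I. (borel :: real measure)"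
  show "boxes I \<subseteq> Pow (space ?P)" using boxes_sets sets.sets_into_space by blast
  show "emeasure M1 X = emeasure M2 X" if "X \<in> boxes I" for X
    using that assms(4) by (auto simp: boxes_def)
  show "range (\<lambda>_::nat. space ?P) \<subseteq> boxes I"
    unfolding boxes_def by (auto intro!: exI[of _ "{}"])
  show "emeasure M1 (space ?P) \<noteq> \<infinity>"
    using finite_measure.emeasure_finite[OF assms(1)] by simp
qed (auto simp: assms sets_PiM_boxes)

text \<open>Increments are controlled along strictly increasing chains, whereas events come with
  finite sets of times. Starting the chain at 0 makes each value of the subordinator a sum of
  increments.\<close>

lemma finite_times_enumerate:
  fixes L :: "real set"
  assumes "finite L" "0 \<in> L" "L \<subseteq> {0..}"
  obtains t n where "t (0::nat) = 0" "\<And>i. i < n \<Longrightarrow> t i < t (Suc i)" "L = t ` {..n}"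
proof -
  define l where "l = sorted_list_of_set L"
  have l: "set l = L" "sorted_wrt (<) l" "l \<noteq> []"
    using assms by (auto simp: l_def strict_sorted_iff)
  define n where "n = length l - 1"
  have len: "length l = Suc n" using l(3) by (simp add: n_def)
  have L: "L = (!) l ` {..n}"
    using l(1) len by (auto simp: set_conv_nth less_Suc_eq_le)
  have less: "l ! i < l ! j" if "i < j" "j \<le> n" for i j
    using sorted_wrt_nth_less[OF l(2)] that len by simp
  obtain k where k: "k \<le> n" "l ! k = 0" using assms(2) L by force
  have "l ! 0 \<ge> 0" using assms(3) L by auto
  then have "k = 0" using less[of 0 k] k by (cases k) auto
  then show ?thesis using that[of "(!) l" n] less k L by auto
qed

lemma strict_chain_less:
  fixes t :: "nat \<Rightarrow> real"
  assumes "\<And>i. i < n \<Longrightarrow> t i < t (Suc i)" "i < j" "j \<le> n"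
  shows "t i < t j"
  using assms(2,3)
proof (induction j)
  case (Suc j)
  then show ?case using assms(1)[of j] by (cases "i = j") (auto intro: less_trans)
qed simp

section \<open>Independence and stationarity of one subordinator at a fixed time\<close>

context subordinator
begin

lemma increasing_path_S: "\<omega> \<in> space M \<Longrightarrow> increasing_path (\<lambda>t. S t \<omega>)"
  using start_zero increasing right_continuous by (simp add: increasing_path_def)

lemma measurable_S_path: "path S \<in> M \<rightarrow>\<^sub>M path_space borel"
  unfolding path_def by (intro measurable_restrict measurable_S) auto

lemma S_eq_sum:
  "t 0 = 0 \<Longrightarrow> \<omega> \<in> space M \<Longrightarrow> S (t i) \<omega> = (\<Sum>k<i. S (t (Suc k)) \<omega> - S (t k) \<omega>)"
  using sum_lessThan_telescope[of "\<lambda>k. S (t k) \<omega>" i] by (simp add: start_zero)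

text \<open>All times involved are put on one chain that also contains q, say as its m-th point.
  Values up to q are sums of the increments before index m, shifted values are sums of those from m
  on, and disjoint blocks of independent variables are independent.\<close>

lemma indep_past_increments:
  assumes q: "0 \<le> q" and J: "finite J" "J \<subseteq> {0..q}" and K: "finite K" "K \<subseteq> {0..}"
  shows "prob {\<omega>\<in>space M. (\<forall>u\<in>J. S u \<omega> \<le> a u) \<and> (\<forall>v\<in>K. S (q + v) \<omega> - S q \<omega> \<le> b v)} =
    prob {\<omega>\<in>space M. \<forall>u\<in>J. S u \<omega> \<le> a u} * prob {\<omega>\<in>space M. \<forall>v\<in>K. S (q + v) \<omega> - S q \<omega> \<le> b v}"
proof -
  let ?L = "{0, q} \<union> J \<union> (+) q ` K"
  have "finite ?L" "0 \<in> ?L" "?L \<subseteq> {0..}" using J K q by auto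
  then obtain t n where t: "t (0::nat) = 0" "\<And>i. i < n \<Longrightarrow> t i < t (Suc i)" and L: "?L = t ` {..n}"
    using finite_times_enumerate[of ?L] by metis
  have less: "t i < t j" if "i < j" "j \<le> n" for i j
    by (rule strict_chain_less[where t = t and n = n]) (use t that in auto)
  define X where "X k \<omega> = S (t (Suc k)) \<omega> - S (t k) \<omega>" for k \<omega>
  have ind: "indep_vars (\<lambda>_. borel) X {..<n}"
    unfolding X_def using t by (intro independent_increments) auto
  obtain m where m: "m \<le> n" "t m = q" using L by (metis (no_types, lifting) UnI1 atMost_iff imageE insertCI)
  have "\<forall>u\<in>J. \<exists>i\<le>n. t i = u" using L by (metis (no_types, lifting) UnI1 UnI2 atMost_iff imageE)
  moreover have "\<And>i. i \<le> n \<Longrightarrow> t i \<in> J \<Longrightarrow> i \<le> m"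
    using less[of m] m J(2) by (metis atLeastAtMost_iff not_le subsetD)
  ultimately obtain idx where idx: "\<And>u. u \<in> J \<Longrightarrow> idx u \<le> m \<and> t (idx u) = u" by metis
  have "\<forall>v\<in>K. \<exists>i\<le>n. t i = q + v" using L by (metis (no_types, lifting) UnI2 atMost_iff imageE image_eqI)
  moreover have "\<And>i v. i \<le> n \<Longrightarrow> v \<in> K \<Longrightarrow> t i = q + v \<Longrightarrow> m \<le> i"
    using less[of _ m] m K(2) by (metis add_increasing2 atLeast_iff not_le order_refl subsetD)
  ultimately obtain jdx where jdx: "\<And>v. v \<in> K \<Longrightarrow> m \<le> jdx v \<and> jdx v \<le> n \<and> t (jdx v) = q + v" by metis
  let ?P = "\<lambda>A. \<Pi>\<^sub>M k\<in>A. (borel :: real measure)"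
  have iv: "indep_var (?P {..<m}) (\<lambda>\<omega>. \<lambda>k\<in>{..<m}. X k \<omega>) (?P {m..<n}) (\<lambda>\<omega>. \<lambda>k\<in>{m..<n}. X k \<omega>)"
    using m by (intro indep_var_restrict[OF ind]) auto
  define D where "D = {f\<in>space (?P {..<m}). \<forall>u\<in>J. (\<Sum>k<idx u. f k) \<le> a u}"
  define E where "E = {f\<in>space (?P {m..<n}). \<forall>v\<in>K. (\<Sum>k\<in>{m..<jdx v}. f k) \<le> b v}"
  have D: "D \<in> sets (?P {..<m})"
    unfolding D_def
  proof (rule sets.sets_Collect_finite_All[OF _ J(1)])
    fix u assume u: "u \<in> J"
    have [measurable]: "(\<lambda>f. \<Sum>k<idx u. f k) \<in> borel_measurable (?P {..<m})"
      using idx[OF u] by (intro borel_measurable_sum measurable_component_singleton) auto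
    show "{f\<in>space (?P {..<m}). (\<Sum>k<idx u. f k) \<le> a u} \<in> sets (?P {..<m})" by measurable
  qed
  have E: "E \<in> sets (?P {m..<n})"
    unfolding E_def
  proof (rule sets.sets_Collect_finite_All[OF _ K(1)])
    fix v assume v: "v \<in> K"
    have [measurable]: "(\<lambda>f. \<Sum>k\<in>{m..<jdx v}. f k) \<in> borel_measurable (?P {m..<n})"
      using jdx[OF v] by (intro borel_measurable_sum measurable_component_singleton) auto
    show "{f\<in>space (?P {m..<n}). (\<Sum>k\<in>{m..<jdx v}. f k) \<le> b v} \<in> sets (?P {m..<n})" by measurable
  qed
  have sumJ: "(\<Sum>k<idx u. (\<lambda>k\<in>{..<m}. X k \<omega>) k) = S u \<omega>" if "\<omega> \<in> space M" "u \<in> J" for u \<omega>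
  proof -
    have "(\<Sum>k<idx u. (\<lambda>k\<in>{..<m}. X k \<omega>) k) = (\<Sum>k<idx u. X k \<omega>)"
      using idx[OF that(2)] by (intro sum.cong) auto
    then show ?thesis using S_eq_sum[of t \<omega> "idx u"] t that idx[OF that(2)] by (simp add: X_def)
  qed
  have sumK: "(\<Sum>k\<in>{m..<jdx v}. (\<lambda>k\<in>{m..<n}. X k \<omega>) k) = S (q + v) \<omega> - S q \<omega>" if "\<omega> \<in> space M" "v \<in> K" for v \<omega>
  proof -
    have "(\<Sum>k\<in>{m..<jdx v}. (\<lambda>k\<in>{m..<n}. X k \<omega>) k) = (\<Sum>k\<in>{m..<jdx v}. X k \<omega>)"
      using jdx[OF that(2)] by (intro sum.cong) auto
    also have "\<dots> = S (t (jdx v)) \<omega> - S (t m) \<omega>"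
      using sum_Suc_diff'[of m "jdx v" "\<lambda>k. S (t k) \<omega>"] jdx[OF that(2)] by (simp add: X_def)
    finally show ?thesis using jdx[OF that(2)] m by simp
  qed
  have eqD: "(\<lambda>\<omega>. \<lambda>k\<in>{..<m}. X k \<omega>) -` D \<inter> space M = {\<omega>\<in>space M. \<forall>u\<in>J. S u \<omega> \<le> a u}"
    using sumJ by (auto simp: D_def space_PiM)
  have eqE: "(\<lambda>\<omega>. \<lambda>k\<in>{m..<n}. X k \<omega>) -` E \<inter> space M = {\<omega>\<in>space M. \<forall>v\<in>K. S (q + v) \<omega> - S q \<omega> \<le> b v}"
    using sumK by (auto simp: E_def space_PiM)
  have "prob ((\<lambda>\<omega>. (\<lambda>k\<in>{..<m}. X k \<omega>, \<lambda>k\<in>{m..<n}. X k \<omega>)) -` (D \<times> E) \<inter> space M) =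
    prob ((\<lambda>\<omega>. \<lambda>k\<in>{..<m}. X k \<omega>) -` D \<inter> space M) * prob ((\<lambda>\<omega>. \<lambda>k\<in>{m..<n}. X k \<omega>) -` E \<inter> space M)"
    by (rule indep_varD[OF iv D E])
  moreover have "(\<lambda>\<omega>. (\<lambda>k\<in>{..<m}. X k \<omega>, \<lambda>k\<in>{m..<n}. X k \<omega>)) -` (D \<times> E) \<inter> space M =
    ((\<lambda>\<omega>. \<lambda>k\<in>{..<m}. X k \<omega>) -` D \<inter> space M) \<inter> ((\<lambda>\<omega>. \<lambda>k\<in>{m..<n}. X k \<omega>) -` E \<inter> space M)" by auto
  moreover have "{\<omega>\<in>space M. \<forall>u\<in>J. S u \<omega> \<le> a u} \<inter> {\<omega>\<in>space M. \<forall>v\<in>K. S (q + v) \<omega> - S q \<omega> \<le> b v} =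
    {\<omega>\<in>space M. (\<forall>u\<in>J. S u \<omega> \<le> a u) \<and> (\<forall>v\<in>K. S (q + v) \<omega> - S q \<omega> \<le> b v)}" by auto
  ultimately show ?thesis by (simp only: eqD eqE)
qed

text \<open>Both sides are the product of the laws of S at the differences of consecutive times, for
  every nonnegative offset p. The empty chain is separate because the product characterization of
  independence is applied to a nonempty index set.\<close>

lemma distr_increments:
  assumes q: "0 \<le> q" and t: "t (0::nat) = 0" "\<And>i. i < n \<Longrightarrow> t i < t (Suc i)"
  shows "distr M (\<Pi>\<^sub>M k\<in>{..<n}. borel) (\<lambda>\<omega>. \<lambda>k\<in>{..<n}. S (q + t (Suc k)) \<omega> - S (q + t k) \<omega>) =
    distr M (\<Pi>\<^sub>M k\<in>{..<n}. borel) (\<lambda>\<omega>. \<lambda>k\<in>{..<n}. S (t (Suc k)) \<omega> - S (t k) \<omega>)"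
proof (cases "n = 0")
  case False
  have less: "t i < t j" if "i < j" "j \<le> n" for i j
    by (rule strict_chain_less[where t = t and n = n]) (use t that in auto)
  have t_nonneg: "0 \<le> t i" if "i \<le> n" for i
    using less[of 0 i] t(1) that by (cases i) auto
  have meas: "(\<lambda>\<omega>. S (p + t (Suc k)) \<omega> - S (p + t k) \<omega>) \<in> borel_measurable M" if "0 \<le> p" "k < n" for p k
    using that t_nonneg[of k] t_nonneg[of "Suc k"] by (intro borel_measurable_diff measurable_S) auto
  have *: "distr M (\<Pi>\<^sub>M k\<in>{..<n}. borel) (\<lambda>\<omega>. \<lambda>k\<in>{..<n}. S (p + t (Suc k)) \<omega> - S (p + t k) \<omega>) =
    (\<Pi>\<^sub>M k\<in>{..<n}. distr M borel (S (t (Suc k) - t k)))" if p: "0 \<le> p" for p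
  proof -
    have "indep_vars (\<lambda>_. borel) (\<lambda>k \<omega>. S (p + t (Suc k)) \<omega> - S (p + t k) \<omega>) {..<n}"
      using independent_increments[of "\<lambda>k. p + t k" n] t p by simp
    then have "distr M (\<Pi>\<^sub>M k\<in>{..<n}. borel) (\<lambda>\<omega>. \<lambda>k\<in>{..<n}. S (p + t (Suc k)) \<omega> - S (p + t k) \<omega>) =
      (\<Pi>\<^sub>M k\<in>{..<n}. distr M borel (\<lambda>\<omega>. S (p + t (Suc k)) \<omega> - S (p + t k) \<omega>))"
      using False meas[OF p] by (subst (asm) indep_vars_iff_distr_eq_PiM') auto
    also have "\<dots> = (\<Pi>\<^sub>M k\<in>{..<n}. distr M borel (S (t (Suc k) - t k)))"
    proof (rule PiM_cong)
      fix k assume "k \<in> {..<n}"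
      then show "distr M borel (\<lambda>\<omega>. S (p + t (Suc k)) \<omega> - S (p + t k) \<omega>) = distr M borel (S (t (Suc k) - t k))"
        using stationary_increments[of "p + t k" "t (Suc k) - t k"] p t(2)[of k] t_nonneg[of k] by simp
    qed simp
    finally show ?thesis .
  qed
  show ?thesis using *[OF q] *[of 0] by simp
qed (auto intro!: distr_cong simp: restrict_def)

lemma prob_increments_stationary:
  assumes q: "0 \<le> q" and K: "finite K" "K \<subseteq> {0..}"
  shows "prob {\<omega>\<in>space M. \<forall>v\<in>K. S (q + v) \<omega> - S q \<omega> \<le> b v} = prob {\<omega>\<in>space M. \<forall>v\<in>K. S v \<omega> \<le> b v}"
proof -
  obtain t n where t: "t (0::nat) = 0" "\<And>i. i < n \<Longrightarrow> t i < t (Suc i)" and L: "insert 0 K = t ` {..n}"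
    using finite_times_enumerate[of "insert 0 K"] K by auto
  have less: "t i < t j" if "i < j" "j \<le> n" for i j
    by (rule strict_chain_less[where t = t and n = n]) (use t that in auto)
  have t_nonneg: "0 \<le> t i" if "i \<le> n" for i
    using less[of 0 i] t(1) that by (cases i) auto
  have "\<forall>v\<in>K. \<exists>i\<le>n. t i = v" using L by (metis atMost_iff imageE insertCI)
  then obtain idx where idx: "\<And>v. v \<in> K \<Longrightarrow> idx v \<le> n \<and> t (idx v) = v" by metis
  let ?P = "\<Pi>\<^sub>M k\<in>{..<n}. (borel :: real measure)"
  let ?X = "\<lambda>p \<omega>. \<lambda>k\<in>{..<n}. S (p + t (Suc k)) \<omega> - S (p + t k) \<omega>"
  define D where "D = {f\<in>space ?P. \<forall>v\<in>K. (\<Sum>k<idx v. f k) \<le> b v}"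
  have D: "D \<in> sets ?P"
    unfolding D_def
  proof (rule sets.sets_Collect_finite_All[OF _ K(1)])
    fix v assume v: "v \<in> K"
    have [measurable]: "(\<lambda>f. \<Sum>k<idx v. f k) \<in> borel_measurable ?P"
      using idx[OF v] by (intro borel_measurable_sum measurable_component_singleton) auto
    show "{f\<in>space ?P. (\<Sum>k<idx v. f k) \<le> b v} \<in> sets ?P" by measurable
  qed
  have *: "measure (distr M ?P (?X p)) D = prob {\<omega>\<in>space M. \<forall>v\<in>K. S (p + v) \<omega> - S p \<omega> \<le> b v}" if p: "0 \<le> p" for p
  proof -
    have sumK: "(\<Sum>k<idx v. ?X p \<omega> k) = S (p + v) \<omega> - S p \<omega>" if v: "v \<in> K" for v \<omega>
    proof -
      have "(\<Sum>k<idx v. ?X p \<omega> k) = (\<Sum>k<idx v. S (p + t (Suc k)) \<omega> - S (p + t k) \<omega>)"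
        using idx[OF v] by (intro sum.cong) auto
      also have "\<dots> = S (p + t (idx v)) \<omega> - S (p + t 0) \<omega>" using sum_lessThan_telescope[of "\<lambda>k. S (p + t k) \<omega>" "idx v"] by simp
      finally show ?thesis using idx[OF v] t by simp
    qed
    have "?X p -` D \<inter> space M = {\<omega>\<in>space M. \<forall>v\<in>K. S (p + v) \<omega> - S p \<omega> \<le> b v}"
      using sumK by (auto simp: D_def space_PiM)
    moreover have "?X p \<in> M \<rightarrow>\<^sub>M ?P"
      using p t_nonneg by (intro measurable_restrict borel_measurable_diff measurable_S) auto
    ultimately show ?thesis using D by (simp add: measure_distr)
  qed
  have "{\<omega>\<in>space M. \<forall>v\<in>K. S (0 + v) \<omega> - S 0 \<omega> \<le> b v} = {\<omega>\<in>space M. \<forall>v\<in>K. S v \<omega> \<le> b v}"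
    using start_zero by auto
  then show ?thesis using *[OF q] *[of 0] distr_increments[OF q t] by simp
qed

lemma measurable_shifted_path:
  "0 \<le> q \<Longrightarrow> path (\<lambda>u \<omega>. S (q + u) \<omega> - S q \<omega>) \<in> M \<rightarrow>\<^sub>M path_space borel"
  unfolding path_def by (intro measurable_restrict borel_measurable_diff measurable_S) auto

lemma distr_shifted_path:
  assumes q: "0 \<le> q"
  shows "distr M (path_space borel) (path (\<lambda>u \<omega>. S (q + u) \<omega> - S q \<omega>)) = distr M (path_space borel) (path S)"
proof (rule measure_eqI_boxes)
  show "finite_measure (distr M (path_space borel) (path (\<lambda>u \<omega>. S (q + u) \<omega> - S q \<omega>)))"
    by (intro finite_measure_distr measurable_shifted_path q)
  fix J :: "real set" and a assume J: "finite J" "J \<subseteq> {0..}"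
  let ?B = "{w\<in>space (path_space borel). \<forall>u\<in>J. w u \<le> (a u :: real)}"
  have B: "?B \<in> sets (path_space borel)"
    using J boxes_sets[of "{0..}"] by (auto simp: boxes_def)
  have "path (\<lambda>u \<omega>. S (q + u) \<omega> - S q \<omega>) -` ?B \<inter> space M =
      {\<omega>\<in>space M. \<forall>u\<in>J. S (q + u) \<omega> - S q \<omega> \<le> a u}"
    using J by (auto simp: path_def space_PiM)
  moreover have "path S -` ?B \<inter> space M = {\<omega>\<in>space M. \<forall>u\<in>J. S u \<omega> \<le> a u}"
    using J by (auto simp: path_def space_PiM)
  ultimately show "emeasure (distr M (path_space borel) (path (\<lambda>u \<omega>. S (q + u) \<omega> - S q \<omega>))) ?B =
      emeasure (distr M (path_space borel) (path S)) ?B"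
    using prob_increments_stationary[OF q J, of a]
    by (simp add: emeasure_distr[OF measurable_shifted_path[OF q] B] emeasure_distr[OF measurable_S_path B] emeasure_eq_measure)
qed simp_all

end

section \<open>Sequences of independent pieces\<close>

locale iid_subordinators = prob_space M for M :: "'a measure" +
  fixes S :: "nat \<Rightarrow> real \<Rightarrow> 'a \<Rightarrow> real"
  assumes subordinators: "subordinator M (S j)"
    and iid: "iid_processes M S"
begin

sublocale S: subordinator M "S j" for j by (rule subordinators)

definition path_law :: "(real \<Rightarrow> real) measure" where
  "path_law = distr M (path_space borel) (path (S 0))"

abbreviation family_space :: "(nat \<Rightarrow> real \<Rightarrow> real) measure" where
  "family_space \<equiv> \<Pi>\<^sub>M i\<in>UNIV. path_space borel"

abbreviation family_law :: "(nat \<Rightarrow> real \<Rightarrow> real) measure" where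
  "family_law \<equiv> \<Pi>\<^sub>M i\<in>UNIV. path_law"

definition family :: "'a \<Rightarrow> nat \<Rightarrow> real \<Rightarrow> real" where
  "family \<omega> = (\<lambda>i. path (S i) \<omega>)"

abbreviation earlier_space :: "nat \<Rightarrow> (nat \<Rightarrow> real \<Rightarrow> real) measure" where
  "earlier_space j \<equiv> \<Pi>\<^sub>M i\<in>{..<j}. path_space borel"

abbreviation earlier :: "nat \<Rightarrow> 'a \<Rightarrow> nat \<Rightarrow> real \<Rightarrow> real" where
  "earlier j \<omega> \<equiv> \<lambda>i\<in>{..<j}. path (S i) \<omega>"

definition later_family :: "nat \<Rightarrow> 'a \<Rightarrow> nat \<Rightarrow> real \<Rightarrow> real" where
  "later_family j \<omega> = (\<lambda>k. path (S (Suc j + k)) \<omega>)"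

lemma indep_paths: "indep_vars (\<lambda>_. path_space borel) (\<lambda>j. path (S j)) UNIV"
  using iid by (simp add: iid_processes_def)

lemma distr_path: "distr M (path_space borel) (path (S j)) = path_law"
  using iid unfolding iid_processes_def path_law_def by blast

lemma measurable_family: "family \<in> M \<rightarrow>\<^sub>M family_space"
  unfolding family_def using measurable_space[OF S.measurable_S_path]
  by (intro measurable_PiM_single' S.measurable_S_path) (auto simp: PiE_def)

lemma measurable_later_family: "later_family j \<in> M \<rightarrow>\<^sub>M family_space"
  unfolding later_family_def using measurable_space[OF S.measurable_S_path]
  by (intro measurable_PiM_single' S.measurable_S_path) (auto simp: PiE_def)

lemma distr_family: "distr M family_space family = family_law"
  using indep_paths
  by (subst (asm) indep_vars_iff_distr_eq_PiM') (simp_all add: S.measurable_S_path distr_path family_def[abs_def] restrict_UNIV)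

text \<open>The later pieces are an injective relabelling of coordinates, under which a product of
  identical laws is invariant.\<close>

lemma distr_later_family: "distr M family_space (later_family j) = family_law"
proof -
  have "distr M family_space (later_family j) =
      distr (distr M family_space family) family_space (\<lambda>f. \<lambda>k\<in>UNIV. f (Suc j + k))"
  proof (subst distr_distr)
    show "(\<lambda>f. \<lambda>k\<in>UNIV. f (Suc j + k)) \<in> family_space \<rightarrow>\<^sub>M family_space"
      by (intro measurable_restrict measurable_component_singleton) simp
  qed (simp_all add: measurable_family comp_def family_def later_family_def[abs_def] restrict_UNIV)
  also have "\<dots> = distr family_law (\<Pi>\<^sub>M i\<in>UNIV. path_law) (\<lambda>f. \<lambda>k\<in>UNIV. f (Suc j + k))"
    unfolding distr_family by (intro distr_cong sets_PiM_cong) (simp_all add: path_law_def)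
  also have "\<dots> = family_law"
    using prob_space_distr[OF S.measurable_S_path[of 0]]
    by (intro distr_PiM_reindex[of UNIV "\<lambda>_. path_law" "\<lambda>k. Suc j + k" UNIV]) (auto simp: path_law_def inj_on_def)
  finally show ?thesis .
qed

text \<open>The indices below j, j itself and those above j are disjoint, so independence survives
  grouping. The middle block is isolated because it is the one to be cut further at a local
  time.\<close>

lemma indep_three_blocks:
  assumes D1: "D1 \<in> sets (earlier_space j)" and D2: "D2 \<in> sets (path_space borel)"
    and D3: "D3 \<in> sets family_space"
  shows "prob {\<omega>\<in>space M. earlier j \<omega> \<in> D1 \<and> path (S j) \<omega> \<in> D2 \<and> later_family j \<omega> \<in> D3} =
    prob {\<omega>\<in>space M. earlier j \<omega> \<in> D1} * prob {\<omega>\<in>space M. path (S j) \<omega> \<in> D2} *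
    prob {\<omega>\<in>space M. later_family j \<omega> \<in> D3}"
proof -
  define K where "K n = (if n = 0 then {..<j} else if n = 1 then {j} else {j<..})" for n :: nat
  let ?P = "\<lambda>n. \<Pi>\<^sub>M i\<in>K n. path_space (borel :: real measure)"
  let ?X = "\<lambda>n \<omega>. \<lambda>i\<in>K n. path (S i) \<omega>"
  define A where "A n = (if n = 0 then D1 else if n = 1 then {f\<in>space (?P 1). f j \<in> D2}
    else {f\<in>space (?P 2). (\<lambda>k. f (Suc j + k)) \<in> D3})" for n :: nat
  have "indep_vars ?P ?X {0, 1, 2}"
    by (rule indep_vars_restrict[OF indep_paths]) (auto simp: K_def disjoint_family_on_def)
  then have "prob (\<Inter>n\<in>{0, 1, 2}. ?X n -` A n \<inter> space M) = (\<Prod>n\<in>{0, 1, 2}. prob (?X n -` A n \<inter> space M))"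
  proof (rule indep_varsD_finite)
    have [measurable]: "(\<lambda>f. f j) \<in> ?P 1 \<rightarrow>\<^sub>M path_space borel"
      by (intro measurable_component_singleton) (simp add: K_def)
    have [measurable]: "(\<lambda>f k. f (Suc j + k)) \<in> ?P 2 \<rightarrow>\<^sub>M family_space"
    proof (rule measurable_PiM_single')
      show "(\<lambda>f. f (Suc j + k)) \<in> ?P 2 \<rightarrow>\<^sub>M path_space borel" for k
        by (intro measurable_component_singleton) (simp add: K_def)
      then show "(\<lambda>f k. f (Suc j + k)) \<in> space (?P 2) \<rightarrow> (\<Pi>\<^sub>E i\<in>UNIV. space (path_space borel))"
        by (auto dest!: measurable_space)
    qed
    have "{f\<in>space (?P 1). f j \<in> D2} \<in> sets (?P 1)" "{f\<in>space (?P 2). (\<lambda>k. f (Suc j + k)) \<in> D3} \<in> sets (?P 2)"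
      using D2 D3 by measurable
    then show "A i \<in> sets (?P i)" if "i \<in> {0, 1, 2}" for i
      using that D1 by (auto simp: A_def K_def)
  qed auto
  moreover have "?X 0 -` A 0 \<inter> space M = {\<omega>\<in>space M. earlier j \<omega> \<in> D1}"
    by (auto simp: A_def K_def)
  moreover have "?X 1 -` A 1 \<inter> space M = {\<omega>\<in>space M. path (S j) \<omega> \<in> D2}"
    using measurable_space[OF S.measurable_S_path] by (auto simp: A_def K_def space_PiM[of "{j}"])
  moreover have "?X 2 -` A 2 \<inter> space M = {\<omega>\<in>space M. later_family j \<omega> \<in> D3}"
    using measurable_space[OF S.measurable_S_path] by (auto simp: A_def K_def space_PiM[of "{j<..}"] later_family_def)
  moreover have "{\<omega>\<in>space M. earlier j \<omega> \<in> D1 \<and> path (S j) \<omega> \<in> D2 \<and> later_family j \<omega> \<in> D3} =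
    {\<omega>\<in>space M. earlier j \<omega> \<in> D1} \<inter> ({\<omega>\<in>space M. path (S j) \<omega> \<in> D2} \<inter> {\<omega>\<in>space M. later_family j \<omega> \<in> D3})"
    by auto
  ultimately show ?thesis by (simp add: mult.assoc)
qed

text \<open>An intersection-stable generator of the information in all pieces before j and in piece
  j up to local time q. The time is local and deterministic, so the random \<open>tau\<close> does
  not enter here.\<close>

definition past_events :: "nat \<Rightarrow> real \<Rightarrow> 'a set set" where
  "past_events j q = {{\<omega>\<in>space M. earlier j \<omega> \<in> D \<and> (\<forall>u\<in>J. S j u \<omega> \<le> a u)} |D J a.
     D \<in> sets (earlier_space j) \<and> finite J \<and> J \<subseteq> {0..q}}"

definition past :: "nat \<Rightarrow> real \<Rightarrow> 'a measure" where
  "past j q = sigma (space M) (past_events j q)"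

definition future_events :: "nat \<Rightarrow> real \<Rightarrow> 'a set set" where
  "future_events j q = {{\<omega>\<in>space M. (\<forall>v\<in>K. S j (q + v) \<omega> - S j q \<omega> \<le> b v) \<and> later_family j \<omega> \<in> D} |D K b.
     D \<in> sets family_space \<and> finite K \<and> K \<subseteq> {0..}}"

definition shifted :: "nat \<Rightarrow> real \<Rightarrow> 'a \<Rightarrow> real \<Rightarrow> real" where
  "shifted j q = path (\<lambda>u \<omega>. S j (q + u) \<omega> - S j q \<omega>)"

lemma space_past [simp]: "space (past j q) = space M"
  unfolding past_def by (rule space_measure_of) (auto simp: past_events_def)

lemma sets_past: "sets (past j q) = sigma_sets (space M) (past_events j q)"
  unfolding past_def by (rule sets_measure_of) (auto simp: past_events_def)

lemma measurable_past_less: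
  assumes "i < j" "0 \<le> u"
  shows "S i u \<in> borel_measurable (past j q)"
  unfolding borel_measurable_iff_le
proof
  fix c
  let ?P = "earlier_space j"
  have "(\<lambda>f. f i) \<in> ?P \<rightarrow>\<^sub>M path_space borel" "(\<lambda>w. w u) \<in> path_space borel \<rightarrow>\<^sub>M (borel :: real measure)"
    using assms by (auto intro!: measurable_component_singleton)
  from measurable_compose[OF this]
  have [measurable]: "(\<lambda>f. f i u) \<in> borel_measurable ?P" .
  have "{\<omega>\<in>space M. earlier j \<omega> \<in> {f\<in>space ?P. f i u \<le> c} \<and> (\<forall>u\<in>{}. S j u \<omega> \<le> 0)} \<in> past_events j q"
    unfolding past_events_def
    by (intro CollectI exI[of _ "{f\<in>space ?P. f i u \<le> c}"] exI[of _ "{}"] exI[of _ "\<lambda>_. 0"] conjI refl) auto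
  moreover have "{\<omega>\<in>space M. earlier j \<omega> \<in> {f\<in>space ?P. f i u \<le> c} \<and> (\<forall>u\<in>{}. S j u \<omega> \<le> 0)} =
    {\<omega>\<in>space M. S i u \<omega> \<le> c}"
    using assms measurable_space[OF S.measurable_S_path] by (auto simp: space_PiM[of "{..<j}"]) (auto simp: path_def)
  ultimately show "{\<omega>\<in>space (past j q). S i u \<omega> \<le> c} \<in> sets (past j q)"
    by (simp add: sets_past)
qed

lemma measurable_past_current:
  assumes "0 \<le> u" "u \<le> q"
  shows "S j u \<in> borel_measurable (past j q)"
  unfolding borel_measurable_iff_le
proof
  fix c
  let ?P = "earlier_space j"
  have "{\<omega>\<in>space M. earlier j \<omega> \<in> space ?P \<and> (\<forall>u\<in>{u}. S j u \<omega> \<le> c)} \<in> past_events j q"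
    unfolding past_events_def using assms
    by (auto intro!: exI[of _ "space ?P"] exI[of _ "{u}"] exI[of _ "\<lambda>_. c"])
  moreover have "{\<omega>\<in>space M. earlier j \<omega> \<in> space ?P \<and> (\<forall>u\<in>{u}. S j u \<omega> \<le> c)} = {\<omega>\<in>space M. S j u \<omega> \<le> c}"
    using measurable_space[OF S.measurable_S_path] by (auto simp: space_PiM[of "{..<j}"])
  ultimately show "{\<omega>\<in>space (past j q). S j u \<omega> \<le> c} \<in> sets (past j q)"
    by (simp add: sets_past)
qed

text \<open>Independence between pieces separates three factors; independence of increments then
  cuts the middle one at q into a past and a future factor.\<close>

lemma prob_blocks:
  assumes q: "0 \<le> q" and D: "D \<in> sets (earlier_space j)" and J: "finite J" "J \<subseteq> {0..q}"
    and D': "D' \<in> sets family_space" and K: "finite K" "K \<subseteq> {0..}"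
  shows "prob {\<omega>\<in>space M. earlier j \<omega> \<in> D \<and> ((\<forall>u\<in>J. S j u \<omega> \<le> a u) \<and>
      (\<forall>v\<in>K. S j (q + v) \<omega> - S j q \<omega> \<le> b v)) \<and> later_family j \<omega> \<in> D'} =
    prob {\<omega>\<in>space M. earlier j \<omega> \<in> D} * (prob {\<omega>\<in>space M. \<forall>u\<in>J. S j u \<omega> \<le> a u} *
      prob {\<omega>\<in>space M. \<forall>v\<in>K. S j (q + v) \<omega> - S j q \<omega> \<le> b v}) * prob {\<omega>\<in>space M. later_family j \<omega> \<in> D'}"
proof -
  define B where "B = {w\<in>space (path_space borel). (\<forall>u\<in>J. w u \<le> a u) \<and> (\<forall>v\<in>K. w (q + v) - w q \<le> b v)}"
  have "B \<in> sets (path_space borel)"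
    unfolding B_def
  proof (intro sets.sets_Collect_conj sets.sets_Collect_finite_All J K)
    fix u assume "u \<in> J"
    then have [measurable]: "(\<lambda>w. w u) \<in> borel_measurable (path_space borel)"
      using J by (intro measurable_component_singleton) auto
    show "{w\<in>space (path_space borel). w u \<le> a u} \<in> sets (path_space borel)" by measurable
  next
    fix v assume "v \<in> K"
    then have [measurable]: "(\<lambda>w. w (q + v)) \<in> borel_measurable (path_space borel)"
      "(\<lambda>w. w q) \<in> borel_measurable (path_space borel)"
      using K q by (auto intro!: measurable_component_singleton)
    show "{w\<in>space (path_space borel). w (q + v) - w q \<le> b v} \<in> sets (path_space borel)" by measurable
  qed
  note * = indep_three_blocks[OF D this D']
  have B: "path (S j) \<omega> \<in> B \<longleftrightarrow> (\<forall>u\<in>J. S j u \<omega> \<le> a u) \<and> (\<forall>v\<in>K. S j (q + v) \<omega> - S j q \<omega> \<le> b v)"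
    if "\<omega> \<in> space M" for \<omega>
  proof -
    have "path (S j) \<omega> u = S j u \<omega>" if "0 \<le> u" for u using that by (simp add: path_def)
    then show ?thesis
      using that measurable_space[OF S.measurable_S_path that, of j] J K q unfolding B_def by (auto simp: subset_iff)
  qed
  then have "{\<omega>\<in>space M. earlier j \<omega> \<in> D \<and> path (S j) \<omega> \<in> B \<and> later_family j \<omega> \<in> D'} =
    {\<omega>\<in>space M. earlier j \<omega> \<in> D \<and> ((\<forall>u\<in>J. S j u \<omega> \<le> a u) \<and>
      (\<forall>v\<in>K. S j (q + v) \<omega> - S j q \<omega> \<le> b v)) \<and> later_family j \<omega> \<in> D'}" by blast
  moreover have "{\<omega>\<in>space M. path (S j) \<omega> \<in> B} =
    {\<omega>\<in>space M. (\<forall>u\<in>J. S j u \<omega> \<le> a u) \<and> (\<forall>v\<in>K. S j (q + v) \<omega> - S j q \<omega> \<le> b v)}" using B by blast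
  ultimately show ?thesis using * S.indep_past_increments[OF q J K, of j a b] by simp
qed

lemma space_eq_past:
  "\<omega> \<in> space M \<Longrightarrow> earlier j \<omega> \<in> space (earlier_space j)"
  using measurable_space[OF S.measurable_S_path] by (auto simp: space_PiM[of "{..<j}"])

lemma indep_past_future_events:
  assumes q: "0 \<le> q"
  shows "indep_set (past_events j q) (future_events j q)"
proof (rule indep_setI)
  have U: "earlier j \<in> M \<rightarrow>\<^sub>M (earlier_space j)"
    using S.measurable_S_path by (intro measurable_restrict)
  show "past_events j q \<subseteq> events"
  proof
    fix A assume "A \<in> past_events j q"
    then obtain D J a where D: "D \<in> sets (earlier_space j)" and J: "finite J" "J \<subseteq> {0..q}"
      and A: "A = {\<omega>\<in>space M. earlier j \<omega> \<in> D \<and> (\<forall>u\<in>J. S j u \<omega> \<le> a u)}"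
      by (auto simp: past_events_def)
    show "A \<in> events" unfolding A
    proof (intro sets.sets_Collect_conj sets.sets_Collect_finite_All J)
      show "{\<omega>\<in>space M. earlier j \<omega> \<in> D} \<in> events"
        using measurable_sets[OF U D] by (simp add: vimage_def Int_def conj_commute)
      fix u assume "u \<in> J"
      then have [measurable]: "S j u \<in> borel_measurable M" using J by (intro S.measurable_S) auto
      show "{\<omega>\<in>space M. S j u \<omega> \<le> a u} \<in> events" by measurable
    qed
  qed
  show "future_events j q \<subseteq> events"
  proof
    fix A assume "A \<in> future_events j q"
    then obtain D K b where D: "D \<in> sets family_space" and K: "finite K" "K \<subseteq> {0..}"
      and A: "A = {\<omega>\<in>space M. (\<forall>v\<in>K. S j (q + v) \<omega> - S j q \<omega> \<le> b v) \<and> later_family j \<omega> \<in> D}"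
      by (auto simp: future_events_def)
    show "A \<in> events" unfolding A
    proof (intro sets.sets_Collect_conj sets.sets_Collect_finite_All K)
      show "{\<omega>\<in>space M. later_family j \<omega> \<in> D} \<in> events"
        using measurable_sets[OF measurable_later_family D] by (simp add: vimage_def Int_def conj_commute)
      fix v assume "v \<in> K"
      then have [measurable]: "S j (q + v) \<in> borel_measurable M" "S j q \<in> borel_measurable M"
        using K q by (auto intro!: S.measurable_S)
      show "{\<omega>\<in>space M. S j (q + v) \<omega> - S j q \<omega> \<le> b v} \<in> events" by measurable
    qed
  qed
  fix A B assume "A \<in> past_events j q" "B \<in> future_events j q"
  then obtain D J a D' K b where D: "D \<in> sets (earlier_space j)" and J: "finite J" "J \<subseteq> {0..q}"
    and A: "A = {\<omega>\<in>space M. earlier j \<omega> \<in> D \<and> (\<forall>u\<in>J. S j u \<omega> \<le> a u)}"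
    and D': "D' \<in> sets family_space" and K: "finite K" "K \<subseteq> {0..}"
    and B: "B = {\<omega>\<in>space M. (\<forall>v\<in>K. S j (q + v) \<omega> - S j q \<omega> \<le> b v) \<and> later_family j \<omega> \<in> D'}"
    unfolding past_events_def future_events_def by blast
  have sp: "\<omega> \<in> space M \<Longrightarrow> later_family j \<omega> \<in> space family_space" for \<omega>
    using measurable_space[OF measurable_later_family] .
  have AB: "A \<inter> B = {\<omega>\<in>space M. earlier j \<omega> \<in> D \<and> ((\<forall>u\<in>J. S j u \<omega> \<le> a u) \<and>
      (\<forall>v\<in>K. S j (q + v) \<omega> - S j q \<omega> \<le> b v)) \<and> later_family j \<omega> \<in> D'}"
    unfolding A B by blast
  \<comment> \<open>Inserting void constraints brings each event to the shape of
    \<open>prob_blocks\<close>, so the same formula computes both marginal probabilities.\<close>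
  have A': "A = {\<omega>\<in>space M. earlier j \<omega> \<in> D \<and> ((\<forall>u\<in>J. S j u \<omega> \<le> a u) \<and>
      (\<forall>v\<in>{}. S j (q + v) \<omega> - S j q \<omega> \<le> b v)) \<and> later_family j \<omega> \<in> space family_space}"
    unfolding A using sp by blast
  have B': "B = {\<omega>\<in>space M. earlier j \<omega> \<in> space (earlier_space j) \<and> ((\<forall>u\<in>{}. S j u \<omega> \<le> a u) \<and>
      (\<forall>v\<in>K. S j (q + v) \<omega> - S j q \<omega> \<le> b v)) \<and> later_family j \<omega> \<in> D'}"
    unfolding B using space_eq_past by blast
  have full: "{\<omega>\<in>space M. later_family j \<omega> \<in> space family_space} = space M"
    "{\<omega>\<in>space M. earlier j \<omega> \<in> space (earlier_space j)} = space M"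
    using sp space_eq_past by blast+
  have "prob A = prob {\<omega>\<in>space M. earlier j \<omega> \<in> D} * prob {\<omega>\<in>space M. \<forall>u\<in>J. S j u \<omega> \<le> a u}"
    unfolding A' by (subst prob_blocks[OF q D J]) (auto simp: full prob_space)
  moreover have "prob B = prob {\<omega>\<in>space M. \<forall>v\<in>K. S j (q + v) \<omega> - S j q \<omega> \<le> b v} * prob {\<omega>\<in>space M. later_family j \<omega> \<in> D'}"
    unfolding B' by (subst prob_blocks[OF q _ _ _ D' K]) (auto simp: full prob_space)
  ultimately show "prob (A \<inter> B) = prob A * prob B"
    unfolding AB prob_blocks[OF q D J D' K] by simp
qed

lemma Int_stable_past_events: "Int_stable (past_events j q)"
proof (rule Int_stableI)
  fix A B assume "A \<in> past_events j q" "B \<in> past_events j q"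
  then obtain D J a D' K b where D: "D \<in> sets (earlier_space j)" and J: "finite J" "J \<subseteq> {0..q}"
    and A: "A = {\<omega>\<in>space M. earlier j \<omega> \<in> D \<and> (\<forall>u\<in>J. S j u \<omega> \<le> a u)}"
    and D': "D' \<in> sets (earlier_space j)" and K: "finite K" "K \<subseteq> {0..q}"
    and B: "B = {\<omega>\<in>space M. earlier j \<omega> \<in> D' \<and> (\<forall>u\<in>K. S j u \<omega> \<le> b u)}"
    unfolding past_events_def by blast
  define c where "c u = (if u \<in> J then if u \<in> K then min (a u) (b u) else a u else b u)" for u
  have "A \<inter> B = {\<omega>\<in>space M. earlier j \<omega> \<in> D \<inter> D' \<and> (\<forall>u\<in>J \<union> K. S j u \<omega> \<le> c u)}"
    unfolding A B by (auto simp: c_def)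
  moreover have "D \<inter> D' \<in> sets (earlier_space j)" "finite (J \<union> K)" "J \<union> K \<subseteq> {0..q}"
    using D D' J K by auto
  ultimately show "A \<inter> B \<in> past_events j q"
    unfolding past_events_def by blast
qed

lemma Int_stable_future_events: "Int_stable (future_events j q)"
proof (rule Int_stableI)
  fix A B assume "A \<in> future_events j q" "B \<in> future_events j q"
  then obtain D J a D' K b where D: "D \<in> sets family_space" and J: "finite J" "J \<subseteq> {0..}"
    and A: "A = {\<omega>\<in>space M. (\<forall>v\<in>J. S j (q + v) \<omega> - S j q \<omega> \<le> a v) \<and> later_family j \<omega> \<in> D}"
    and D': "D' \<in> sets family_space" and K: "finite K" "K \<subseteq> {0..}"
    and B: "B = {\<omega>\<in>space M. (\<forall>v\<in>K. S j (q + v) \<omega> - S j q \<omega> \<le> b v) \<and> later_family j \<omega> \<in> D'}"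
    unfolding future_events_def by blast
  define c where "c u = (if u \<in> J then if u \<in> K then min (a u) (b u) else a u else b u)" for u
  have "A \<inter> B = {\<omega>\<in>space M. (\<forall>v\<in>J \<union> K. S j (q + v) \<omega> - S j q \<omega> \<le> c v) \<and> later_family j \<omega> \<in> D \<inter> D'}"
    unfolding A B by (auto simp: c_def)
  moreover have "D \<inter> D' \<in> sets family_space" "finite (J \<union> K)" "J \<union> K \<subseteq> {0..}"
    using D D' J K by auto
  ultimately show "A \<inter> B \<in> future_events j q"
    unfolding future_events_def by blast
qed

lemma measurable_shifted: "0 \<le> q \<Longrightarrow> shifted j q \<in> M \<rightarrow>\<^sub>M path_space borel"
  unfolding shifted_def by (rule S.measurable_shifted_path)

lemma distr_shifted: "0 \<le> q \<Longrightarrow> distr M (path_space borel) (shifted j q) = path_law"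
  unfolding shifted_def by (simp add: S.distr_shifted_path distr_path)

lemma shifted_later_in_future:
  assumes q: "0 \<le> q" and D: "D \<in> sets (path_space borel)" and D': "D' \<in> sets family_space"
  shows "{\<omega>\<in>space M. shifted j q \<omega> \<in> D \<and> later_family j \<omega> \<in> D'} \<in> sigma_sets (space M) (future_events j q)"
proof -
  let ?F = "sigma (space M) (future_events j q)"
  have F: "space ?F = space M" "sets ?F = sigma_sets (space M) (future_events j q)"
    by (auto simp: future_events_def intro!: space_measure_of sets_measure_of)
  have sp: "\<omega> \<in> space M \<Longrightarrow> later_family j \<omega> \<in> space family_space" for \<omega>
    using measurable_space[OF measurable_later_family] .
  have "(\<lambda>\<omega>. \<lambda>u\<in>{0..}. S j (q + u) \<omega> - S j q \<omega>) \<in> ?F \<rightarrow>\<^sub>M path_space borel"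
  proof (rule measurable_restrict)
    fix u :: real assume u: "u \<in> {0..}"
    show "(\<lambda>\<omega>. S j (q + u) \<omega> - S j q \<omega>) \<in> ?F \<rightarrow>\<^sub>M borel"
      unfolding borel_measurable_iff_le
    proof
      fix c
      have "{\<omega>\<in>space M. (\<forall>v\<in>{u}. S j (q + v) \<omega> - S j q \<omega> \<le> c) \<and> later_family j \<omega> \<in> space family_space} \<in> future_events j q"
        unfolding future_events_def using u
        by (auto intro!: exI[of _ "space family_space"] exI[of _ "{u}"] exI[of _ "\<lambda>_. c"])
      moreover have "{\<omega>\<in>space M. (\<forall>v\<in>{u}. S j (q + v) \<omega> - S j q \<omega> \<le> c) \<and> later_family j \<omega> \<in> space family_space} =
        {\<omega>\<in>space M. S j (q + u) \<omega> - S j q \<omega> \<le> c}" using sp by blast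
      ultimately show "{\<omega>\<in>space ?F. S j (q + u) \<omega> - S j q \<omega> \<le> c} \<in> sets ?F"
        unfolding F by (metis (no_types, lifting) sigma_sets.Basic)
    qed
  qed
  then have "shifted j q \<in> ?F \<rightarrow>\<^sub>M path_space borel"
    by (simp add: shifted_def path_def[abs_def])
  from measurable_sets[OF this D]
  have 1: "shifted j q -` D \<inter> space M \<in> sets ?F" by (simp only: F)
  have "{\<omega>\<in>space M. (\<forall>v\<in>{}. S j (q + v) \<omega> - S j q \<omega> \<le> 0) \<and> later_family j \<omega> \<in> D'} \<in> future_events j q"
    unfolding future_events_def using D' by blast
  then have "{\<omega>\<in>space M. later_family j \<omega> \<in> D'} \<in> sets ?F" unfolding F by (auto intro: sigma_sets.Basic)
  from sets.Int[OF 1 this] have "(shifted j q -` D \<inter> space M) \<inter> {\<omega>\<in>space M. later_family j \<omega> \<in> D'} \<in> sigma_sets (space M) (future_events j q)"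
    by (simp only: F)
  moreover have "(shifted j q -` D \<inter> space M) \<inter> {\<omega>\<in>space M. later_family j \<omega> \<in> D'} =
    {\<omega>\<in>space M. shifted j q \<omega> \<in> D \<and> later_family j \<omega> \<in> D'}" by auto
  ultimately show ?thesis by simp
qed

lemma prob_shifted_later:
  assumes q: "0 \<le> q" and D: "D \<in> sets (path_space borel)" and D': "D' \<in> sets family_space"
  shows "prob {\<omega>\<in>space M. shifted j q \<omega> \<in> D \<and> later_family j \<omega> \<in> D'} = measure path_law D * measure family_law D'"
proof -
  let ?U = "earlier_space j" and ?D = "(\<lambda>w. \<lambda>u\<in>{0..}. w (q + u) - w q) -` D \<inter> space (path_space borel)"
  have "(\<lambda>w. \<lambda>u\<in>{0..}. w (q + u) - w q) \<in> path_space borel \<rightarrow>\<^sub>M path_space (borel :: real measure)"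
    using q by (intro measurable_restrict borel_measurable_diff measurable_component_singleton) auto
  from measurable_sets[OF this D]
  have m: "?D \<in> sets (path_space borel)" .
  have eq: "path (S j) \<omega> \<in> ?D \<longleftrightarrow> shifted j q \<omega> \<in> D"
    if "\<omega> \<in> space M" for \<omega>
  proof -
    have "(\<lambda>u\<in>{0..}. path (S j) \<omega> (q + u) - path (S j) \<omega> q) = shifted j q \<omega>"
      using q by (auto simp: shifted_def path_def fun_eq_iff)
    then show ?thesis using measurable_space[OF S.measurable_S_path that] by simp
  qed
  have "prob {\<omega>\<in>space M. shifted j q \<omega> \<in> D \<and> later_family j \<omega> \<in> D'} =
    prob {\<omega>\<in>space M. earlier j \<omega> \<in> space ?U \<and>
      path (S j) \<omega> \<in> ?D \<and> later_family j \<omega> \<in> D'}"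
    using eq space_eq_past by (intro arg_cong[where f = prob]) blast
  also have "\<dots> = prob {\<omega>\<in>space M. earlier j \<omega> \<in> space ?U} *
      prob {\<omega>\<in>space M. path (S j) \<omega> \<in> ?D} *
      prob {\<omega>\<in>space M. later_family j \<omega> \<in> D'}"
    by (rule indep_three_blocks[OF sets.top m D'])
  also have "{\<omega>\<in>space M. earlier j \<omega> \<in> space ?U} = space M"
    using space_eq_past by blast
  also have "{\<omega>\<in>space M. path (S j) \<omega> \<in> ?D} =
      shifted j q -` D \<inter> space M"
    using eq by blast
  also have "{\<omega>\<in>space M. later_family j \<omega> \<in> D'} = later_family j -` D' \<inter> space M" by auto
  also have "prob (shifted j q -` D \<inter> space M) = measure path_law D"
    using measure_distr[OF measurable_shifted[OF q] D, of j] by (simp add: distr_shifted[OF q])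
  also have "prob (later_family j -` D' \<inter> space M) = measure family_law D'"
    using measure_distr[OF measurable_later_family D', of j] by (simp add: distr_later_family)
  finally show ?thesis by (simp add: prob_space)
qed

text \<open>The simple Markov property of the pieces at a fixed local time, obtained by extending
  independence from the two intersection-stable generators to the sigma-algebras they
  generate.\<close>

lemma indep_past_future:
  assumes q: "0 \<le> q" and C: "C \<in> sets (past j q)"
    and D: "D \<in> sets (path_space borel)" and D': "D' \<in> sets family_space"
  shows "prob (C \<inter> {\<omega>\<in>space M. shifted j q \<omega> \<in> D \<and> later_family j \<omega> \<in> D'}) =
    prob C * (measure path_law D * measure family_law D')"
  using indep_setD[OF indep_set_sigma_sets[OF indep_past_future_events[OF q] Int_stable_past_events Int_stable_future_events],
      of C j "{\<omega>\<in>space M. shifted j q \<omega> \<in> D \<and> later_family j \<omega> \<in> D'}"]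
    C shifted_later_in_future[OF q D D'] prob_shifted_later[OF q D D']
  by (simp add: sets_past)

lemma sets_past_subset: "0 \<le> q \<Longrightarrow> sets (past j q) \<subseteq> events"
  using indep_past_future_events[of q j] sets.sigma_sets_subset[of "past_events j q" M]
  by (auto simp: sets_past indep_set_def indep_sets_def UNIV_bool)

end

section \<open>The process and its natural filtration\<close>

lemma ennreal_less_rat:
  fixes a b :: ennreal
  assumes "a < b"
  shows "\<exists>p\<in>{p\<in>\<rat>. 0 \<le> p}. a \<le> ennreal p \<and> ennreal p < b"
proof -
  obtain r :: real where r: "0 \<le> r" "a = ennreal r" using assms by (cases a) auto
  obtain c where c: "r < c" "ennreal c \<le> b"
    using assms r by (cases b) (auto simp: ennreal_less_iff intro: that gt_ex[of r, THEN exE])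
  obtain p where p: "p \<in> \<rat>" "r < p" "p < c" using Rats_dense_in_real[OF c(1)] by blast
  have "ennreal p < b" using p r by (intro less_le_trans[OF ennreal_lessI c(2)]) auto
  then show ?thesis using p r by (auto intro!: bexI[of _ p] ennreal_leI)
qed

lemma value_of_of_value: "0 \<le> v \<Longrightarrow> value_of (of_value v) = v"
  by (auto simp: of_value_def value_of_def)

context iid_subordinators
begin

abbreviation X :: "real option \<Rightarrow> real \<Rightarrow> 'a \<Rightarrow> real option" where
  "X \<equiv> censored_subordinator S"

abbreviation pieces :: "'a \<Rightarrow> nat \<Rightarrow> real \<Rightarrow> real" where
  "pieces \<omega> \<equiv> \<lambda>j u. S j u \<omega>"

definition V :: "real option \<Rightarrow> real \<Rightarrow> 'a \<Rightarrow> real" where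
  "V z t \<omega> = value_of (X z t \<omega>)"

lemma V_Some: "V (Some x) t \<omega> = censored_value (pieces \<omega>) x t"
  by (simp add: V_def censored_path_eq_value value_of_of_value value_nonneg)

lemma V_None: "V None t \<omega> = 0"
  by (simp add: V_def value_of_def)

lemma X_eq: "X z t \<omega> = of_value (V z t \<omega>)"
  by (cases z) (simp_all add: V_Some V_None censored_path_eq_value, simp add: of_value_def)

lemma censored_pieces: "\<omega> \<in> space M \<Longrightarrow> 0 \<le> x \<Longrightarrow> censored (pieces \<omega>) x"
  by unfold_locales (simp_all add: S.increasing_path_S)

lemma V_antimono:
  assumes "\<omega> \<in> space M" "z \<in> space censored_state" "0 \<le> t" "t \<le> t'"
  shows "V z t' \<omega> \<le> V z t \<omega>"
  using assms censored.value_antimono[OF censored_pieces]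
  by (cases z) (auto simp: V_None V_Some space_censored_state)

lemma V_right:
  assumes "\<omega> \<in> space M" "z \<in> space censored_state" "0 \<le> t" "c < V z t \<omega>"
  shows "\<exists>b>t. \<forall>u. t \<le> u \<longrightarrow> u < b \<longrightarrow> c < V z u \<omega>"
proof (cases z)
  case None
  then show ?thesis using assms by (auto simp: V_None intro!: exI[of _ "t + 1"])
next
  case (Some x)
  then show ?thesis using assms censored.value_right_continuous[OF censored_pieces, of \<omega> x t c]
    by (auto simp: V_Some space_censored_state)
qed

lemma measurable_paths_pieces: "measurable_paths M (\<lambda>\<omega>. pieces \<omega>) (\<lambda>_. x)"
  by unfold_locales (auto simp: S.increasing_path_S intro: S.measurable_S)

lemma measurable_V: "0 \<le> t \<Longrightarrow> V z t \<in> borel_measurable M"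
  using measurable_paths.measurable_value[OF measurable_paths_pieces]
  by (cases z) (simp_all add: V_Some[abs_def] V_None[abs_def])

lemma measurable_X: "0 \<le> t \<Longrightarrow> X z t \<in> M \<rightarrow>\<^sub>M censored_state"
  using measurable_of_value[OF measurable_V[of t z]] by (simp add: X_eq[symmetric])

lemma X_start:
  assumes "\<omega> \<in> space M" "z \<in> space censored_state"
  shows "X z 0 \<omega> = z"
  using assms censored.value_start[OF censored_pieces]
  by (cases z) (auto simp: X_eq V_None V_Some space_censored_state of_value_def simp del: censored_subordinator.simps)

lemma None_path_in_space: "(\<lambda>t\<in>{0..}. None) \<in> space (path_space censored_state)"
  by (auto simp: space_PiM space_censored_state)

lemma path_X_Some:
  "\<omega> \<in> space M \<Longrightarrow> path (X (Some v)) \<omega> = path_functional (v, family \<omega>)"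
  using path_functional_eq[of "pieces \<omega>" "family \<omega>" v] S.increasing_path_S
  by (simp add: path_def family_def)

lemma path_X:
  assumes "\<omega> \<in> space M" "z \<in> space censored_state"
  shows "path (X z) \<omega> = (if 0 < value_of z then path_functional (value_of z, family \<omega>) else (\<lambda>t\<in>{0..}. None))"
  using path_X_Some[OF assms(1)] assms(2)
  by (cases z) (auto simp: path_def space_censored_state value_of_def simp del: censored_subordinator.simps(1))

lemma measurable_path_X: "z \<in> space censored_state \<Longrightarrow> path (X z) \<in> M \<rightarrow>\<^sub>M path_space censored_state"
  unfolding path_def by (intro measurable_restrict measurable_X) auto

text \<open>Joint measurability in the starting state and the outcome suffices, since the
  probability space does not depend on the starting state.\<close>

lemma measurable_kernel:
  "(\<lambda>z. distr M (path_space censored_state) (path (X z))) \<in>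
    censored_state \<rightarrow>\<^sub>M prob_algebra (path_space censored_state)"
proof (rule measurable_distr_prob_space2)
  show "(\<lambda>_. M) \<in> censored_state \<rightarrow>\<^sub>M prob_algebra M"
    by (intro measurable_const) (simp add: space_prob_algebra prob_space_axioms)
  note measurable_family [measurable]
  \<comment> \<open>The cemetery has numerical value 0, which distinguishes it from every live
    state; its path is constant and is supplied separately.\<close>
  have "(\<lambda>(z, \<omega>). if 0 < value_of z then path_functional (value_of z, family \<omega>) else (\<lambda>t\<in>{0..}. None))
      \<in> censored_state \<Otimes>\<^sub>M M \<rightarrow>\<^sub>M path_space censored_state"
    unfolding split_beta using None_path_in_space by measurable
  then show "(\<lambda>(z, \<omega>). path (X z) \<omega>) \<in> censored_state \<Otimes>\<^sub>M M \<rightarrow>\<^sub>M path_space censored_state"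
    by (rule measurable_cong[THEN iffD1, rotated]) (auto simp: space_pair_measure path_X)
qed

abbreviation F :: "real option \<Rightarrow> ennreal \<Rightarrow> 'a measure" where
  "F z \<equiv> natural_filtration M censored_state (X z)"

lemma space_F: "space (F z t) = space M"
  unfolding natural_filtration_def by (rule space_measure_of) auto

lemma sets_F: "sets (F z t) =
    sigma_sets (space M) {X z u -` A \<inter> space M |u A. 0 \<le> u \<and> ennreal u \<le> t \<and> A \<in> sets censored_state}"
  unfolding natural_filtration_def by (rule sets_measure_of) auto

lemma filtration_F: "filtration (space M) (F z)"
  by unfold_locales (auto simp: space_F sets_F intro!: sigma_sets_mono' intro: order_trans)

lemma sets_F_subset: "sets (F z t) \<subseteq> sets M"
  unfolding sets_F using measurable_sets[OF measurable_X] by (intro sets.sigma_sets_subset) auto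

lemma measurable_V_F:
  assumes "0 \<le> u" "ennreal u \<le> t"
  shows "V z u \<in> borel_measurable (F z t)"
proof -
  have "X z u \<in> F z t \<rightarrow>\<^sub>M censored_state"
  proof (rule measurableI)
    fix A assume "A \<in> sets censored_state"
    then show "X z u -` A \<inter> space (F z t) \<in> sets (F z t)"
      using assms by (auto simp: space_F sets_F intro!: sigma_sets.Basic)
  qed (simp add: X_eq of_value_in_space)
  then show ?thesis unfolding V_def by measurable
qed

end

section \<open>The state at a stopping time\<close>

locale stopped = iid_subordinators +
  fixes z :: "real option" and T :: "'a \<Rightarrow> ennreal"
  assumes start: "z \<in> space censored_state" and stopping: "stopping_time (F z) T"
begin

sublocale filtration "space M" "F z" by (rule filtration_F)

abbreviation FT :: "'a measure" where
  "FT \<equiv> pre_sigma T"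

lemma sets_FT_subset: "sets FT \<subseteq> sets M"
proof
  fix A assume "A \<in> sets FT"
  \<comment> \<open>At the top index the constraint on \<open>T\<close> is void, so A itself belongs
    to the terminal sigma-algebra of the filtration.\<close>
  from sets_pre_sigmaD[OF stopping this, of \<top>] have "A \<in> sets (F z \<top>)" by simp
  then show "A \<in> sets M" using sets_F_subset by blast
qed

lemma T_measurable [measurable]: "T \<in> borel_measurable FT"
  by (rule measurable_stopping_time_pre_sigma[OF stopping])

lemma T_measurable_M [measurable]: "T \<in> borel_measurable M"
  by (rule measurable_stopping_time[OF stopping sets_F_subset space_F])

definition VT :: "'a \<Rightarrow> real" where
  "VT \<omega> = (if T \<omega> < \<top> then V z (enn2real (T \<omega>)) \<omega> else 0)"

text \<open>Since \<open>V\<close> is nonincreasing and right continuous, it exceeds a level at time \<open>T\<close> iff it does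
  so at some later time from a countable set.\<close>

lemma VT_greater_iff:
  assumes \<omega>: "\<omega> \<in> space M"
  shows "T \<omega> < \<top> \<and> c < V z (enn2real (T \<omega>)) \<omega> \<and> T \<omega> \<le> t \<longleftrightarrow>
    (t < \<top> \<and> T \<omega> \<le> t \<and> c < V z (enn2real t) \<omega>) \<or>
    (\<exists>q\<in>{q\<in>\<rat>. 0 \<le> q \<and> ennreal q \<le> t}. T \<omega> \<le> ennreal q \<and> c < V z q \<omega>)" (is "?L \<longleftrightarrow> ?R")
proof
  assume L: ?L
  then obtain r where r: "0 \<le> r" "T \<omega> = ennreal r" by (cases "T \<omega>") auto
  then obtain b where b: "b > r" "\<And>u. r \<le> u \<Longrightarrow> u < b \<Longrightarrow> c < V z u \<omega>"
    using V_right[OF \<omega> start r(1)] L by auto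
  show ?R
  proof (cases "T \<omega> = t")
    case True
    then show ?thesis using L by auto
  next
    case False
    then have "T \<omega> < t" using L by (simp add: less_le)
    then obtain b' where b': "b' > r" "ennreal b' \<le> t"
      using r by (cases t) (auto simp: ennreal_less_iff intro: that gt_ex[of r, THEN exE])
    have "r < min b b'" using b b' by simp
    then obtain q where q: "q \<in> \<rat>" "r < q" "q < min b b'" using Rats_dense_in_real by blast
    have "ennreal q \<le> t" using q by (intro order_trans[OF ennreal_leI b'(2)]) auto
    moreover have "T \<omega> \<le> ennreal q" using r q by (auto intro: ennreal_leI)
    ultimately show ?thesis using q r b(2)[of q] by auto
  qed
next
  assume ?R
  then show ?L
  proof
    assume *: "t < \<top> \<and> T \<omega> \<le> t \<and> c < V z (enn2real t) \<omega>"
    then have "enn2real (T \<omega>) \<le> enn2real t" by (intro enn2real_mono) auto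
    from V_antimono[OF \<omega> start enn2real_nonneg this] * show ?L
      by (auto intro: le_less_trans less_le_trans)
  next
    assume "\<exists>q\<in>{q\<in>\<rat>. 0 \<le> q \<and> ennreal q \<le> t}. T \<omega> \<le> ennreal q \<and> c < V z q \<omega>"
    then obtain q where q: "0 \<le> q" "ennreal q \<le> t" "T \<omega> \<le> ennreal q" "c < V z q \<omega>" by blast
    have "enn2real (T \<omega>) \<le> q" using enn2real_mono[OF q(3)] q(1) by simp
    from V_antimono[OF \<omega> start enn2real_nonneg this] q show ?L
      by (auto intro: le_less_trans less_le_trans order_trans)
  qed
qed

lemma VT_measurable [measurable]: "VT \<in> borel_measurable FT"
proof -
  have *: "{\<omega>\<in>space M. T \<omega> < \<top> \<and> c < V z (enn2real (T \<omega>)) \<omega>} \<in> sets FT" for c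
  proof (rule sets_pre_sigmaI[OF stopping])
    fix t
    let ?A = "\<lambda>s v. {\<omega>\<in>space (F z t). T \<omega> \<le> s \<and> c < V z v \<omega>}"
    have A: "?A s v \<in> sets (F z t)" if "s \<le> t" "0 \<le> v" "ennreal v \<le> t" for s v
    proof -
      note measurable_V_F[OF that(2,3), measurable] stopping_time_le_const[OF stopping that(1), measurable]
      show ?thesis by measurable
    qed
    \<comment> \<open>The time t is kept beside the rationals: if \<open>T\<close> equals an
      irrational t, no rational lies between \<open>T\<close> and t.\<close>
    have "{\<omega> \<in> {\<omega>\<in>space M. T \<omega> < \<top> \<and> c < V z (enn2real (T \<omega>)) \<omega>}. T \<omega> \<le> t} =
      (if t < \<top> then ?A t (enn2real t) else {}) \<union> (\<Union>q\<in>{q\<in>\<rat>. 0 \<le> q \<and> ennreal q \<le> t}. ?A (ennreal q) q)"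
      using VT_greater_iff[of _ c t] by (auto simp: space_F)
    also have "\<dots> \<in> sets (F z t)"
      by (intro sets.Un sets.countable_UN''[OF countable_rats_on]) (auto intro!: A)
    finally show "{\<omega> \<in> {\<omega>\<in>space M. T \<omega> < \<top> \<and> c < V z (enn2real (T \<omega>)) \<omega>}. T \<omega> \<le> t} \<in> sets (F z t)" .
  qed
  show ?thesis
    unfolding borel_measurable_iff_greater
  proof
    fix c
    have "{\<omega>\<in>space FT. c < VT \<omega>} =
      {\<omega>\<in>space M. T \<omega> < \<top> \<and> c < V z (enn2real (T \<omega>)) \<omega>} \<union> {\<omega>\<in>space FT. T \<omega> = \<top> \<and> c < 0}"
      by (auto simp: VT_def space_pre_sigma less_top[symmetric])
    also have "\<dots> \<in> sets FT" by (rule sets.Un[OF *]) measurable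
    finally show "{\<omega>\<in>space FT. c < VT \<omega>} \<in> sets FT" .
  qed
qed

lemma X_T: "T \<omega> < \<top> \<Longrightarrow> X z (enn2real (T \<omega>)) \<omega> = of_value (VT \<omega>)"
  by (simp add: X_eq VT_def)

lemma XT_measurable:
  assumes [measurable]: "A \<in> sets censored_state"
  shows "{\<omega>\<in>space M. T \<omega> < \<top> \<and> X z (enn2real (T \<omega>)) \<omega> \<in> A} \<in> sets FT"
proof -
  have [measurable]: "(\<lambda>\<omega>. of_value (VT \<omega>)) \<in> FT \<rightarrow>\<^sub>M censored_state"
    by (rule measurable_of_value) measurable
  have "{\<omega>\<in>space M. T \<omega> < \<top> \<and> X z (enn2real (T \<omega>)) \<omega> \<in> A} = {\<omega>\<in>space FT. T \<omega> < \<top> \<and> of_value (VT \<omega>) \<in> A}"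
    by (auto simp: X_T space_pre_sigma)
  also have "\<dots> \<in> sets FT" by measurable
  finally show ?thesis .
qed

end

subsection \<open>Events before a stopping time within one piece\<close>

lemma (in iid_subordinators) past_mono: "p \<le> q \<Longrightarrow> sets (past j p) \<subseteq> sets (past j q)"
  unfolding sets_past past_events_def by (intro sigma_sets_mono') fastforce

locale stopped_Some = iid_subordinators +
  fixes x :: real and T :: "'a \<Rightarrow> ennreal" and j :: nat
  assumes x: "0 < x" and stopping': "stopping_time (F (Some x)) T"
begin

sublocale stopped M S "Some x" T
  using x stopping' by unfold_locales (auto simp: space_censored_state)

abbreviation tau :: "'a \<Rightarrow> ennreal" where "tau \<omega> \<equiv> censored_tau (pieces \<omega>) x j"
abbreviation sig :: "'a \<Rightarrow> ennreal" where "sig \<omega> \<equiv> censored_sigma (pieces \<omega>) x j"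

text \<open>The pieces with the \<open>j\<close>-th one stopped at \<open>q\<close> are measurable with respect to \<open>past j q\<close>, and
  they determine the process up to time \<open>tau + q\<close> if \<open>q \<le> sig\<close>.\<close>

definition stopped_pieces :: "real \<Rightarrow> 'a \<Rightarrow> nat \<Rightarrow> real \<Rightarrow> real" where
  "stopped_pieces q \<omega> i u = (if i < j then S i u \<omega> else if i = j then S j (min q u) \<omega> else 0)"

lemma increasing_stopped_pieces:
  assumes "0 \<le> q" "\<omega> \<in> space M"
  shows "increasing_path (stopped_pieces q \<omega> i)"
  using increasing_path_stop[OF S.increasing_path_S[OF assms(2), of j] assms(1)] S.increasing_path_S[OF assms(2), of i]
    increasing_path_const_zero
  unfolding stopped_pieces_def[abs_def] by (cases i j rule: linorder_cases) auto

lemma measurable_paths_stopped: "0 \<le> q \<Longrightarrow> measurable_paths (past j q) (stopped_pieces q) (\<lambda>_. x)"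
proof
  fix u :: real and i assume "0 \<le> q" "0 \<le> u"
  then show "(\<lambda>\<omega>. stopped_pieces q \<omega> i u) \<in> borel_measurable (past j q)"
    using measurable_past_less[of i j u q] measurable_past_current[of "min q u" q j]
    unfolding stopped_pieces_def by (cases i j rule: linorder_cases) auto
qed (auto simp: increasing_stopped_pieces)

lemma tau_stopped:
  assumes "0 \<le> q" "\<omega> \<in> space M"
  shows "censored_tau (stopped_pieces q \<omega>) x j = tau \<omega>"
  using assms increasing_stopped_pieces[OF assms] S.increasing_path_S
  by (intro censored_tau_cong[where j = j]) (auto simp: stopped_pieces_def)

lemma le_sig_stopped:
  assumes "0 \<le> q" "\<omega> \<in> space M"
  shows "ennreal q \<le> censored_sigma (stopped_pieces q \<omega>) x j \<longleftrightarrow> ennreal q \<le> sig \<omega>"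
proof
  show "ennreal q \<le> sig \<omega>" if "ennreal q \<le> censored_sigma (stopped_pieces q \<omega>) x j"
    using increasing_stopped_pieces[OF assms] S.increasing_path_S[OF assms(2)] x that
    by (intro le_censored_sigma_cong[of "stopped_pieces q \<omega>" "pieces \<omega>" j q x]) (auto simp: stopped_pieces_def)
  show "ennreal q \<le> censored_sigma (stopped_pieces q \<omega>) x j" if "ennreal q \<le> sig \<omega>"
    using increasing_stopped_pieces[OF assms] S.increasing_path_S[OF assms(2)] x that
    by (intro le_censored_sigma_cong[of "pieces \<omega>" "stopped_pieces q \<omega>" j q x]) (auto simp: stopped_pieces_def)
qed

lemma past_tau_sig:
  assumes q: "0 \<le> q"
  shows "{\<omega>\<in>space M. ennreal p < tau \<omega> + ennreal q \<and> ennreal q \<le> sig \<omega>} \<in> sets (past j q)"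
    and "{\<omega>\<in>space M. ennreal q \<le> sig \<omega>} \<in> sets (past j q)"
proof -
  interpret measurable_paths "past j q" "stopped_pieces q" "\<lambda>_. x"
    by (rule measurable_paths_stopped[OF q])
  have "{\<omega>\<in>space (past j q). ennreal p < censored_tau (stopped_pieces q \<omega>) x j + ennreal q \<and>
      ennreal q \<le> censored_sigma (stopped_pieces q \<omega>) x j} \<in> sets (past j q)" by measurable
  also have "{\<omega>\<in>space (past j q). ennreal p < censored_tau (stopped_pieces q \<omega>) x j + ennreal q \<and>
      ennreal q \<le> censored_sigma (stopped_pieces q \<omega>) x j} =
    {\<omega>\<in>space M. ennreal p < tau \<omega> + ennreal q \<and> ennreal q \<le> sig \<omega>}"
    using q by (auto simp: tau_stopped le_sig_stopped)
  finally show "{\<omega>\<in>space M. ennreal p < tau \<omega> + ennreal q \<and> ennreal q \<le> sig \<omega>} \<in> sets (past j q)" .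
  have "{\<omega>\<in>space (past j q). ennreal q \<le> censored_sigma (stopped_pieces q \<omega>) x j} \<in> sets (past j q)" by measurable
  also have "{\<omega>\<in>space (past j q). ennreal q \<le> censored_sigma (stopped_pieces q \<omega>) x j} =
    {\<omega>\<in>space M. ennreal q \<le> sig \<omega>}"
    using q by (auto simp: le_sig_stopped)
  finally show "{\<omega>\<in>space M. ennreal q \<le> sig \<omega>} \<in> sets (past j q)" .
qed

text \<open>On the restricting event, every state up to time p is computed from the stopped pieces
  by \<open>censored_value_cong_before\<close>. The sets whose trace on that event lies in the past
  form a sigma-algebra, so checking the generators of the natural filtration is enough.\<close>

lemma past_F:
  assumes q: "0 \<le> q" and p: "0 \<le> p" and A: "A \<in> sets (F (Some x) (ennreal p))"
  shows "{\<omega>\<in>A. ennreal p < tau \<omega> + ennreal q \<and> ennreal q \<le> sig \<omega>} \<in> sets (past j q)"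
proof -
  let ?D = "{\<omega>\<in>space M. ennreal p < tau \<omega> + ennreal q \<and> ennreal q \<le> sig \<omega>}"
  have D: "?D \<in> sets (past j q)" by (rule past_tau_sig(1)[OF q])
  have sub: "A \<subseteq> space M" using A sets_F_subset sets.sets_into_space by blast
  have "A \<inter> ?D \<in> sets (past j q)"
    using A unfolding sets_F
  proof (induction A rule: sigma_sets.induct)
    case (Basic A)
    then obtain u B where u: "0 \<le> u" "ennreal u \<le> ennreal p" and B [measurable]: "B \<in> sets censored_state"
      and A: "A = X (Some x) u -` B \<inter> space M" by blast
    interpret measurable_paths "past j q" "stopped_pieces q" "\<lambda>_. x"
      by (rule measurable_paths_stopped[OF q])
    have [measurable]: "(\<lambda>\<omega>. of_value (censored_value (stopped_pieces q \<omega>) x u)) \<in> past j q \<rightarrow>\<^sub>M censored_state"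
      by (rule measurable_of_value[OF measurable_value[OF u(1)]])
    have "X (Some x) u \<omega> = of_value (censored_value (stopped_pieces q \<omega>) x u)" if "\<omega> \<in> ?D" for \<omega>
    proof -
      have \<omega>: "\<omega> \<in> space M" using that by simp
      have "ennreal u < tau \<omega> + ennreal q" using that u(2) by auto
      then have "censored_value (pieces \<omega>) x u = censored_value (stopped_pieces q \<omega>) x u"
        using increasing_stopped_pieces[OF q \<omega>] S.increasing_path_S[OF \<omega>] x u that
        by (intro censored_value_cong_before[where j = j and q = q]) (auto simp: stopped_pieces_def)
      then show ?thesis unfolding X_eq V_Some by simp
    qed
    then have "A \<inter> ?D = {\<omega>\<in>space (past j q). of_value (censored_value (stopped_pieces q \<omega>) x u) \<in> B} \<inter> ?D"
      unfolding A by auto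
    also have "\<dots> \<in> sets (past j q)" by (rule sets.Int[OF _ D]) measurable
    finally show ?case .
  next
    case (Compl A)
    have "(space M - A) \<inter> ?D = ?D - (A \<inter> ?D)" by auto
    then show ?case using sets.Diff[OF D Compl.IH] by (simp only:)
  next
    case (Union A)
    have "(\<Union>i. A i) \<inter> ?D = (\<Union>i. A i \<inter> ?D)" by auto
    moreover have "(\<Union>i. A i \<inter> ?D) \<in> sets (past j q)"
      by (intro sets.countable_UN image_subsetI Union.IH)
    ultimately show ?case by simp
  qed simp
  moreover have "A \<inter> ?D = {\<omega>\<in>A. ennreal p < tau \<omega> + ennreal q \<and> ennreal q \<le> sig \<omega>}" using sub by auto
  ultimately show ?thesis by simp
qed

text \<open>The bound \<open>tau + q\<close> is random, so a rational p with
  \<open>T <= p < tau + q\<close> is inserted: the first inequality is an event of the filtration at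
  the fixed time p, the second is covered by \<open>past_F\<close>.\<close>

lemma past_FT:
  assumes q: "0 \<le> q" and B: "B \<in> sets FT"
  shows "{\<omega>\<in>B. T \<omega> < tau \<omega> + ennreal q \<and> ennreal q \<le> sig \<omega>} \<in> sets (past j q)"
proof -
  have "{\<omega>\<in>B. T \<omega> < tau \<omega> + ennreal q \<and> ennreal q \<le> sig \<omega>} =
    (\<Union>p\<in>{p\<in>\<rat>. 0 \<le> p}. {\<omega>\<in>{\<omega>\<in>B. T \<omega> \<le> ennreal p}. ennreal p < tau \<omega> + ennreal q \<and> ennreal q \<le> sig \<omega>})"
    using ennreal_less_rat by (fastforce intro: le_less_trans)
  also have "\<dots> \<in> sets (past j q)"
    by (intro sets.countable_UN''[OF countable_rats_on] past_F[OF q] sets_pre_sigmaD[OF stopping' B]) auto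
  finally show ?thesis .
qed

text \<open>The event \<open>T < tau\<close> is the instance q = 0 of \<open>past_FT\<close> and can
  be removed. Two parameters are needed because a dyadic cell begins at one grid point while the
  phase is required to last until the next.\<close>

lemma past_FT_phase:
  assumes p: "0 \<le> p" "p \<le> q" and B: "B \<in> sets FT"
  shows "{\<omega>\<in>B. tau \<omega> \<le> T \<omega> \<and> T \<omega> < tau \<omega> + ennreal p \<and> ennreal q \<le> sig \<omega>} \<in> sets (past j q)"
proof -
  have sub: "B \<subseteq> space M" using sets.sets_into_space[OF B] by (simp add: space_pre_sigma)
  have 1: "{\<omega>\<in>B. T \<omega> < tau \<omega> + ennreal p \<and> ennreal p \<le> sig \<omega>} \<in> sets (past j q)"
    using past_FT[OF p(1) B] past_mono[OF p(2)] by blast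
  have 2: "{\<omega>\<in>B. T \<omega> < tau \<omega> + ennreal 0 \<and> ennreal 0 \<le> sig \<omega>} \<in> sets (past j q)"
    using past_FT[OF order_refl B] past_mono[of 0 q j] p by auto
  have "{\<omega>\<in>B. tau \<omega> \<le> T \<omega> \<and> T \<omega> < tau \<omega> + ennreal p \<and> ennreal q \<le> sig \<omega>} =
    ({\<omega>\<in>B. T \<omega> < tau \<omega> + ennreal p \<and> ennreal p \<le> sig \<omega>} \<inter> {\<omega>\<in>space M. ennreal q \<le> sig \<omega>}) -
      {\<omega>\<in>B. T \<omega> < tau \<omega> + ennreal 0 \<and> ennreal 0 \<le> sig \<omega>}"
    using sub ennreal_leI[OF p(2)] by (auto simp: not_less intro: order_trans)
  also have "\<dots> \<in> sets (past j q)"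
    using p by (intro sets.Diff sets.Int 1 2 past_tau_sig(2)) auto
  finally show ?thesis .
qed

end

section \<open>The strong Markov property\<close>

subsection \<open>Independence in the limit\<close>

text \<open>Dominated convergence of indicators; no monotonicity of the sequence of events is
  assumed.\<close>

lemma emeasure_tendsto_of_eventually:
  assumes N: "finite_measure N" and [measurable]: "\<And>n. E n \<in> sets N" "E' \<in> sets N"
    and sub: "\<And>n. E n \<subseteq> E'" and ev: "\<And>\<omega>. \<omega> \<in> E' \<Longrightarrow> \<forall>\<^sub>F n in sequentially. \<omega> \<in> E n"
  shows "(\<lambda>n. emeasure N (E n)) \<longlonglongrightarrow> emeasure N E'"
proof -
  have "(\<lambda>n. \<integral>\<^sup>+\<omega>. indicator (E n) \<omega> \<partial>N) \<longlonglongrightarrow> (\<integral>\<^sup>+\<omega>. indicator E' \<omega> \<partial>N)"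
  proof (rule nn_integral_dominated_convergence[where w = "\<lambda>_. 1"])
    show "AE \<omega> in N. (\<lambda>n. indicator (E n) \<omega> :: ennreal) \<longlonglongrightarrow> indicator E' \<omega>"
    proof (rule AE_I2)
      fix \<omega>
      show "(\<lambda>n. indicator (E n) \<omega> :: ennreal) \<longlonglongrightarrow> indicator E' \<omega>"
      proof (cases "\<omega> \<in> E'")
        case True
        then show ?thesis by (intro tendsto_eventually eventually_mono[OF ev]) auto
      next
        case False
        then have "indicator (E n) \<omega> = (0 :: ennreal)" for n using sub[of n] by (auto simp: indicator_def)
        then show ?thesis using False by simp
      qed
    qed
  qed (use finite_measure.emeasure_finite[OF N] in \<open>auto simp: indicator_def less_top\<close>)
  then show ?thesis by simp
qed

lemma emeasure_density_indicator:
  assumes A [measurable]: "A \<in> sets M" and Z [measurable]: "Z \<in> sets M"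
  shows "emeasure (density M (indicator Z)) A = emeasure M (A \<inter> Z)"
proof -
  have "emeasure (density M (indicator Z)) A = (\<integral>\<^sup>+\<omega>. indicator Z \<omega> * indicator A \<omega> \<partial>M)"
    by (simp add: emeasure_density)
  also have "\<dots> = (\<integral>\<^sup>+\<omega>. indicator (A \<inter> Z) \<omega> \<partial>M)"
    by (intro nn_integral_cong) (auto simp: indicator_def)
  also have "\<dots> = emeasure M (A \<inter> Z)" by (rule nn_integral_indicator) simp
  finally show ?thesis .
qed

lemma emeasure_distr_on:
  assumes [measurable]: "W \<in> N \<rightarrow>\<^sub>M P" "E \<in> sets N" "D \<in> sets P"
  shows "emeasure (distr (density N (indicator E)) P W) D = emeasure N {\<omega>\<in>E. W \<omega> \<in> D}"
proof -
  have m: "W -` D \<inter> space N \<in> sets N" by measurable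
  have "W -` D \<inter> space N \<inter> E = {\<omega>\<in>E. W \<omega> \<in> D}"
    using sets.sets_into_space[OF assms(2)] by auto
  then show ?thesis
    using emeasure_density_indicator[OF m assms(2)] by (simp add: emeasure_distr)
qed

lemma nn_integral_distr_on:
  assumes [measurable]: "W \<in> N \<rightarrow>\<^sub>M P" "E \<in> sets N" "\<phi> \<in> borel_measurable P"
  shows "(\<integral>\<^sup>+w. \<phi> w \<partial>distr (density N (indicator E)) P W) = (\<integral>\<^sup>+\<omega>. indicator E \<omega> * \<phi> (W \<omega>) \<partial>N)"
  by (subst nn_integral_distr) (auto simp: nn_integral_density)

text \<open>A continuous majorant of the indicator of a box: each factor is 1 up to the bound and
  falls linearly to 0 with slope of size m. Coordinatewise convergence passes through it, but not
  through the indicator, which jumps at the boundary.\<close>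

definition soft_box :: "'i set \<Rightarrow> ('i \<Rightarrow> real) \<Rightarrow> nat \<Rightarrow> ('i \<Rightarrow> real) \<Rightarrow> real" where
  "soft_box J a m w = (\<Prod>u\<in>J. max 0 (min 1 (1 - real m * (w u - a u))))"

lemma soft_box_bounds: "0 \<le> soft_box J a m w" "soft_box J a m w \<le> 1"
  unfolding soft_box_def by (auto intro!: prod_nonneg prod_le_1)

lemma soft_box_tendsto:
  "(\<And>u. u \<in> J \<Longrightarrow> (\<lambda>n. W n u) \<longlonglongrightarrow> w u) \<Longrightarrow> (\<lambda>n. soft_box J a m (W n)) \<longlonglongrightarrow> soft_box J a m w"
  unfolding soft_box_def by (intro tendsto_intros)

lemma soft_box_tendsto_indicator:
  assumes "finite J"
  shows "(\<lambda>m. soft_box J a m w) \<longlonglongrightarrow> (if \<forall>u\<in>J. w u \<le> a u then 1 else 0)"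
proof -
  have *: "(\<lambda>m. max 0 (min 1 (1 - real m * (w u - a u)))) \<longlonglongrightarrow> (if w u \<le> a u then 1 else 0)" for u
  proof (cases "w u \<le> a u")
    case True
    then have "1 \<le> 1 - real m * (w u - a u)" for m by (simp add: mult_nonneg_nonpos)
    then have "max 0 (min 1 (1 - real m * (w u - a u))) = 1" for m by (simp add: min_absorb1)
    then show ?thesis using True by simp
  next
    case False
    then obtain k where k: "1 < real k * (w u - a u)" using ex_less_of_nat_mult[of "w u - a u" 1] by auto
    have "max 0 (min 1 (1 - real m * (w u - a u))) = 0" if "k \<le> m" for m
    proof -
      have "real k * (w u - a u) \<le> real m * (w u - a u)" using that False by (intro mult_right_mono) auto
      then show ?thesis using k by simp
    qed
    then have "\<forall>\<^sub>F m in sequentially. max 0 (min 1 (1 - real m * (w u - a u))) = 0"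
      by (auto simp only: eventually_sequentially)
    then show ?thesis using False by (simp add: tendsto_eventually)
  qed
  have "(\<lambda>m. soft_box J a m w) \<longlonglongrightarrow> (\<Prod>u\<in>J. if w u \<le> a u then 1 else 0)"
    unfolding soft_box_def by (intro tendsto_prod *)
  also have "(\<Prod>u\<in>J. if w u \<le> a u then 1 else 0) = (if \<forall>u\<in>J. w u \<le> a u then 1 else (0::real))"
    using assms by (auto intro!: prod.neutral prod_zero)
  finally show ?thesis .
qed

text \<open>Two limits in a fixed order: n tends to infinity for a fixed soft box, where
  coordinatewise convergence is enough, and only then does m turn the soft box into a sharp one.
  Boxes determine the limit law.\<close>

lemma indep_limit:
  fixes W :: "nat \<Rightarrow> 'b \<Rightarrow> 'i \<Rightarrow> real"
  assumes N: "finite_measure N" and Q: "prob_space Q" and sets_Q: "sets Q = sets (\<Pi>\<^sub>M i\<in>I. borel)"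
    and W [measurable]: "\<And>n. W n \<in> N \<rightarrow>\<^sub>M (\<Pi>\<^sub>M i\<in>I. borel)" "W' \<in> N \<rightarrow>\<^sub>M (\<Pi>\<^sub>M i\<in>I. borel)"
    and E [measurable]: "\<And>n. E n \<in> sets N" "E' \<in> sets N"
    and sub: "\<And>n. E n \<subseteq> E'" and ev: "\<And>\<omega>. \<omega> \<in> E' \<Longrightarrow> \<forall>\<^sub>F n in sequentially. \<omega> \<in> E n"
    and lim: "\<And>\<omega> u. \<omega> \<in> E' \<Longrightarrow> u \<in> I \<Longrightarrow> (\<lambda>n. W n \<omega> u) \<longlonglongrightarrow> W' \<omega> u"
    and indep: "\<And>n D. D \<in> sets (\<Pi>\<^sub>M i\<in>I. borel) \<Longrightarrow>
      emeasure N {\<omega>\<in>E n. W n \<omega> \<in> D} = emeasure N (E n) * emeasure Q D"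
    and D: "D \<in> sets (\<Pi>\<^sub>M i\<in>I. borel)"
  shows "emeasure N {\<omega>\<in>E'. W' \<omega> \<in> D} = emeasure N E' * emeasure Q D"
proof -
  interpret N: finite_measure N by fact
  interpret Q: prob_space Q by fact
  let ?P = "\<Pi>\<^sub>M i\<in>I. (borel :: real measure)"
  note [measurable_cong] = sets_Q
  \<comment> \<open>Restricting to \<open>E n\<close> leaves total mass
    \<open>emeasure N (E n)\<close>, so independence says that the law is a multiple of
    \<open>Q\<close>.\<close>
  have law: "distr (density N (indicator (E n))) ?P (W n) = scale_measure (emeasure N (E n)) Q" for n
    by (rule measure_eqI) (simp_all add: sets_Q emeasure_distr_on indep)
  have fin: "finite_measure (density N (indicator E'))"
    by (rule finite_measureI) (simp add: emeasure_density nn_integral_indicator[of "space N \<inter> E'", symmetric] 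
        nn_integral_set_ennreal[symmetric] N.emeasure_eq_measure)
  have "distr (density N (indicator E')) ?P W' = scale_measure (emeasure N E') Q"
  proof (rule measure_eqI_boxes[where I = I])
    show "finite_measure (distr (density N (indicator E')) ?P W')"
      by (rule finite_measure.finite_measure_distr[OF fin]) simp
    fix J a assume J: "finite J" "J \<subseteq> I"
    let ?B = "{w\<in>space ?P. \<forall>u\<in>J. w u \<le> (a u :: real)}"
    have B [measurable]: "?B \<in> sets ?P" using J boxes_sets[of I] by (auto simp: boxes_def)
    have [measurable]: "(\<lambda>w. w u) \<in> borel_measurable ?P" if "u \<in> J" for u
      using that J by (intro measurable_component_singleton) auto
    have [measurable]: "soft_box J a m \<in> borel_measurable ?P" for m
      unfolding soft_box_def by measurable
    \<comment> \<open>The limit in n: both sides are limits of the same integrals over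
      \<open>E n\<close>, once by convergence of the paths and once by the product formula and
      convergence of the masses.\<close>
    have soft: "(\<integral>\<^sup>+\<omega>. indicator E' \<omega> * ennreal (soft_box J a m (W' \<omega>)) \<partial>N) =
      emeasure N E' * (\<integral>\<^sup>+w. ennreal (soft_box J a m w) \<partial>Q)" for m
    proof (rule LIMSEQ_unique)
      have "(\<integral>\<^sup>+w. ennreal (soft_box J a m w) \<partial>Q) \<le> (\<integral>\<^sup>+w. 1 \<partial>Q)"
        by (intro nn_integral_mono) (simp add: soft_box_bounds)
      then have bnd: "(\<integral>\<^sup>+w. ennreal (soft_box J a m w) \<partial>Q) < \<top>"
        by (simp add: Q.emeasure_space_1 le_less_trans)
      have eq: "(\<integral>\<^sup>+\<omega>. indicator (E n) \<omega> * ennreal (soft_box J a m (W n \<omega>)) \<partial>N) =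
        (\<integral>\<^sup>+w. ennreal (soft_box J a m w) \<partial>Q) * emeasure N (E n)" for n
      proof -
        have "(\<integral>\<^sup>+\<omega>. indicator (E n) \<omega> * ennreal (soft_box J a m (W n \<omega>)) \<partial>N) =
          (\<integral>\<^sup>+w. ennreal (soft_box J a m w) \<partial>distr (density N (indicator (E n))) ?P (W n))"
          by (subst nn_integral_distr_on) auto
        also have "\<dots> = emeasure N (E n) * (\<integral>\<^sup>+w. ennreal (soft_box J a m w) \<partial>Q)"
          unfolding law by (rule nn_integral_scale_measure) measurable
        finally show ?thesis by (simp add: mult.commute)
      qed
      have "(\<lambda>n. emeasure N (E n)) \<longlonglongrightarrow> emeasure N E'"
        by (rule emeasure_tendsto_of_eventually[OF N E sub ev])
      from ennreal_tendsto_cmult[OF bnd this]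
      show "(\<lambda>n. \<integral>\<^sup>+\<omega>. indicator (E n) \<omega> * ennreal (soft_box J a m (W n \<omega>)) \<partial>N) \<longlonglongrightarrow>
        emeasure N E' * (\<integral>\<^sup>+w. ennreal (soft_box J a m w) \<partial>Q)"
        unfolding eq by (simp add: mult.commute)
      show "(\<lambda>n. \<integral>\<^sup>+\<omega>. indicator (E n) \<omega> * ennreal (soft_box J a m (W n \<omega>)) \<partial>N) \<longlonglongrightarrow>
        (\<integral>\<^sup>+\<omega>. indicator E' \<omega> * ennreal (soft_box J a m (W' \<omega>)) \<partial>N)"
      proof (rule nn_integral_dominated_convergence[where w = "\<lambda>_. 1"])
        show "AE \<omega> in N. (\<lambda>n. indicator (E n) \<omega> * ennreal (soft_box J a m (W n \<omega>))) \<longlonglongrightarrow>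
          indicator E' \<omega> * ennreal (soft_box J a m (W' \<omega>))"
        proof (rule AE_I2)
          fix \<omega>
          show "(\<lambda>n. indicator (E n) \<omega> * ennreal (soft_box J a m (W n \<omega>))) \<longlonglongrightarrow>
            indicator E' \<omega> * ennreal (soft_box J a m (W' \<omega>))"
          proof (cases "\<omega> \<in> E'")
            case True
            have "(\<lambda>n. ennreal (soft_box J a m (W n \<omega>))) \<longlonglongrightarrow> ennreal (soft_box J a m (W' \<omega>))"
              using lim[OF True] J by (intro tendsto_ennrealI soft_box_tendsto) auto
            moreover have "\<forall>\<^sub>F n in sequentially. ennreal (soft_box J a m (W n \<omega>)) =
              indicator (E n) \<omega> * ennreal (soft_box J a m (W n \<omega>))"
              by (rule eventually_mono[OF ev[OF True]]) simp
            ultimately show ?thesis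
              using True by (simp add: Lim_transform_eventually)
          next
            case False
            then have "indicator (E n) \<omega> = (0 :: ennreal)" for n using sub[of n] by (auto simp: indicator_def)
            then show ?thesis using False by simp
          qed
        qed
        show "(\<integral>\<^sup>+\<omega>. 1 \<partial>N) < \<infinity>" by (simp add: N.emeasure_finite less_top[symmetric])
        show "AE \<omega> in N. indicator (E n) \<omega> * ennreal (soft_box J a m (W n \<omega>)) \<le> 1" for n
          by (rule AE_I2) (simp add: soft_box_bounds indicator_def)
      qed measurable
    qed
    \<comment> \<open>The limit in m, which sharpens the soft boxes on both sides of
      \<open>soft\<close>.\<close>
    have "(\<lambda>m. \<integral>\<^sup>+\<omega>. indicator E' \<omega> * ennreal (soft_box J a m (W' \<omega>)) \<partial>N) \<longlonglongrightarrow>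
      (\<integral>\<^sup>+\<omega>. indicator E' \<omega> * indicator ?B (W' \<omega>) \<partial>N)"
    proof (rule nn_integral_dominated_convergence[where w = "\<lambda>_. 1"])
      show "AE \<omega> in N. (\<lambda>m. indicator E' \<omega> * ennreal (soft_box J a m (W' \<omega>))) \<longlonglongrightarrow>
          indicator E' \<omega> * indicator ?B (W' \<omega>)"
      proof (rule AE_I2)
        fix \<omega> assume "\<omega> \<in> space N"
        then have "W' \<omega> \<in> space ?P" using measurable_space[OF W(2)] by blast
        then have "indicator ?B (W' \<omega>) = ennreal (if \<forall>u\<in>J. W' \<omega> u \<le> a u then 1 else 0)" by simp
        then show "(\<lambda>m. indicator E' \<omega> * ennreal (soft_box J a m (W' \<omega>))) \<longlonglongrightarrow>
          indicator E' \<omega> * indicator ?B (W' \<omega>)"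
          using tendsto_ennrealI[OF soft_box_tendsto_indicator[OF J(1), of a "W' \<omega>"]]
          by (intro ennreal_tendsto_cmult) (auto simp: indicator_def)
      qed
      show "(\<integral>\<^sup>+\<omega>. 1 \<partial>N) < \<infinity>" by (simp add: N.emeasure_finite less_top[symmetric])
      show "AE \<omega> in N. indicator E' \<omega> * ennreal (soft_box J a m (W' \<omega>)) \<le> 1" for m
        by (rule AE_I2) (simp add: soft_box_bounds indicator_def)
    qed measurable
    moreover have "(\<lambda>m. \<integral>\<^sup>+w. ennreal (soft_box J a m w) \<partial>Q) \<longlonglongrightarrow> (\<integral>\<^sup>+w. indicator ?B w \<partial>Q)"
    proof (rule nn_integral_dominated_convergence[where w = "\<lambda>_. 1"])
      show "AE w in Q. (\<lambda>m. ennreal (soft_box J a m w)) \<longlonglongrightarrow> indicator ?B w"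
      proof (rule AE_I2)
        fix w assume "w \<in> space Q"
        then have "w \<in> space ?P" using sets_eq_imp_space_eq[OF sets_Q] by simp
        then have "indicator ?B w = ennreal (if \<forall>u\<in>J. w u \<le> a u then 1 else 0)" by simp
        then show "(\<lambda>m. ennreal (soft_box J a m w)) \<longlonglongrightarrow> indicator ?B w"
          using tendsto_ennrealI[OF soft_box_tendsto_indicator[OF J(1), of a w]] by simp
      qed
      show "(\<integral>\<^sup>+w. 1 \<partial>Q) < \<infinity>" by (simp add: Q.emeasure_space_1)
      show "AE w in Q. ennreal (soft_box J a m w) \<le> 1" for m
        by (rule AE_I2) (simp add: soft_box_bounds)
    qed measurable
    then have "(\<lambda>m. emeasure N E' * (\<integral>\<^sup>+w. ennreal (soft_box J a m w) \<partial>Q)) \<longlonglongrightarrow>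
        emeasure N E' * (\<integral>\<^sup>+w. indicator ?B w \<partial>Q)"
      by (intro ennreal_tendsto_cmult) (simp add: less_top[symmetric] N.emeasure_finite)
    ultimately have "(\<integral>\<^sup>+\<omega>. indicator E' \<omega> * indicator ?B (W' \<omega>) \<partial>N) = emeasure N E' * (\<integral>\<^sup>+w. indicator ?B w \<partial>Q)"
      unfolding soft by (rule LIMSEQ_unique)
    moreover have "(\<integral>\<^sup>+w. indicator ?B w \<partial>Q) = emeasure Q ?B"
      by (rule nn_integral_indicator) (simp add: sets_Q)
    moreover have "emeasure (distr (density N (indicator E')) ?P W') ?B =
        (\<integral>\<^sup>+w. indicator ?B w \<partial>distr (density N (indicator E')) ?P W')"
      by (rule nn_integral_indicator[symmetric]) simp
    moreover have "\<dots> = (\<integral>\<^sup>+\<omega>. indicator E' \<omega> * indicator ?B (W' \<omega>) \<partial>N)"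
      by (rule nn_integral_distr_on) measurable
    ultimately show "emeasure (distr (density N (indicator E')) ?P W') ?B = emeasure (scale_measure (emeasure N E') Q) ?B"
      by simp
  qed (simp_all add: sets_Q)
  from arg_cong[OF this, of "\<lambda>M. emeasure M D"] show ?thesis
    by (simp add: emeasure_distr_on D)
qed

subsection \<open>Restarting the current piece at a stopping time\<close>

context iid_subordinators
begin

lemma prob_space_path_law: "prob_space path_law"
  unfolding path_law_def by (rule prob_space_distr[OF S.measurable_S_path])

lemma sets_path_law [measurable_cong]: "sets path_law = sets (path_space borel)"
  by (simp add: path_law_def)

lemma prob_space_family_law: "prob_space family_law"
  by (intro prob_space_PiM prob_space_path_law)

lemma sets_family_law [measurable_cong]: "sets family_law = sets family_space"
  by (intro sets_PiM_cong) (simp_all add: sets_path_law)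

lemma shifted_apply: "0 \<le> u \<Longrightarrow> shifted j r \<omega> u = S j (r + u) \<omega> - S j r \<omega>"
  by (simp add: shifted_def path_def)

lemma measurable_shifted_random:
  assumes [measurable]: "r \<in> borel_measurable M" and r: "\<And>\<omega>. \<omega> \<in> space M \<Longrightarrow> 0 \<le> r \<omega>"
  shows "(\<lambda>\<omega>. shifted j (r \<omega>) \<omega>) \<in> M \<rightarrow>\<^sub>M path_space borel"
proof -
  have "(\<lambda>\<omega>. S j (\<rho> \<omega>) \<omega>) \<in> borel_measurable M"
    if "\<rho> \<in> borel_measurable M" "\<And>\<omega>. \<omega> \<in> space M \<Longrightarrow> 0 \<le> \<rho> \<omega>" for \<rho>
    by (rule measurable_eval_increasing_path[where g = "\<lambda>\<omega> u. S j u \<omega>"])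
       (auto simp: S.increasing_path_S that S.measurable_S)
  then show ?thesis
    unfolding shifted_def path_def using r
    by (intro measurable_restrict borel_measurable_diff) auto
qed

text \<open>Both values whose difference is taken are approached strictly from the right, where the
  piece is continuous.\<close>

lemma shifted_tendsto:
  assumes \<omega>: "\<omega> \<in> space M" and r: "0 \<le> r" and \<rho>: "\<rho> \<longlonglongrightarrow> r" "\<And>n. r < \<rho> n" and u: "0 \<le> u"
  shows "(\<lambda>n. shifted j (\<rho> n) \<omega> u) \<longlonglongrightarrow> shifted j r \<omega> u"
proof -
  have "(\<lambda>n. S j (\<rho> n + v) \<omega>) \<longlonglongrightarrow> S j (r + v) \<omega>" if v: "0 \<le> v" for v
  proof (rule filterlim_compose[where g = "\<lambda>t. S j t \<omega>" and f = "\<lambda>n. \<rho> n + v"])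
    show "((\<lambda>t. S j t \<omega>) \<longlongrightarrow> S j (r + v) \<omega>) (at_right (r + v))"
      using r v by (intro increasing_path_right S.increasing_path_S \<omega>) auto
    have "(\<lambda>n. \<rho> n + v) \<longlonglongrightarrow> r + v" by (intro tendsto_intros \<rho>)
    moreover have "\<rho> n \<noteq> r" for n using \<rho>(2)[of n] by simp
    ultimately show "filterlim (\<lambda>n. \<rho> n + v) (at_right (r + v)) sequentially"
      using \<rho>(2) by (auto simp: filterlim_at)
  qed
  from tendsto_diff[OF this[OF u] this[of 0]] show ?thesis
    using u by (simp add: shifted_apply)
qed

end

context stopped_Some
begin

definition phase_event :: "'a set \<Rightarrow> 'a set" where
  "phase_event B = {\<omega>\<in>B. tau \<omega> \<le> T \<omega> \<and> T \<omega> < tau \<omega> + sig \<omega>}"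

text \<open>The local time of piece j at \<open>T\<close>. Before the phase the truncated difference
  gives 0, and so does an infinite \<open>T\<close>; these defaults are harmless as probabilities
  are evaluated on phase events.\<close>

definition R :: "'a \<Rightarrow> real" where
  "R \<omega> = enn2real (T \<omega> - tau \<omega>)"

definition grid_index :: "nat \<Rightarrow> 'a \<Rightarrow> nat" where
  "grid_index n \<omega> = nat \<lfloor>2 ^ n * R \<omega>\<rfloor>"

definition grid :: "nat \<Rightarrow> nat \<Rightarrow> real" where
  "grid n i = real i / 2 ^ n"

text \<open>The right end of the dyadic cell containing \<open>R\<close>. The successor keeps it
  strictly above \<open>R\<close> even when \<open>R\<close> is a grid point, as the limit from the
  right requires.\<close>

definition Rgrid :: "nat \<Rightarrow> 'a \<Rightarrow> real" where
  "Rgrid n \<omega> = grid n (Suc (grid_index n \<omega>))"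

lemma R_nonneg: "0 \<le> R \<omega>" by (simp add: R_def)

lemma grid_nonneg: "0 \<le> grid n i" by (simp add: grid_def)

lemma grid_index_eq_iff: "grid_index n \<omega> = i \<longleftrightarrow> grid n i \<le> R \<omega> \<and> R \<omega> < grid n (Suc i)"
proof -
  have "grid_index n \<omega> = i \<longleftrightarrow> \<lfloor>2 ^ n * R \<omega>\<rfloor> = int i"
    using R_nonneg[of \<omega>] by (auto simp: grid_index_def)
  also have "\<dots> \<longleftrightarrow> real i \<le> 2 ^ n * R \<omega> \<and> 2 ^ n * R \<omega> < real i + 1"
    by (simp add: floor_eq_iff)
  finally show ?thesis by (simp add: grid_def field_simps)
qed

lemma Rgrid_bounds: "R \<omega> < Rgrid n \<omega>" "Rgrid n \<omega> \<le> R \<omega> + 1 / 2 ^ n"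
proof -
  have *: "grid n (grid_index n \<omega>) \<le> R \<omega> \<and> R \<omega> < grid n (Suc (grid_index n \<omega>))"
    using grid_index_eq_iff by blast
  then show "R \<omega> < Rgrid n \<omega>" by (simp add: Rgrid_def)
  have "Rgrid n \<omega> = grid n (grid_index n \<omega>) + 1 / 2 ^ n"
    by (simp add: Rgrid_def grid_def add_divide_distrib)
  then show "Rgrid n \<omega> \<le> R \<omega> + 1 / 2 ^ n" using * by simp
qed

lemma Rgrid_tendsto: "(\<lambda>n. Rgrid n \<omega>) \<longlonglongrightarrow> R \<omega>"
proof (rule tendsto_sandwich)
  show "\<forall>\<^sub>F n in sequentially. R \<omega> \<le> Rgrid n \<omega>" by (intro always_eventually allI less_imp_le Rgrid_bounds)
  show "\<forall>\<^sub>F n in sequentially. Rgrid n \<omega> \<le> R \<omega> + 1 / 2 ^ n" using Rgrid_bounds(2) by auto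
  have "(\<lambda>n. 1 / 2 ^ n :: real) \<longlonglongrightarrow> 0"
    using LIMSEQ_power_zero[of "1 / 2 :: real"] by (simp add: power_divide)
  from tendsto_add[OF tendsto_const this] show "(\<lambda>n. R \<omega> + 1 / 2 ^ n) \<longlonglongrightarrow> R \<omega>" by simp
qed simp

lemma tau_measurable [measurable]: "tau \<in> borel_measurable M"
  and sig_measurable [measurable]: "sig \<in> borel_measurable M"
  using measurable_paths.measurable_tau[OF measurable_paths_pieces]
    measurable_paths.measurable_sigma[OF measurable_paths_pieces] by auto

lemma R_measurable [measurable]: "R \<in> borel_measurable M"
  unfolding R_def[abs_def] by measurable

lemma Rgrid_measurable [measurable]: "Rgrid n \<in> borel_measurable M"
proof -
  have "Rgrid n \<omega> = (real_of_int \<lfloor>2 ^ n * R \<omega>\<rfloor> + 1) / 2 ^ n" for \<omega>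
    using R_nonneg[of \<omega>] by (simp add: Rgrid_def grid_def grid_index_def)
  then have "Rgrid n = (\<lambda>\<omega>. (real_of_int \<lfloor>2 ^ n * R \<omega>\<rfloor> + 1) / 2 ^ n)" by auto
  then show ?thesis by simp
qed

lemma phase_event_sets [measurable]: "B \<in> sets FT \<Longrightarrow> phase_event B \<in> sets M"
proof -
  assume "B \<in> sets FT"
  then have [measurable]: "B \<in> sets M" using sets_FT_subset by blast
  have "phase_event B = B \<inter> {\<omega>\<in>space M. tau \<omega> \<le> T \<omega> \<and> T \<omega> < tau \<omega> + sig \<omega>}"
    using sets.sets_into_space[OF \<open>B \<in> sets M\<close>] by (auto simp: phase_event_def)
  then show ?thesis by simp
qed

lemma tau_T_cases:
  assumes "tau \<omega> \<le> T \<omega>" "T \<omega> < \<top>"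
  obtains a where "0 \<le> a" "tau \<omega> = ennreal a" "T \<omega> = ennreal (a + R \<omega>)"
proof -
  obtain t where t: "0 \<le> t" "T \<omega> = ennreal t" using assms(2) by (cases "T \<omega>") auto
  obtain a where a: "0 \<le> a" "tau \<omega> = ennreal a" using assms t by (cases "tau \<omega>") (auto simp: top_unique)
  have "a \<le> t" using assms(1) t a by simp
  then have "R \<omega> = t - a" using t a by (simp add: R_def ennreal_minus)
  then show ?thesis using that t a by simp
qed

lemma T_less_iff:
  assumes "tau \<omega> \<le> T \<omega>" "T \<omega> < \<top>"
  shows "T \<omega> < tau \<omega> + b \<longleftrightarrow> ennreal (R \<omega>) < b"
proof -
  obtain a where "0 \<le> a" "tau \<omega> = ennreal a" "T \<omega> = ennreal (a + R \<omega>)" using tau_T_cases[OF assms] .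
  then show ?thesis using R_nonneg[of \<omega>]
    by (cases b) (simp_all add: ennreal_plus[symmetric] ennreal_less_iff ennreal_less_top del: ennreal_plus)
qed

text \<open>Rounding up may overshoot the end of the phase, where events of \<open>FT\<close> need
  no longer be determined by piece j up to the rounded time. Such outcomes are discarded; by
  \<open>grid_event_eventually\<close> none is lost in the limit.\<close>

definition grid_event :: "'a set \<Rightarrow> nat \<Rightarrow> 'a set" where
  "grid_event B n = {\<omega>\<in>phase_event B. ennreal (Rgrid n \<omega>) \<le> sig \<omega>}"

text \<open>Written as a difference of two sets covered by \<open>past_FT_phase\<close>, so that it
  visibly belongs to the past at the right end of the cell; \<open>grid_piece_eq\<close> identifies
  it with the part of the grid event in cell i.\<close>

definition grid_piece :: "'a set \<Rightarrow> nat \<Rightarrow> nat \<Rightarrow> 'a set" where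
  "grid_piece B n i =
     {\<omega>\<in>B. tau \<omega> \<le> T \<omega> \<and> T \<omega> < tau \<omega> + ennreal (grid n (Suc i)) \<and> ennreal (grid n (Suc i)) \<le> sig \<omega>} -
     {\<omega>\<in>B. tau \<omega> \<le> T \<omega> \<and> T \<omega> < tau \<omega> + ennreal (grid n i) \<and> ennreal (grid n (Suc i)) \<le> sig \<omega>}"

lemma grid_piece_eq: "grid_piece B n i = {\<omega>\<in>grid_event B n. grid_index n \<omega> = i}"
proof (intro set_eqI iffI)
  fix \<omega> assume "\<omega> \<in> grid_piece B n i"
  then have *: "\<omega> \<in> B" "tau \<omega> \<le> T \<omega>" "T \<omega> < tau \<omega> + ennreal (grid n (Suc i))" "ennreal (grid n (Suc i)) \<le> sig \<omega>"
      "\<not> T \<omega> < tau \<omega> + ennreal (grid n i)"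
    by (auto simp: grid_piece_def)
  have fin: "T \<omega> < \<top>" using *(3) by (rule less_le_trans) simp
  have "R \<omega> < grid n (Suc i)" "grid n i \<le> R \<omega>"
    using *(3,5) T_less_iff[OF *(2) fin] R_nonneg by (auto simp: ennreal_less_iff)
  then have i: "grid_index n \<omega> = i" by (simp add: grid_index_eq_iff)
  have "T \<omega> < tau \<omega> + sig \<omega>" using *(3) add_left_mono[OF *(4)] by (rule less_le_trans)
  then show "\<omega> \<in> {\<omega>\<in>grid_event B n. grid_index n \<omega> = i}"
    using * i by (simp add: grid_event_def phase_event_def Rgrid_def)
next
  fix \<omega> assume "\<omega> \<in> {\<omega>\<in>grid_event B n. grid_index n \<omega> = i}"
  then have *: "\<omega> \<in> B" "tau \<omega> \<le> T \<omega>" "T \<omega> < tau \<omega> + sig \<omega>" "ennreal (grid n (Suc i)) \<le> sig \<omega>" "grid_index n \<omega> = i"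
    by (auto simp: grid_event_def phase_event_def Rgrid_def)
  have fin: "T \<omega> < \<top>" using *(3) by (rule less_le_trans) simp
  have "R \<omega> < grid n (Suc i)" "grid n i \<le> R \<omega>" using *(5) by (auto simp: grid_index_eq_iff)
  then show "\<omega> \<in> grid_piece B n i"
    using * T_less_iff[OF *(2) fin] R_nonneg by (auto simp: grid_piece_def ennreal_less_iff)
qed

lemma grid_piece_past:
  assumes "B \<in> sets FT"
  shows "grid_piece B n i \<in> sets (past j (grid n (Suc i)))"
  unfolding grid_piece_def using assms
  by (intro sets.Diff past_FT_phase) (auto simp: grid_def divide_right_mono)

lemma grid_event_sets [measurable]:
  assumes B [measurable]: "B \<in> sets FT"
  shows "grid_event B n \<in> sets M"
proof -
  have "grid_event B n = phase_event B \<inter> {\<omega>\<in>space M. ennreal (Rgrid n \<omega>) \<le> sig \<omega>}"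
    using sets.sets_into_space[OF phase_event_sets[OF B]] by (auto simp: grid_event_def)
  then show ?thesis by simp
qed

abbreviation restart :: "'a \<Rightarrow> real \<Rightarrow> real" where
  "restart \<omega> \<equiv> shifted j (R \<omega>) \<omega>"

lemma restart_measurable [measurable]: "restart \<in> M \<rightarrow>\<^sub>M path_space borel"
  by (rule measurable_shifted_random) (auto simp: R_nonneg)

lemma grid_restart_measurable [measurable]: "(\<lambda>\<omega>. shifted j (Rgrid n \<omega>) \<omega>) \<in> M \<rightarrow>\<^sub>M path_space borel"
  by (rule measurable_shifted_random[OF Rgrid_measurable]) (simp add: Rgrid_def grid_nonneg)

lemmas later_family_measurable [measurable] = measurable_later_family[of j]

text \<open>On each cell the rounded time is a constant and the cell belongs to the past at that
  constant, so independence at a fixed time applies; the countably many cells are then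
  summed.\<close>

lemma emeasure_grid_event:
  assumes B [measurable]: "B \<in> sets FT" and D [measurable]: "D \<in> sets (path_space borel)"
    and D' [measurable]: "D' \<in> sets family_space"
  shows "emeasure M {\<omega>\<in>grid_event B n. shifted j (Rgrid n \<omega>) \<omega> \<in> D \<and> later_family j \<omega> \<in> D'} =
    emeasure M (grid_event B n) * (emeasure path_law D * emeasure family_law D')"
proof -
  interpret path_law: prob_space path_law by (rule prob_space_path_law)
  interpret family_law: prob_space family_law by (rule prob_space_family_law)
  define G where "G i = {\<omega>\<in>grid_piece B n i. shifted j (Rgrid n \<omega>) \<omega> \<in> D \<and> later_family j \<omega> \<in> D'}" for i
  have piece: "grid_piece B n i \<in> sets M" for i
    using grid_piece_past[OF B] sets_past_subset[OF grid_nonneg] by blast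
  have G_eq: "G i = grid_piece B n i \<inter> {\<omega>\<in>space M. shifted j (grid n (Suc i)) \<omega> \<in> D \<and> later_family j \<omega> \<in> D'}" for i
    using sets.sets_into_space[OF piece[of i]] by (auto simp: G_def grid_piece_eq Rgrid_def)
  have G_sets: "G i \<in> sets M" for i
  proof -
    note measurable_shifted[OF grid_nonneg[of n "Suc i"], measurable]
    have "{\<omega>\<in>space M. shifted j (grid n (Suc i)) \<omega> \<in> D \<and> later_family j \<omega> \<in> D'} \<in> sets M" by measurable
    then show ?thesis unfolding G_eq using piece by blast
  qed
  have "emeasure M (G i) = emeasure M (grid_piece B n i) * (emeasure path_law D * emeasure family_law D')" for i
    unfolding G_eq using indep_past_future[OF grid_nonneg grid_piece_past[OF B] D D', of n i]
    by (simp add: emeasure_eq_measure path_law.emeasure_eq_measure family_law.emeasure_eq_measure ennreal_mult)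
  then have "(\<Sum>i. emeasure M (G i)) =
      (\<Sum>i. emeasure M (grid_piece B n i)) * (emeasure path_law D * emeasure family_law D')"
    by simp
  moreover have "(\<Sum>i. emeasure M (G i)) = emeasure M (\<Union>i. G i)"
    using G_sets by (intro suminf_emeasure) (auto simp: disjoint_family_on_def G_def grid_piece_eq)
  moreover have "(\<Sum>i. emeasure M (grid_piece B n i)) = emeasure M (\<Union>i. grid_piece B n i)"
    using piece by (intro suminf_emeasure) (auto simp: disjoint_family_on_def grid_piece_eq)
  moreover have "(\<Union>i. G i) = {\<omega>\<in>grid_event B n. shifted j (Rgrid n \<omega>) \<omega> \<in> D \<and> later_family j \<omega> \<in> D'}"
    by (auto simp: G_def grid_piece_eq)
  moreover have "(\<Union>i. grid_piece B n i) = grid_event B n" by (auto simp: grid_piece_eq)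
  ultimately show ?thesis by simp
qed

text \<open>Within the phase \<open>R\<close> is strictly below \<open>sig\<close>, and the rounded
  times converge to \<open>R\<close>.\<close>

lemma grid_event_eventually:
  assumes "\<omega> \<in> phase_event B"
  shows "\<forall>\<^sub>F n in sequentially. \<omega> \<in> grid_event B n"
proof -
  have *: "tau \<omega> \<le> T \<omega>" "T \<omega> < tau \<omega> + sig \<omega>" using assms by (auto simp: phase_event_def)
  have fin: "T \<omega> < \<top>" using *(2) by (rule less_le_trans) simp
  have less: "ennreal (R \<omega>) < sig \<omega>" using *(2) T_less_iff[OF *(1) fin] by simp
  have "\<forall>\<^sub>F n in sequentially. ennreal (Rgrid n \<omega>) < sig \<omega>"
    by (rule order_tendstoD(2)[OF tendsto_ennrealI[OF Rgrid_tendsto] less])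
  then show ?thesis by (rule eventually_mono) (auto simp: grid_event_def assms)
qed

text \<open>The strong Markov property of the current piece, jointly with the later ones. It is the
  limit of \<open>emeasure_grid_event\<close>, and right continuity identifies the limit of the
  restarted paths.\<close>

lemma emeasure_restart:
  assumes B [measurable]: "B \<in> sets FT" and D [measurable]: "D \<in> sets (path_space borel)"
    and D' [measurable]: "D' \<in> sets family_space"
  shows "emeasure M {\<omega>\<in>phase_event B. restart \<omega> \<in> D \<and> later_family j \<omega> \<in> D'} =
    emeasure M (phase_event B) * (emeasure path_law D * emeasure family_law D')"
proof -
  interpret path_law: prob_space path_law by (rule prob_space_path_law)
  interpret family_law: prob_space family_law by (rule prob_space_family_law)
  define Z where "Z = {\<omega>\<in>space M. later_family j \<omega> \<in> D'}"
  have [measurable]: "Z \<in> sets M" unfolding Z_def by measurable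
  \<comment> \<open>The later pieces do not vary with n. Absorbing the condition on them into the
    measure leaves a single path, the situation of \<open>indep_limit\<close>.\<close>
  define N where "N = density M (indicator Z)"
  have [measurable_cong]: "sets N = sets M" and space_N: "space N = space M" by (simp_all add: N_def)
  have N: "emeasure N A = emeasure M (A \<inter> Z)" if "A \<in> sets M" for A
    using that unfolding N_def by (rule emeasure_density_indicator) simp
  have fin: "finite_measure N"
    by (rule finite_measureI) (use emeasure_finite in \<open>simp add: space_N N\<close>)
  have top: "space (path_space borel) \<in> sets (path_space (borel :: real measure))" by simp
  have full: "emeasure path_law (space (path_space borel)) = 1"
    using path_law.emeasure_space_1 sets_eq_imp_space_eq[OF sets_path_law] by simp
  have grid_N: "emeasure N {\<omega>\<in>grid_event B n. shifted j (Rgrid n \<omega>) \<omega> \<in> D0} =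
      emeasure M (grid_event B n) * (emeasure path_law D0 * emeasure family_law D')"
    if [measurable]: "D0 \<in> sets (path_space borel)" for D0 n
  proof -
    have "{\<omega>\<in>grid_event B n. shifted j (Rgrid n \<omega>) \<omega> \<in> D0} =
        grid_event B n \<inter> {\<omega>\<in>space M. shifted j (Rgrid n \<omega>) \<omega> \<in> D0}"
      using sets.sets_into_space[OF grid_event_sets[OF B]] by auto
    also have "\<dots> \<in> sets M" by measurable
    finally have "emeasure N {\<omega>\<in>grid_event B n. shifted j (Rgrid n \<omega>) \<omega> \<in> D0} =
        emeasure M ({\<omega>\<in>grid_event B n. shifted j (Rgrid n \<omega>) \<omega> \<in> D0} \<inter> Z)" by (rule N)
    also have "{\<omega>\<in>grid_event B n. shifted j (Rgrid n \<omega>) \<omega> \<in> D0} \<inter> Z =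
        {\<omega>\<in>grid_event B n. shifted j (Rgrid n \<omega>) \<omega> \<in> D0 \<and> later_family j \<omega> \<in> D'}"
      using sets.sets_into_space[OF grid_event_sets[OF B]] by (auto simp: Z_def)
    finally show ?thesis using emeasure_grid_event[OF B that D'] by simp
  qed
  \<comment> \<open>Taking the whole path space gives the mass of the grid event under
    \<open>N\<close>, which turns \<open>grid_N\<close> into a product formula under
    \<open>N\<close> itself.\<close>
  have grid_full: "emeasure N (grid_event B n) = emeasure M (grid_event B n) * emeasure family_law D'" for n
  proof -
    have "{\<omega>\<in>grid_event B n. shifted j (Rgrid n \<omega>) \<omega> \<in> space (path_space borel)} = grid_event B n"
      using sets.sets_into_space[OF grid_event_sets[OF B]] measurable_space[OF grid_restart_measurable] by auto
    then show ?thesis using grid_N[OF top, of n] full by simp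
  qed
  have sub: "grid_event B n \<subseteq> phase_event B" for n by (auto simp: grid_event_def)
  have main: "emeasure N {\<omega>\<in>phase_event B. restart \<omega> \<in> D} = emeasure N (phase_event B) * emeasure path_law D"
  proof (rule indep_limit[where W = "\<lambda>n \<omega>. shifted j (Rgrid n \<omega>) \<omega>" and E = "grid_event B" and I = "{0..}"])
    show "(\<lambda>n. shifted j (Rgrid n \<omega>) \<omega> u) \<longlonglongrightarrow> restart \<omega> u" if "\<omega> \<in> phase_event B" "u \<in> {0..}" for \<omega> u
      using that sets.sets_into_space[OF phase_event_sets[OF B]]
      by (intro shifted_tendsto R_nonneg Rgrid_tendsto Rgrid_bounds) auto
    show "emeasure N {\<omega>\<in>grid_event B n. shifted j (Rgrid n \<omega>) \<omega> \<in> D0} =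
        emeasure N (grid_event B n) * emeasure path_law D0"
      if "D0 \<in> sets (path_space borel)" for n D0
      using grid_N[OF that] grid_full by (simp add: mult_ac)
  qed (use sub grid_event_eventually in \<open>auto simp: fin prob_space_path_law sets_path_law\<close>)
  have "emeasure N (phase_event B) = emeasure M (phase_event B) * emeasure family_law D'"
  proof (rule LIMSEQ_unique)
    show "(\<lambda>n. emeasure N (grid_event B n)) \<longlonglongrightarrow> emeasure N (phase_event B)"
      by (rule emeasure_tendsto_of_eventually[OF fin _ _ sub grid_event_eventually]) auto
    have "(\<lambda>n. emeasure M (grid_event B n)) \<longlonglongrightarrow> emeasure M (phase_event B)"
      by (rule emeasure_tendsto_of_eventually[OF finite_measure_axioms _ _ sub grid_event_eventually]) auto
    then have "(\<lambda>n. emeasure family_law D' * emeasure M (grid_event B n)) \<longlonglongrightarrow>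
        emeasure family_law D' * emeasure M (phase_event B)"
      by (intro ennreal_tendsto_cmult) (simp add: less_top[symmetric] family_law.emeasure_finite)
    then show "(\<lambda>n. emeasure N (grid_event B n)) \<longlonglongrightarrow> emeasure M (phase_event B) * emeasure family_law D'"
      unfolding grid_full by (simp add: mult.commute)
  qed
  moreover have "emeasure N {\<omega>\<in>phase_event B. restart \<omega> \<in> D} =
      emeasure M {\<omega>\<in>phase_event B. restart \<omega> \<in> D \<and> later_family j \<omega> \<in> D'}"
  proof -
    have "{\<omega>\<in>phase_event B. restart \<omega> \<in> D} = phase_event B \<inter> {\<omega>\<in>space M. restart \<omega> \<in> D}"
      using sets.sets_into_space[OF phase_event_sets[OF B]] by auto
    also have "\<dots> \<in> sets M" by measurable
    finally have "emeasure N {\<omega>\<in>phase_event B. restart \<omega> \<in> D} = emeasure M ({\<omega>\<in>phase_event B. restart \<omega> \<in> D} \<inter> Z)"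
      by (rule N)
    also have "{\<omega>\<in>phase_event B. restart \<omega> \<in> D} \<inter> Z = {\<omega>\<in>phase_event B. restart \<omega> \<in> D \<and> later_family j \<omega> \<in> D'}"
      using sets.sets_into_space[OF phase_event_sets[OF B]] by (auto simp: Z_def)
    finally show ?thesis .
  qed
  ultimately show ?thesis using main by (simp add: mult_ac)
qed

end

subsection \<open>Conditional law of the process after a stopping time\<close>

context iid_subordinators
begin

definition transition :: "(real \<Rightarrow> real option) set \<Rightarrow> real option \<Rightarrow> ennreal" where
  "transition \<Gamma> y = emeasure (distr M (path_space censored_state) (path (X y))) \<Gamma>"

lemma transition_measurable [measurable]:
  assumes "\<Gamma> \<in> sets (path_space censored_state)"
  shows "transition \<Gamma> \<in> borel_measurable censored_state"
  unfolding transition_def[abs_def]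
  using measurable_emeasure_kernel[OF measurable_prob_algebraD[OF measurable_kernel] assms] .

lemma transition_le_1: "y \<in> space censored_state \<Longrightarrow> transition \<Gamma> y \<le> 1"
  unfolding transition_def
  using prob_space.emeasure_le_1[OF prob_space_distr[OF measurable_path_X]] by blast

lemma transition_None:
  assumes "\<Gamma> \<in> sets (path_space censored_state)"
  shows "transition \<Gamma> None = indicator \<Gamma> (\<lambda>t\<in>{0..}. None)"
proof -
  have None: "None \<in> space censored_state" by (simp add: space_censored_state)
  have "path (X None) -` \<Gamma> \<inter> space M = (if (\<lambda>t\<in>{0..}. None) \<in> \<Gamma> then space M else {})"
    by (auto simp: path_def)
  then show ?thesis
    unfolding transition_def by (simp add: emeasure_distr[OF measurable_path_X[OF None] assms] emeasure_space_1)
qed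

lemma transition_Some:
  assumes v: "0 < v" and \<Gamma>: "\<Gamma> \<in> sets (path_space censored_state)"
  shows "transition \<Gamma> (Some v) = emeasure family_law {s\<in>space family_space. path_functional (v, s) \<in> \<Gamma>}"
proof -
  have Some: "Some v \<in> space censored_state" using v by (simp add: space_censored_state)
  have [measurable]: "path_functional \<in> borel \<Otimes>\<^sub>M family_space \<rightarrow>\<^sub>M path_space censored_state"
    by (rule measurable_path_functional)
  have sets: "{s\<in>space family_space. path_functional (v, s) \<in> \<Gamma>} \<in> sets family_space"
    using \<Gamma> by measurable
  have "transition \<Gamma> (Some v) = emeasure M (path (X (Some v)) -` \<Gamma> \<inter> space M)"
    unfolding transition_def by (rule emeasure_distr[OF measurable_path_X[OF Some] \<Gamma>])
  also have "path (X (Some v)) -` \<Gamma> \<inter> space M =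
      family -` {s\<in>space family_space. path_functional (v, s) \<in> \<Gamma>} \<inter> space M"
    using measurable_space[OF measurable_family] by (auto simp: path_X_Some simp del: censored_subordinator.simps)
  also have "emeasure M \<dots> = emeasure (distr M family_space family) {s\<in>space family_space. path_functional (v, s) \<in> \<Gamma>}"
    by (rule emeasure_distr[OF measurable_family sets, symmetric])
  finally show ?thesis unfolding distr_family .
qed

text \<open>Prepending an independent path of the common law to an i.i.d. sequence gives an i.i.d.
  sequence of the same law. Hence the restarted piece followed by the later pieces can replace the
  original family.\<close>

lemma emeasure_case_nat:
  assumes A: "A \<in> sets family_space"
  shows "emeasure (path_law \<Otimes>\<^sub>M family_law) {p\<in>space (path_space borel \<Otimes>\<^sub>M family_space). case_nat (fst p) (snd p) \<in> A} =
    emeasure family_law A"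
proof -
  interpret path_law: prob_space path_law by (rule prob_space_path_law)
  interpret sequence_space path_law ..
  have "(\<lambda>(w, s). case_nat w s) \<in> path_law \<Otimes>\<^sub>M family_law \<rightarrow>\<^sub>M family_law"
    by measurable
  from emeasure_distr[OF this, of A]
  have "emeasure family_law A = emeasure (path_law \<Otimes>\<^sub>M family_law)
      ((\<lambda>(w, s). case_nat w s) -` A \<inter> space (path_law \<Otimes>\<^sub>M family_law))"
    using A by (simp only: PiM_iter sets_family_law)
  also have "(\<lambda>(w, s). case_nat w s) -` A \<inter> space (path_law \<Otimes>\<^sub>M family_law) =
      {p\<in>space (path_space borel \<Otimes>\<^sub>M family_space). case_nat (fst p) (snd p) \<in> A}"
    using sets_eq_imp_space_eq[OF sets_path_law] sets_eq_imp_space_eq[OF sets_family_law]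
    by (auto simp: space_pair_measure)
  finally show ?thesis by simp
qed

end

context stopped
begin

lemma subalgebra_FT: "subalgebra M FT"
  by (simp add: subalgebra_def space_pre_sigma sets_FT_subset)

lemma VT_measurable_M [measurable]: "VT \<in> borel_measurable M"
  by (rule measurable_from_subalg[OF subalgebra_FT VT_measurable])

end

context stopped_Some
begin

text \<open>The state at \<open>T\<close> is measurable with respect to \<open>FT\<close>, so a
  condition on it can be absorbed into B. Applying \<open>emeasure_restart\<close> to the smaller
  event makes the state independent of the new pieces under the restricted measure.\<close>

lemma law_at_T:
  assumes B [measurable]: "B \<in> sets FT"
  defines "N \<equiv> density M (indicator (phase_event B))"
  shows "distr N borel VT \<Otimes>\<^sub>M (path_law \<Otimes>\<^sub>M family_law) =
    distr N (borel \<Otimes>\<^sub>M (path_space borel \<Otimes>\<^sub>M family_space)) (\<lambda>\<omega>. (VT \<omega>, restart \<omega>, later_family j \<omega>))"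
proof -
  let ?J = "distr N (borel \<Otimes>\<^sub>M (path_space borel \<Otimes>\<^sub>M family_space)) (\<lambda>\<omega>. (VT \<omega>, restart \<omega>, later_family j \<omega>))"
  interpret path_law: prob_space path_law by (rule prob_space_path_law)
  interpret family_law: prob_space family_law by (rule prob_space_family_law)
  interpret pf: pair_prob_space path_law family_law ..
  have [measurable_cong]: "sets N = sets M" by (simp add: N_def)
  have N: "emeasure N A = emeasure M (A \<inter> phase_event B)" if "A \<in> sets M" for A
    using that unfolding N_def by (rule emeasure_density_indicator) measurable
  have fin: "finite_measure (distr N borel VT)"
    by (rule finite_measureI)
      (use sets_eq_imp_space_eq[of N M] in \<open>simp add: emeasure_distr N N_def emeasure_density_indicator\<close>)
  have rect: "emeasure (distr N borel VT) A * emeasure (path_law \<Otimes>\<^sub>M family_law) X' =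
    emeasure ?J (A \<times> X')"
    if A: "A \<in> sets borel" and X': "X' \<in> sets (path_law \<Otimes>\<^sub>M family_law)" for A X'
  proof -
    \<comment> \<open>The condition on the state becomes part of the event of \<open>FT\<close>; its
      mass \<open>?c\<close> is then the marginal mass of A.\<close>
    define C where "C = {\<omega>\<in>B. VT \<omega> \<in> A}"
    have C [measurable]: "C \<in> sets FT"
    proof -
      have "C = B \<inter> (VT -` A \<inter> space FT)"
        using sets.sets_into_space[OF B] by (auto simp: C_def)
      then show ?thesis using measurable_sets[OF VT_measurable A] B by auto
    qed
    have phase_C: "phase_event C = {\<omega>\<in>phase_event B. VT \<omega> \<in> A}" by (auto simp: C_def phase_event_def)
    let ?c = "emeasure M (phase_event C)"
    let ?L = "distr (density M (indicator (phase_event C))) (path_space borel \<Otimes>\<^sub>M family_space) (\<lambda>\<omega>. (restart \<omega>, later_family j \<omega>))"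
    have X'' [measurable]: "X' \<in> sets (path_space borel \<Otimes>\<^sub>M family_space)"
      using X' sets_pair_measure_cong[OF sets_path_law sets_family_law] by simp
    \<comment> \<open>X' is an arbitrary set of pairs, so the factorization is first obtained on
      rectangles and extended. The mass \<open>?c\<close> is carried by the first factor.\<close>
    have law: "scale_measure ?c path_law \<Otimes>\<^sub>M family_law =
      ?L"
    proof (rule pair_measure_eqI)
      have "finite_measure (scale_measure ?c path_law)"
        by (rule finite_measureI) (simp add: space_scale_measure path_law.emeasure_space_1 emeasure_finite)
      then show "sigma_finite_measure (scale_measure ?c path_law)"
        by (simp add: finite_measure_def)
      show "sigma_finite_measure family_law" by (rule family_law.sigma_finite_measure_axioms)
      show "sets (scale_measure ?c path_law \<Otimes>\<^sub>M family_law) =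
        sets ?L"
        using sets_pair_measure_cong[of "scale_measure ?c path_law" "path_space borel" family_law family_space]
        by (simp add: sets_path_law sets_family_law)
      fix D D' assume "D \<in> sets (scale_measure ?c path_law)" "D' \<in> sets family_law"
      then have [measurable]: "D \<in> sets (path_space borel)" "D' \<in> sets family_space"
        by (simp_all add: sets_path_law sets_family_law)
      have "emeasure ?L (D \<times> D') =
        emeasure M {\<omega>\<in>phase_event C. (restart \<omega>, later_family j \<omega>) \<in> D \<times> D'}"
        by (rule emeasure_distr_on) measurable
      also have "\<dots> = ?c * (emeasure path_law D * emeasure family_law D')"
        using emeasure_restart[OF C, of D D'] by simp
      finally show "emeasure (scale_measure ?c path_law) D * emeasure family_law D' =
        emeasure ?L (D \<times> D')"
        by (simp add: mult.assoc)
    qed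
    have "emeasure (scale_measure ?c path_law \<Otimes>\<^sub>M family_law) X' = (\<integral>\<^sup>+w. emeasure family_law (Pair w -` X') \<partial>scale_measure ?c path_law)"
      using X' by (intro family_law.emeasure_pair_measure_alt) (simp cong: sets_pair_measure_cong)
    also have "\<dots> = ?c * (\<integral>\<^sup>+w. emeasure family_law (Pair w -` X') \<partial>path_law)"
      using X' by (intro nn_integral_scale_measure family_law.measurable_emeasure_Pair)
    also have "\<dots> = ?c * emeasure (path_law \<Otimes>\<^sub>M family_law) X'"
      using family_law.emeasure_pair_measure_alt[OF X'] by simp
    finally have "?c * emeasure (path_law \<Otimes>\<^sub>M family_law) X' =
      emeasure M {\<omega>\<in>phase_event C. (restart \<omega>, later_family j \<omega>) \<in> X'}"
      unfolding law by (subst (asm) emeasure_distr_on) auto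
    moreover have "emeasure (distr N borel VT) A = ?c"
      unfolding N_def using A by (subst emeasure_distr_on) (auto simp: phase_C)
    moreover have "emeasure ?J (A \<times> X') =
      emeasure M {\<omega>\<in>phase_event C. (restart \<omega>, later_family j \<omega>) \<in> X'}"
      unfolding N_def using A by (subst emeasure_distr_on) (auto simp: phase_C intro!: arg_cong[where f = "emeasure M"])
    ultimately show ?thesis by simp
  qed
  show ?thesis
  proof (rule pair_measure_eqI)
    show "sigma_finite_measure (distr N borel VT)" using fin by (simp add: finite_measure_def)
    show "sigma_finite_measure (path_law \<Otimes>\<^sub>M family_law)" by (rule pf.sigma_finite_measure_axioms)
    show "sets (distr N borel VT \<Otimes>\<^sub>M (path_law \<Otimes>\<^sub>M family_law)) =
      sets ?J"
      by (simp add: sets_path_law sets_family_law cong: sets_pair_measure_cong)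
  qed (use rect in simp)
qed

text \<open>\<open>value_shift\<close> at time \<open>T\<close>, expressed through
  \<open>path_functional\<close>: the future is a fixed measurable function of the state at
  \<open>T\<close> and the restarted pieces.\<close>

lemma path_after_T:
  assumes \<omega>: "\<omega> \<in> space M" and ph: "tau \<omega> \<le> T \<omega>" "T \<omega> < tau \<omega> + sig \<omega>" and pos: "0 < VT \<omega>"
  shows "path (\<lambda>t. X (Some x) (enn2real (T \<omega>) + t)) \<omega> = path_functional (VT \<omega>, case_nat (restart \<omega>) (later_family j \<omega>))"
proof -
  have fin: "T \<omega> < \<top>" using ph(2) by (rule less_le_trans) simp
  obtain a where a: "0 \<le> a" "tau \<omega> = ennreal a" "T \<omega> = ennreal (a + R \<omega>)" using tau_T_cases[OF ph(1) fin] .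
  have T: "enn2real (T \<omega>) = a + R \<omega>" using a R_nonneg[of \<omega>] by (simp del: ennreal_plus)
  interpret censored "pieces \<omega>" x using censored_pieces[OF \<omega>, of x] x by simp
  have ip: "in_phase (pieces \<omega>) x (a + R \<omega>) j"
    using ph a by (simp add: in_phase_def tau_Suc)
  have VT: "VT \<omega> = censored_value (pieces \<omega>) x (a + R \<omega>)"
    using fin T by (simp add: VT_def V_Some)
  define s where "s = case_nat (\<lambda>u. S j (R \<omega> + u) \<omega> - S j (R \<omega>) \<omega>) (\<lambda>k u. S (Suc j + k) u \<omega>)"
  have s: "increasing_path (s k)" for k
    using increasing_path_cmp[OF path R_nonneg, of j \<omega>] path by (cases k) (auto simp: s_def)
  have eq: "case_nat (restart \<omega>) (later_family j \<omega>) k u = s k u" if "0 \<le> u" for k u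
    using that by (cases k) (auto simp: s_def shifted_apply later_family_def path_def)
  have "X (Some x) (enn2real (T \<omega>) + u) \<omega> = censored_path s (VT \<omega>) u" if u: "0 \<le> u" for u
  proof -
    have "censored_value (pieces \<omega>) x (a + R \<omega> + u) = censored_value s (VT \<omega>) u"
      using value_shift[OF _ ip _ u] pos a R_nonneg[of \<omega>] by (simp add: VT s_def)
    then show ?thesis
      unfolding X_eq T V_Some by (simp add: censored_path_eq_value)
  qed
  then have "path (\<lambda>t. X (Some x) (enn2real (T \<omega>) + t)) \<omega> = (\<lambda>t\<in>{0..}. censored_path s (VT \<omega>) t)"
    by (auto simp: path_def simp del: censored_subordinator.simps)
  also have "\<dots> = path_functional (VT \<omega>, case_nat (restart \<omega>) (later_family j \<omega>))"
    by (rule path_functional_eq[symmetric]) (use s eq in auto)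
  finally show ?thesis .
qed

text \<open>By \<open>law_at_T\<close> the state and the new pieces have a product law, so Fubini
  integrates out the pieces first. For a fixed positive state the inner integral is the transition
  probability, by \<open>emeasure_case_nat\<close>.\<close>

lemma emeasure_path_after_T:
  assumes B [measurable]: "B \<in> sets FT" and \<Gamma>: "\<Gamma> \<in> sets (path_space censored_state)"
  shows "emeasure M {\<omega>\<in>phase_event B. 0 < VT \<omega> \<and> path (\<lambda>t. X (Some x) (enn2real (T \<omega>) + t)) \<omega> \<in> \<Gamma>} =
    (\<integral>\<^sup>+\<omega>. indicator (phase_event B) \<omega> * (if 0 < VT \<omega> then transition \<Gamma> (of_value (VT \<omega>)) else 0) \<partial>M)"
proof -
  interpret path_law: prob_space path_law by (rule prob_space_path_law)
  interpret family_law: prob_space family_law by (rule prob_space_family_law)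
  interpret pf: pair_prob_space path_law family_law ..
  note \<Gamma> [measurable]
  have [measurable]: "path_functional \<in> borel \<Otimes>\<^sub>M family_space \<rightarrow>\<^sub>M path_space censored_state"
    by (rule measurable_path_functional)
  let ?P = "borel \<Otimes>\<^sub>M (path_space borel \<Otimes>\<^sub>M family_space)"
  let ?W = "\<lambda>\<omega>. (VT \<omega>, restart \<omega>, later_family j \<omega>)"
  define N where "N = density M (indicator (phase_event B))"
  \<comment> \<open>Positivity is built in because the identification of the future in
    \<open>path_after_T\<close> is for a live state; the cemetery is treated separately.\<close>
  define A where "A = {p\<in>space ?P. 0 < fst p \<and> path_functional (fst p, case_nat (fst (snd p)) (snd (snd p))) \<in> \<Gamma>}"
  have A: "A \<in> sets ?P" unfolding A_def by measurable
  have sub: "phase_event B \<subseteq> space M" by (rule sets.sets_into_space[OF phase_event_sets[OF B]])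
  have W: "?W \<in> M \<rightarrow>\<^sub>M ?P" by measurable
  have "emeasure M {\<omega>\<in>phase_event B. 0 < VT \<omega> \<and> path (\<lambda>t. X (Some x) (enn2real (T \<omega>) + t)) \<omega> \<in> \<Gamma>} =
    emeasure M {\<omega>\<in>phase_event B. ?W \<omega> \<in> A}"
  proof (intro arg_cong[where f = "emeasure M"] Collect_cong conj_cong refl)
    fix \<omega> assume "\<omega> \<in> phase_event B"
    then have \<omega>: "\<omega> \<in> space M" "tau \<omega> \<le> T \<omega>" "T \<omega> < tau \<omega> + sig \<omega>" using sub by (auto simp: phase_event_def)
    show "0 < VT \<omega> \<and> path (\<lambda>t. X (Some x) (enn2real (T \<omega>) + t)) \<omega> \<in> \<Gamma> \<longleftrightarrow> ?W \<omega> \<in> A"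
      using path_after_T[OF \<omega>] measurable_space[OF W \<omega>(1)] by (auto simp: A_def simp del: censored_subordinator.simps)
  qed
  also have "\<dots> = emeasure (distr N ?P ?W) A"
    unfolding N_def by (rule emeasure_distr_on[symmetric, OF W _ A]) measurable
  also have "\<dots> = emeasure (distr N borel VT \<Otimes>\<^sub>M (path_law \<Otimes>\<^sub>M family_law)) A"
    unfolding N_def using law_at_T[OF B] by simp
  also have "\<dots> = (\<integral>\<^sup>+v. emeasure (path_law \<Otimes>\<^sub>M family_law) (Pair v -` A) \<partial>distr N borel VT)"
    using A by (intro pf.emeasure_pair_measure_alt)
      (simp add: sets_path_law sets_family_law cong: sets_pair_measure_cong)
  also have "\<dots> = (\<integral>\<^sup>+v. (if 0 < v then transition \<Gamma> (of_value v) else 0) \<partial>distr N borel VT)"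
  proof (rule nn_integral_cong)
    fix v :: real
    show "emeasure (path_law \<Otimes>\<^sub>M family_law) (Pair v -` A) = (if 0 < v then transition \<Gamma> (of_value v) else 0)"
    proof (cases "0 < v")
      case True
      have sets: "{s\<in>space family_space. path_functional (v, s) \<in> \<Gamma>} \<in> sets family_space" by measurable
      have cn: "case_nat w s \<in> space family_space" if "w \<in> space (path_space borel)" "s \<in> space family_space" for w s
        using that by (auto simp: space_PiM PiE_iff split: nat.split)
      have "Pair v -` A = {p\<in>space (path_space borel \<Otimes>\<^sub>M family_space).
          case_nat (fst p) (snd p) \<in> {s\<in>space family_space. path_functional (v, s) \<in> \<Gamma>}}"
        using True cn by (auto simp: A_def space_pair_measure)
      then show ?thesis
        using emeasure_case_nat[OF sets] transition_Some[OF True \<Gamma>] True by (simp add: of_value_def)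
    next
      case False
      then have "Pair v -` A = {}" by (auto simp: A_def)
      then show ?thesis using False by simp
    qed
  qed
  also have "\<dots> = (\<integral>\<^sup>+\<omega>. indicator (phase_event B) \<omega> * (if 0 < VT \<omega> then transition \<Gamma> (of_value (VT \<omega>)) else 0) \<partial>M)"
  proof -
    have [measurable]: "(\<lambda>v. of_value v) \<in> borel \<rightarrow>\<^sub>M censored_state"
      by (rule measurable_of_value) simp
    have "(\<lambda>v. if 0 < v then transition \<Gamma> (of_value v) else 0) \<in> borel_measurable borel" by measurable
    then show ?thesis
      unfolding N_def by (rule nn_integral_distr_on[rotated 2]) measurable
  qed
  finally show ?thesis .
qed

end

section \<open>Combining the phases and passing to conditional expectations\<close>

context stopped
begin

text \<open>The process is nonincreasing and right continuous, so exceeding a level at a random time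
  is witnessed by a later rational time.\<close>

lemma measurable_V_random:
  assumes \<rho> [measurable]: "\<rho> \<in> borel_measurable M" and nonneg: "\<And>\<omega>. \<omega> \<in> space M \<Longrightarrow> 0 \<le> \<rho> \<omega>"
  shows "(\<lambda>\<omega>. V z (\<rho> \<omega>) \<omega>) \<in> borel_measurable M"
  unfolding borel_measurable_iff_greater
proof
  fix c
  have "{\<omega>\<in>space M. c < V z (\<rho> \<omega>) \<omega>} = (\<Union>q\<in>{q\<in>\<rat>. 0 \<le> q}. {\<omega>\<in>space M. \<rho> \<omega> \<le> q \<and> c < V z q \<omega>})"
  proof (intro set_eqI iffI)
    fix \<omega> assume "\<omega> \<in> {\<omega>\<in>space M. c < V z (\<rho> \<omega>) \<omega>}"
    then have \<omega>: "\<omega> \<in> space M" "c < V z (\<rho> \<omega>) \<omega>" by auto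
    obtain b where b: "b > \<rho> \<omega>" "\<And>u. \<rho> \<omega> \<le> u \<Longrightarrow> u < b \<Longrightarrow> c < V z u \<omega>"
      using V_right[OF \<omega>(1) start nonneg[OF \<omega>(1)] \<omega>(2)] by blast
    obtain q where "q \<in> \<rat>" "\<rho> \<omega> < q" "q < b" using Rats_dense_in_real[OF b(1)] by blast
    then show "\<omega> \<in> (\<Union>q\<in>{q\<in>\<rat>. 0 \<le> q}. {\<omega>\<in>space M. \<rho> \<omega> \<le> q \<and> c < V z q \<omega>})"
      using b(2)[of q] nonneg[OF \<omega>(1)] \<omega>(1) by auto
  next
    fix \<omega> assume "\<omega> \<in> (\<Union>q\<in>{q\<in>\<rat>. 0 \<le> q}. {\<omega>\<in>space M. \<rho> \<omega> \<le> q \<and> c < V z q \<omega>})"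
    then obtain q where "\<omega> \<in> space M" "\<rho> \<omega> \<le> q" "c < V z q \<omega>" by blast
    then show "\<omega> \<in> {\<omega>\<in>space M. c < V z (\<rho> \<omega>) \<omega>}"
      using V_antimono[OF _ start nonneg, of \<omega> \<omega> q] by auto
  qed
  also have "\<dots> \<in> sets M"
  proof (rule sets.countable_UN''[OF countable_rats_on])
    fix q :: real assume "q \<in> {q\<in>\<rat>. 0 \<le> q}"
    then have [measurable]: "V z q \<in> borel_measurable M" by (intro measurable_V) auto
    show "{\<omega>\<in>space M. \<rho> \<omega> \<le> q \<and> c < V z q \<omega>} \<in> sets M" by measurable
  qed
  finally show "{\<omega>\<in>space M. c < V z (\<rho> \<omega>) \<omega>} \<in> sets M" .
qed

abbreviation after :: "'a \<Rightarrow> real \<Rightarrow> real option" where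
  "after \<omega> \<equiv> path (\<lambda>t. X z (enn2real (T \<omega>) + t)) \<omega>"

lemma after_measurable: "after \<in> M \<rightarrow>\<^sub>M path_space censored_state"
  unfolding path_def X_eq
  by (intro measurable_restrict measurable_of_value measurable_V_random) auto

text \<open>The conditional probability in extended nonnegative form. Its value 0 at infinite
  \<open>T\<close> matches the restriction to finite \<open>T\<close> in the event whose conditional
  expectation is taken.\<close>

definition transition_at_T :: "(real \<Rightarrow> real option) set \<Rightarrow> 'a \<Rightarrow> ennreal" where
  "transition_at_T \<Gamma> \<omega> = (if T \<omega> < \<top> then transition \<Gamma> (of_value (VT \<omega>)) else 0)"

lemma transition_at_T_measurable:
  assumes [measurable]: "\<Gamma> \<in> sets (path_space censored_state)"
  shows "transition_at_T \<Gamma> \<in> borel_measurable FT"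
proof -
  have [measurable]: "(\<lambda>\<omega>. of_value (VT \<omega>)) \<in> FT \<rightarrow>\<^sub>M censored_state"
    by (rule measurable_of_value) measurable
  show ?thesis unfolding transition_at_T_def[abs_def] by measurable
qed

lemma transition_at_T_le_1: "transition_at_T \<Gamma> \<omega> \<le> 1"
  by (simp add: transition_at_T_def transition_le_1 of_value_in_space)

text \<open>The outcomes of B split according to the phase containing \<open>T\<close>, plus a
  remainder where \<open>T\<close> is infinite or the process is dead. Each phase is handled by
  \<open>emeasure_path_after_T\<close>, and countable additivity combines them.\<close>

lemma emeasure_after:
  assumes B [measurable]: "B \<in> sets FT" and \<Gamma> [measurable]: "\<Gamma> \<in> sets (path_space censored_state)"
  defines "G \<equiv> {\<omega>\<in>space M. T \<omega> < \<top> \<and> after \<omega> \<in> \<Gamma>}"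
  shows "emeasure M (B \<inter> G) = (\<integral>\<^sup>+\<omega>. transition_at_T \<Gamma> \<omega> * indicator B \<omega> \<partial>M)"
proof -
  have BM [measurable]: "B \<in> sets M" using B sets_FT_subset by blast
  have sub: "B \<subseteq> space M" by (rule sets.sets_into_space[OF BM])
  note after_measurable [measurable]
  have K [measurable]: "transition_at_T \<Gamma> \<in> borel_measurable M"
    by (rule measurable_from_subalg[OF subalgebra_FT transition_at_T_measurable[OF \<Gamma>]])
  have G [measurable]: "G \<in> sets M" unfolding G_def by measurable
  define C where "C = {\<omega>\<in>B. T \<omega> < \<top> \<and> 0 < VT \<omega>}"
  have C: "C \<in> sets FT"
  proof -
    have "C = B \<inter> {\<omega>\<in>space FT. T \<omega> < \<top> \<and> 0 < VT \<omega>}"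
      using sub by (auto simp: C_def space_pre_sigma)
    also have "\<dots> \<in> sets FT" by (rule sets.Int[OF B]) measurable
    finally show ?thesis .
  qed
  \<comment> \<open>Index 0 collects the outcomes dead at \<open>T\<close> or with \<open>T\<close>
    infinite; index j + 1 is phase j. The default of \<open>value_of\<close> does no harm, since a
    live outcome forces z to be a positive state.\<close>
  define P where "P = case_nat (B - C) (\<lambda>j. {\<omega>\<in>C. in_phase (pieces \<omega>) (value_of z) (enn2real (T \<omega>)) j})"
  have phase_C: "\<exists>x>0. z = Some x \<and> (\<exists>j. in_phase (pieces \<omega>) x (enn2real (T \<omega>)) j)" if "\<omega> \<in> C" for \<omega>
  proof -
    have pos: "0 < V z (enn2real (T \<omega>)) \<omega>" using that by (auto simp: C_def VT_def)
    then obtain x where x: "z = Some x" by (cases z) (auto simp: V_None)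
    then have "0 < censored_value (pieces \<omega>) x (enn2real (T \<omega>))" using pos by (simp add: V_Some)
    then have "\<exists>j. in_phase (pieces \<omega>) x (enn2real (T \<omega>)) j"
      using censored_value_no_phase less_irrefl by metis
    then show ?thesis using x start by (auto simp: space_censored_state)
  qed
  have union: "(\<Union>i. P i) = B"
  proof
    show "(\<Union>i. P i) \<subseteq> B" by (auto simp: P_def C_def split: nat.splits)
    show "B \<subseteq> (\<Union>i. P i)"
    proof
      fix \<omega> assume "\<omega> \<in> B"
      show "\<omega> \<in> (\<Union>i. P i)"
      proof (cases "\<omega> \<in> C")
        case True
        then obtain j where "in_phase (pieces \<omega>) (value_of z) (enn2real (T \<omega>)) j"
          using phase_C[OF True] by (auto simp: value_of_def)
        then have "\<omega> \<in> P (Suc j)" using True by (simp add: P_def)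
        then show ?thesis by blast
      next
        case False
        then have "\<omega> \<in> P 0" using \<open>\<omega> \<in> B\<close> by (simp add: P_def)
        then show ?thesis by blast
      qed
    qed
  qed
  have disj: "disjoint_family P"
    using in_phase_unique by (auto simp: disjoint_family_on_def P_def split: nat.splits)
  have piece: "P i \<in> sets M \<and> emeasure M (P i \<inter> G) = (\<integral>\<^sup>+\<omega>. transition_at_T \<Gamma> \<omega> * indicator (P i) \<omega> \<partial>M)" for i
  proof (cases i)
    case 0
    have [measurable]: "C \<in> sets M" using C sets_FT_subset by blast
    have P0: "P 0 \<in> sets M" by (simp add: P_def)
    \<comment> \<open>If \<open>T\<close> is finite, the value is 0 at \<open>T\<close> and stays
      there by monotonicity, so both sides are the indicator of the constant cemetery path. If
      \<open>T\<close> is infinite, both sides vanish.\<close>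
    have "indicator (P 0 \<inter> G) \<omega> = transition_at_T \<Gamma> \<omega> * indicator (P 0) \<omega>" if \<omega>: "\<omega> \<in> space M" for \<omega>
    proof (cases "\<omega> \<in> P 0 \<and> T \<omega> < \<top>")
      case True
      then have "VT \<omega> \<le> 0" by (auto simp: P_def C_def)
      then have V0: "V z (enn2real (T \<omega>)) \<omega> \<le> 0" using True by (simp add: VT_def)
      have "X z (enn2real (T \<omega>) + t) \<omega> = None" if "0 \<le> t" for t
      proof -
        have "V z (enn2real (T \<omega>) + t) \<omega> \<le> V z (enn2real (T \<omega>)) \<omega>"
          using that by (intro V_antimono[OF \<omega> start]) auto
        then show ?thesis using V0 unfolding X_eq by (simp add: of_value_def)
      qed
      then have "after \<omega> = (\<lambda>t\<in>{0..}. None)" by (auto simp: path_def)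
      moreover have "transition_at_T \<Gamma> \<omega> = indicator \<Gamma> (\<lambda>t\<in>{0..}. None)"
        using True \<open>VT \<omega> \<le> 0\<close> transition_None[OF \<Gamma>] by (simp add: transition_at_T_def of_value_def)
      ultimately show ?thesis using True \<omega> by (simp add: G_def indicator_def)
    next
      case False
      then show ?thesis by (auto simp: G_def transition_at_T_def indicator_def)
    qed
    then have "(\<integral>\<^sup>+\<omega>. indicator (P 0 \<inter> G) \<omega> \<partial>M) = (\<integral>\<^sup>+\<omega>. transition_at_T \<Gamma> \<omega> * indicator (P 0) \<omega> \<partial>M)"
      by (intro nn_integral_cong) auto
    moreover have "(\<integral>\<^sup>+\<omega>. indicator (P 0 \<inter> G) \<omega> \<partial>M) = emeasure M (P 0 \<inter> G)"
      using P0 G by (intro nn_integral_indicator) auto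
    ultimately show ?thesis using P0 0 by simp
  next
    case (Suc j)
    show ?thesis
    \<comment> \<open>A live outcome is what shows that z is a positive state, and this is needed to
      enter \<open>stopped_Some\<close>; without one the piece is empty.\<close>
    proof (cases "C = {}")
      case True
      then show ?thesis using Suc by (simp add: P_def)
    next
      case False
      then obtain x where x: "0 < x" "z = Some x" using phase_C by blast
      interpret p: stopped_Some M S x T j
        using x stopping by unfold_locales simp_all
      have CT: "C \<in> sets p.FT" using C x by simp
      have Pj: "p.phase_event C = P i"
      proof -
        have "p.tau \<omega> \<le> T \<omega> \<and> T \<omega> < p.tau \<omega> + p.sig \<omega> \<longleftrightarrow> in_phase (pieces \<omega>) (value_of z) (enn2real (T \<omega>)) j"
          if "\<omega> \<in> C" for \<omega>
        proof -
          have "ennreal (enn2real (T \<omega>)) = T \<omega>" using that by (simp add: C_def)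
          then show ?thesis by (simp add: in_phase_def tau_Suc x value_of_def)
        qed
        then show ?thesis by (auto simp: p.phase_event_def P_def Suc)
      qed
      have VT: "p.VT = VT" by (simp add: fun_eq_iff p.VT_def VT_def x)
      have on: "0 < VT \<omega> \<and> T \<omega> < \<top> \<and> \<omega> \<in> space M" if "\<omega> \<in> P i" for \<omega>
        using that sub by (auto simp: P_def Suc C_def)
      have "P i \<in> sets M" using p.phase_event_sets[OF CT] Pj by simp
      moreover have "{\<omega>\<in>P i. 0 < VT \<omega> \<and> after \<omega> \<in> \<Gamma>} = P i \<inter> G"
        using on by (auto simp: G_def)
      moreover have "(\<integral>\<^sup>+\<omega>. indicator (P i) \<omega> * (if 0 < VT \<omega> then transition \<Gamma> (of_value (VT \<omega>)) else 0) \<partial>M) =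
          (\<integral>\<^sup>+\<omega>. transition_at_T \<Gamma> \<omega> * indicator (P i) \<omega> \<partial>M)"
        using on by (intro nn_integral_cong) (auto simp: indicator_def transition_at_T_def)
      ultimately show ?thesis
        using p.emeasure_path_after_T[OF CT \<Gamma>] unfolding Pj VT x(2)[symmetric] by simp
    qed
  qed
  have "emeasure M (B \<inter> G) = (\<Sum>i. emeasure M (P i \<inter> G))"
  proof (subst suminf_emeasure)
    show "disjoint_family (\<lambda>i. P i \<inter> G)" using disj by (rule disjoint_family_subset) auto
    have "B \<inter> G = (\<Union>i. P i \<inter> G)" using union by auto
    then show "emeasure M (B \<inter> G) = emeasure M (\<Union>i. P i \<inter> G)" by simp
  qed (use piece G in auto)
  also have "\<dots> = (\<Sum>i. emeasure (density M (transition_at_T \<Gamma>)) (P i))"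
    using piece by (simp add: emeasure_density)
  also have "\<dots> = emeasure (density M (transition_at_T \<Gamma>)) B"
    using piece disj by (subst suminf_emeasure) (auto simp: union)
  also have "\<dots> = (\<integral>\<^sup>+\<omega>. transition_at_T \<Gamma> \<omega> * indicator B \<omega> \<partial>M)"
    by (simp add: emeasure_density)
  finally show ?thesis .
qed

text \<open>\<open>emeasure_after\<close> is the averaging identity characterizing conditional
  expectation, in extended form; the bound by 1 allows its translation into real integrals.\<close>

lemma strong_markov:
  assumes \<Gamma> [measurable]: "\<Gamma> \<in> sets (path_space censored_state)"
  shows "AE \<omega> in M. T \<omega> < \<top> \<longrightarrow>
    real_cond_exp M FT (indicator {\<omega>\<in>space M. T \<omega> < \<top> \<and> after \<omega> \<in> \<Gamma>}) \<omega> =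
    measure (distr M (path_space censored_state) (path (X (X z (enn2real (T \<omega>)) \<omega>)))) \<Gamma>"
proof -
  interpret finite_measure_subalgebra M FT
    by unfold_locales (rule subalgebra_FT)
  note after_measurable [measurable]
  let ?G = "{\<omega>\<in>space M. T \<omega> < \<top> \<and> after \<omega> \<in> \<Gamma>}"
  have G [measurable]: "?G \<in> sets M" by measurable
  note transition_at_T_measurable[OF \<Gamma>, measurable]
  have K [measurable]: "transition_at_T \<Gamma> \<in> borel_measurable M"
    by (rule measurable_from_subalg[OF subalgebra_FT transition_at_T_measurable[OF \<Gamma>]])
  have fin: "transition_at_T \<Gamma> \<omega> < \<top>" for \<omega>
    using transition_at_T_le_1[of \<Gamma> \<omega>] by (rule le_less_trans) simp
  have "AE \<omega> in M. real_cond_exp M FT (indicator ?G) \<omega> = enn2real (transition_at_T \<Gamma> \<omega>)"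
  proof (rule real_cond_exp_charact)
    fix A assume A: "A \<in> sets FT"
    then have [measurable]: "A \<in> sets M" using sets_FT_subset by blast
    have "(\<integral>\<omega>\<in>A. indicator ?G \<omega> \<partial>M) = (\<integral>\<omega>. indicator (A \<inter> ?G) \<omega> \<partial>M)"
      unfolding set_lebesgue_integral_def by (intro Bochner_Integration.integral_cong) (auto simp: indicator_def)
    also have "\<dots> = measure M (A \<inter> ?G)"
      using sets.sets_into_space[OF \<open>A \<in> sets M\<close>] by (simp add: Int_absorb2 Int_assoc)
    also have "\<dots> = enn2real (\<integral>\<^sup>+\<omega>. transition_at_T \<Gamma> \<omega> * indicator A \<omega> \<partial>M)"
      using emeasure_after[OF A \<Gamma>] by (simp add: measure_def)
    also have "(\<integral>\<^sup>+\<omega>. transition_at_T \<Gamma> \<omega> * indicator A \<omega> \<partial>M) =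
      (\<integral>\<^sup>+\<omega>. ennreal (indicator A \<omega> *\<^sub>R enn2real (transition_at_T \<Gamma> \<omega>)) \<partial>M)"
      using fin by (intro nn_integral_cong) (auto simp: indicator_def)
    also have "enn2real \<dots> = (\<integral>\<omega>\<in>A. enn2real (transition_at_T \<Gamma> \<omega>) \<partial>M)"
      unfolding set_lebesgue_integral_def by (rule integral_eq_nn_integral[symmetric]) auto
    finally show "(\<integral>\<omega>\<in>A. indicator ?G \<omega> \<partial>M) = (\<integral>\<omega>\<in>A. enn2real (transition_at_T \<Gamma> \<omega>) \<partial>M)" .
  next
    show "integrable M (indicator ?G :: _ \<Rightarrow> real)"
      by (intro integrable_real_indicator G) (simp add: less_top[symmetric] emeasure_finite)
    have "enn2real (transition_at_T \<Gamma> \<omega>) \<le> 1" for \<omega>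
      using enn2real_mono[OF transition_at_T_le_1[of \<Gamma> \<omega>]] by simp
    then show "integrable M (\<lambda>\<omega>. enn2real (transition_at_T \<Gamma> \<omega>))"
      by (intro integrable_const_bound[where B = 1]) auto
  qed measurable
  then show ?thesis
  proof (rule AE_mp, intro AE_I2 impI)
    fix \<omega> assume *: "real_cond_exp M FT (indicator ?G) \<omega> = enn2real (transition_at_T \<Gamma> \<omega>)" "T \<omega> < \<top>"
    have "enn2real (transition_at_T \<Gamma> \<omega>) =
      measure (distr M (path_space censored_state) (path (X (X z (enn2real (T \<omega>)) \<omega>)))) \<Gamma>"
      unfolding X_T[OF *(2)] using *(2) by (simp add: transition_at_T_def transition_def measure_def)
    then show "real_cond_exp M FT (indicator ?G) \<omega> =
      measure (distr M (path_space censored_state) (path (X (X z (enn2real (T \<omega>)) \<omega>)))) \<Gamma>"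
      using * by simp
  qed
qed

end

theorem (in iid_subordinators) strong_markov_censored_subordinator:
  "strong_markov_process censored_state (\<lambda>_. M) (censored_subordinator S)"
  unfolding strong_markov_process_def infinity_ennreal_def
proof (intro conjI ballI allI impI)
  fix z assume z: "z \<in> space censored_state"
  show "prob_space M" by (rule prob_space_axioms)
  show "X z t \<in> M \<rightarrow>\<^sub>M censored_state" if "0 \<le> t" for t using that by (rule measurable_X)
  show "AE \<omega> in M. X z 0 \<omega> = z" by (rule AE_I2) (rule X_start[OF _ z])
  fix T assume "stopping_time (F z) T"
  then interpret stopped M S z T using z by unfold_locales
  show "{\<omega>\<in>space M. T \<omega> < \<top> \<and> X z (enn2real (T \<omega>)) \<omega> \<in> A} \<in> sets FT" if "A \<in> sets censored_state" for A
    using that by (rule XT_measurable)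
  show "AE \<omega> in M. T \<omega> < \<top> \<longrightarrow>
    real_cond_exp M FT (indicator {\<omega>\<in>space M. T \<omega> < \<top> \<and> path (\<lambda>t. X z (enn2real (T \<omega>) + t)) \<omega> \<in> \<Gamma>}) \<omega> =
    measure (distr M (path_space censored_state) (path (X (X z (enn2real (T \<omega>)) \<omega>)))) \<Gamma>"
    if "\<Gamma> \<in> sets (path_space censored_state)" for \<Gamma>
    using that by (rule strong_markov)
qed (rule measurable_kernel)

theorem theorem5p1:
  fixes f :: "real \<Rightarrow> real" and \<mu> :: "real measure"
    and M :: "'a measure" and S :: "nat \<Rightarrow> real \<Rightarrow> 'a \<Rightarrow> real"
  assumes bernstein: "complete_bernstein f \<mu>"
    and "filterlim (\<lambda>l. 1 / f l) at_top (at_right 0)"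
    and "((\<lambda>l. 1 / f l) \<longlongrightarrow> 0) at_top"
    and "((\<lambda>l. l / f l) \<longlongrightarrow> 0) (at_right 0)"
    and "filterlim (\<lambda>l. l / f l) at_top at_top"
    and subordinators: "\<And>j. subordinator M (S j)"
    and laplace: "\<And>j t l. 0 \<le> t \<Longrightarrow> 0 < l \<Longrightarrow>
      (\<integral>\<omega>. exp (- l * S j t \<omega>) \<partial>M) = exp (- t * f l)"
    and iid: "iid_processes M S"
  shows "strong_markov_process censored_state (\<lambda>_. M) (censored_subordinator S)"
proof -
  \<comment> \<open>A single subordinator already supplies the fact that \<open>M\<close> is a
    probability space.\<close>
  interpret subordinator M "S 0" by (rule subordinators)
  interpret iid_subordinators M S
    by (intro iid_subordinators.intro iid_subordinators_axioms.intro prob_space_axioms subordinators iid)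
  show ?thesis by (rule strong_markov_censored_subordinator)
qed

end
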